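(* Let $K$ be a field with $\mathrm{char}(K)=0$ and let $G$ be a graph on $[n]$. Then $|\mathrm{gins}(I(G))|=1$ if and only if $G$ is a semi-complete bipartite graph.
   Context: $R=K[x_1,\dots,x_n]$ is the polynomial ring with each $\deg x_i=1$. A graph on $[n]=\{1,\dots,n\}$ is a $1$-dimensional simplicial complex on $[n]$ (every $i\in[n]$ is a vertex and there is at least one edge). The edge ideal $I(G)\subset R$ is generated by all squarefree monomials $x_ix_j$ with $\{i,j\}\in G$. For a homogeneous ideal $I\subset R$ and a term order $\sigma$, $\mathrm{gin}_\sigma(I)$ is the generic initial ideal, i.e. the constant value of the initial ideal $\mathrm{in}_\sigma(\varphi(I))$ for $\varphi$ in a suitable nonempty Zariski open subset of $GL_n(K)$, where $\varphi$ acts on $R$ by linear changes of variables. Set $\mathrm{gins}(I)=\{\mathrm{gin}_\sigma(I):\sigma$ a term order with $x_1>_\sigma\cdots>_\sigma x_n\}$. A graph is semi-complete bipartite if a complete bipartite graph can be obtained from it by deleting isolated vertices, i.e. it is a union of a complete bipartite graph and isolated vertices. *)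

theory Defs
  imports "HOL-Library.Poly_Mapping" "HOL-Analysis.Determinants"
begin

section \<open>Polynomial rings, linear substitutions and initial ideals\<close>

text \<open>
  The index set \<open>[n]\<close> is an arbitrary finite linearly ordered type \<open>'n\<close>, with
  \<open>n = CARD('n)\<close>; its order is used only to express \<open>x\<^sub>1 > \<dots> > x\<^sub>n\<close>. A monomial is
  its exponent vector, so a product of monomials is a sum of type \<open>'n monomial\<close>.
\<close>

type_synonym 'n monomial = "'n \<Rightarrow>\<^sub>0 nat"
type_synonym ('n, 'k) mpoly = "'n monomial \<Rightarrow>\<^sub>0 'k"

definition mono_poly :: "'n monomial \<Rightarrow> ('n, 'k::comm_ring_1) mpoly" where
  "mono_poly m = Poly_Mapping.single m 1"

definition const_poly :: "'k \<Rightarrow> ('n, 'k::comm_ring_1) mpoly" where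
  "const_poly c = Poly_Mapping.single 0 c"

definition var_mono :: "'n \<Rightarrow> 'n monomial" where
  "var_mono i = Poly_Mapping.single i 1"

abbreviation var :: "'n \<Rightarrow> ('n, 'k::comm_ring_1) mpoly" where
  "var i \<equiv> mono_poly (var_mono i)"

text \<open>\<open>ideal.span S\<close> is the ideal generated by \<open>S\<close>.\<close>

interpretation ideal: module "(*) :: 'a::comm_ring_1 \<Rightarrow> 'a \<Rightarrow> 'a"
  by unfold_locales (simp_all add: algebra_simps)

text \<open>
  \<open>poly_subst h v p\<close> maps the coefficients of \<open>p\<close> by \<open>h\<close> and replaces the variable \<open>i\<close> by \<open>v i\<close>.
\<close>

definition poly_subst ::
    "('k \<Rightarrow> 'a) \<Rightarrow> ('i \<Rightarrow> 'a) \<Rightarrow> ('i, 'k::comm_ring_1) mpoly \<Rightarrow> 'a::comm_ring_1" where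
  "poly_subst h v p =
     (\<Sum>m\<in>Poly_Mapping.keys p. h (Poly_Mapping.lookup p m) *
        (\<Prod>i\<in>Poly_Mapping.keys m. v i ^ Poly_Mapping.lookup m i))"

definition linear_change ::
    "'k^'n^'n \<Rightarrow> ('n::finite, 'k::comm_ring_1) mpoly \<Rightarrow> ('n, 'k) mpoly" where
  "linear_change A = poly_subst const_poly (\<lambda>j. \<Sum>i\<in>UNIV. const_poly (A $ i $ j) * var i)"

text \<open>\<open>(s, t) \<in> \<sigma>\<close> means \<open>s \<le> t\<close> with respect to \<open>\<sigma>\<close>.\<close>

definition term_order :: "'n monomial rel \<Rightarrow> bool" where
  "term_order \<sigma> \<longleftrightarrow> linear_order \<sigma> \<and> (\<forall>s. (0, s) \<in> \<sigma>) \<and>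
     (\<forall>s t u. (s, t) \<in> \<sigma> \<longrightarrow> (s + u, t + u) \<in> \<sigma>)"

definition decreasing_vars :: "'n::linorder monomial rel \<Rightarrow> bool" where
  "decreasing_vars \<sigma> \<longleftrightarrow> (\<forall>i j. i < j \<longrightarrow> (var_mono j, var_mono i) \<in> \<sigma> - Id)"

definition lead_mono :: "'n monomial rel \<Rightarrow> ('n, 'k::comm_ring_1) mpoly \<Rightarrow> 'n monomial" where
  "lead_mono \<sigma> p =
     (THE m. m \<in> Poly_Mapping.keys p \<and> (\<forall>t\<in>Poly_Mapping.keys p. (t, m) \<in> \<sigma>))"

definition initial_ideal ::
    "'n monomial rel \<Rightarrow> ('n, 'k::comm_ring_1) mpoly set \<Rightarrow> ('n, 'k) mpoly set" where
  "initial_ideal \<sigma> I = ideal.span {mono_poly (lead_mono \<sigma> p) |p. p \<in> I \<and> p \<noteq> 0}"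


section \<open>Generic initial ideals\<close>

text \<open>
  The Zariski topology on \<open>GL\<^sub>n(K)\<close> is the subspace topology of the affine space of matrices:
  an open set is the complement in \<open>GL\<^sub>n(K)\<close> of the common zeros of a set of polynomials in the
  matrix entries.
\<close>

definition zariski_open_GL :: "('k::field^'n^'n) set \<Rightarrow> bool" where
  "zariski_open_GL U \<longleftrightarrow>
     (\<exists>F :: ('n \<times> 'n, 'k) mpoly set.
        U = {A. invertible A \<and> (\<exists>f\<in>F. poly_subst id (\<lambda>(i, j). A $ i $ j) f \<noteq> 0)})"

definition gin ::
    "'n::finite monomial rel \<Rightarrow> ('n, 'k::field) mpoly set \<Rightarrow> ('n, 'k) mpoly set" where
  "gin \<sigma> I = (THE J. \<exists>U. zariski_open_GL U \<and> U \<noteq> {} \<and>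
     (\<forall>A\<in>U. initial_ideal \<sigma> (linear_change A ` I) = J))"

definition gins ::
    "('n::{finite, linorder}, 'k::field) mpoly set \<Rightarrow> ('n, 'k) mpoly set set" where
  "gins I = {gin \<sigma> I |\<sigma>. term_order \<sigma> \<and> decreasing_vars \<sigma>}"


section \<open>Graphs and edge ideals\<close>

definition graph :: "'n set set \<Rightarrow> bool" where
  "graph G \<longleftrightarrow> (\<forall>F\<in>G. \<forall>H\<subseteq>F. H \<in> G) \<and> (\<forall>i. {i} \<in> G) \<and>
     (\<forall>F\<in>G. finite F \<and> card F \<le> 2) \<and> (\<exists>F\<in>G. card F = 2)"

definition edge_ideal :: "'n set set \<Rightarrow> ('n, 'k::comm_ring_1) mpoly set" where
  "edge_ideal G = ideal.span {var i * var j |i j. i \<noteq> j \<and> {i, j} \<in> G}"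

definition isolated :: "'n set set \<Rightarrow> 'n \<Rightarrow> bool" where
  "isolated G i \<longleftrightarrow> {i} \<in> G \<and> (\<forall>j. j \<noteq> i \<longrightarrow> {i, j} \<notin> G)"

definition delete_vertices :: "'n set set \<Rightarrow> 'n set \<Rightarrow> 'n set set" where
  "delete_vertices G D = {F\<in>G. F \<inter> D = {}}"

text \<open>The vertex set of a complete bipartite graph is \<open>A \<union> B\<close>, so it need not be the whole type.\<close>

definition complete_bipartite :: "'n set set \<Rightarrow> bool" where
  "complete_bipartite G \<longleftrightarrow>
     (\<exists>A B. A \<noteq> {} \<and> B \<noteq> {} \<and> A \<inter> B = {} \<and>
        G = {{}} \<union> {{i} |i. i \<in> A \<union> B} \<union> {{a, b} |a b. a \<in> A \<and> b \<in> B})"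

definition semi_complete_bipartite :: "'n set set \<Rightarrow> bool" where
  "semi_complete_bipartite G \<longleftrightarrow>
     (\<exists>D. (\<forall>i\<in>D. isolated G i) \<and> complete_bipartite (delete_vertices G D))"

end

theory Submission
  imports Defs "HOL-Computational_Algebra.Polynomial"
begin

text \<open>
  If \<open>G\<close> is a union of isolated vertices and a complete bipartite graph with parts \<open>P\<close>, \<open>Q\<close> of sizes
  \<open>a \<le> b\<close>, then its edge ideal is a product of two linear ideals. For generic linear forms
  the quadrics \<open>v w' - v' w\<close>, with \<open>v, v'\<close> in the span of the first family and \<open>w, w'\<close> in the
  span of the second, have leading monomials \<open>x\<^sub>i x\<^sub>j\<close> (\<open>i \<le> j\<close>, \<open>i \<le> a\<close>, \<open>i + j \<le> a + b\<close>) for every term order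
  with decreasing variables. A count of monomials shows that nothing else is needed, so the
  generic initial ideal does not depend on the order.

  Otherwise the lexicographic and the reverse lexicographic generic initial ideals differ, in a
  monomial \<open>x\<^sub>1 x\<^sub>j\<^sup>e\<close> with \<open>e \<in> {1, 2}\<close>. It is a lexicographic leading monomial because it is one
  after a suitable specialization (a matrix straightening a spanning forest). If it were a reverse
  lexicographic leading monomial of a form \<open>F\<close>, then \<open>F\<close> would restrict to \<open>x\<^sub>j\<^sup>e m\<close> on the span \<open>L\<close> of the
  first \<open>j\<close> coordinate vectors, with \<open>m\<close> linear. The form vanishes on the image of the coordinate
  subspace of each independent set of vertices; those of dimension one more than the codimension of \<open>L\<close>
  meet \<open>L\<close> in a point where \<open>x\<^sub>j \<noteq> 0\<close>, hence \<open>m = 0\<close> there, and these points span \<open>L\<close>.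
\<close>

text \<open>What is lower semicontinuous in the matrix is not the membership of one monomial but the
  number of leading monomials in a set of one degree that is closed upwards. A specialization
  showing \<open>x_1 x_j^e\<close> to be leading must therefore make every larger monomial of degree
  \<open>e + 1\<close> leading too; the products \<open>x_1 x_i\<close> with \<open>i < j\<close>
  take care of this. The constants come from counting edges. With \<open>t\<close> components, two
  of them having edges, a spanning forest has \<open>n - t\<close> edges and gives
  \<open>x_1 x_i\<close> up to position \<open>n - t\<close>; independent sets of size
  \<open>t\<close> obstruct position \<open>n - t + 1\<close>, so the missing step is a cubic,
  \<open>e = 2\<close>. If one component has edges and \<open>s\<close> vertices are isolated, a
  tree reaches position \<open>n - s - 1\<close>, which is obstructed once the complement graph of
  the non-isolated part is connected, by independent sets of size \<open>s + 2\<close>. A triangle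
  gives one more edge, hence position \<open>n - s\<close>, where independent sets of size
  \<open>s + 1\<close> suffice. A graph outside these cases has one nontrivial component, with
  disconnected complement and no triangle, so that component is complete bipartite.\<close>

abbreviation lookup where "lookup \<equiv> Poly_Mapping.lookup"
abbreviation keys where "keys \<equiv> Poly_Mapping.keys"

section \<open>Linear independence of rows\<close>

text \<open>Rows and columns have arbitrary index types because the systems below are indexed by
  monomials, by vertices and by disjoint sums, and the index sets change within inductions.\<close>

definition rows_indep :: "'d set \<Rightarrow> 'c set \<Rightarrow> ('d \<Rightarrow> 'c \<Rightarrow> 'k::field) \<Rightarrow> bool" where
  "rows_indep D C M \<longleftrightarrow>
     (\<forall>u. (\<forall>c\<in>C. (\<Sum>d\<in>D. u d * M d c) = 0) \<longrightarrow> (\<forall>d\<in>D. u d = 0))"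

lemma rows_indepI:
  assumes "\<And>u d. \<forall>c\<in>C. (\<Sum>d\<in>D. u d * M d c) = 0 \<Longrightarrow> d \<in> D \<Longrightarrow> u d = 0"
  shows "rows_indep D C M"
  using assms unfolding rows_indep_def by blast

lemma rows_indepD:
  assumes "rows_indep D C M" "\<And>c. c \<in> C \<Longrightarrow> (\<Sum>d\<in>D. u d * M d c) = 0" "d \<in> D"
  shows "u d = 0"
  using assms unfolding rows_indep_def by blast

text \<open>Gaussian elimination: a pivot removes one equation and one unknown, so the surplus of
  unknowns survives the induction.\<close>

lemma underdetermined_system:
  fixes M :: "'d \<Rightarrow> 'c \<Rightarrow> 'k::field"
  assumes "finite C" "finite D" "card C < card D"
  shows "\<exists>u. (\<exists>d\<in>D. u d \<noteq> 0) \<and> (\<forall>c\<in>C. (\<Sum>d\<in>D. u d * M d c) = 0)"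
  using assms
proof (induction C arbitrary: D M rule: finite_induct)
  case empty
  then have "D \<noteq> {}" by auto
  then show ?case by (intro exI[of _ "\<lambda>_. 1"]) auto
next
  case (insert c C)
  show ?case
  proof (cases "\<forall>d\<in>D. M d c = 0")
    case True
    then show ?thesis using insert.IH[of D M] insert.prems insert.hyps by auto
  next
    case False
    then obtain e where e: "e \<in> D" "M e c \<noteq> 0" by blast
    define M' where "M' = (\<lambda>d x. M d x - M d c / M e c * M e x)"
    have "card C < card (D - {e})" "finite (D - {e})"
      using insert.prems insert.hyps e by (simp_all add: card_Diff_singleton)
    then obtain u where u: "\<exists>d\<in>D - {e}. u d \<noteq> 0" "\<forall>x\<in>C. (\<Sum>d\<in>D - {e}. u d * M' d x) = 0"
      using insert.IH[of "D - {e}" M'] by blast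
    define w where "w = u(e := - (\<Sum>d\<in>D - {e}. u d * M d c) / M e c)"
    have split: "(\<Sum>d\<in>D. w d * M d x) = w e * M e x + (\<Sum>d\<in>D - {e}. u d * M d x)" for x
      using e insert.prems(1) by (subst sum.remove[of D e]) (auto simp: w_def intro!: sum.cong)
    have "(\<Sum>d\<in>D. w d * M d x) = (\<Sum>d\<in>D - {e}. u d * M' d x)" for x
    proof -
      have "(\<Sum>d\<in>D - {e}. u d * M' d x)
          = (\<Sum>d\<in>D - {e}. u d * M d x - u d * M d c * (M e x / M e c))"
        by (simp add: M'_def right_diff_distrib)
      also have "\<dots> = (\<Sum>d\<in>D - {e}. u d * M d x) - (\<Sum>d\<in>D - {e}. u d * M d c) * (M e x / M e c)"
        by (simp only: sum_subtractf sum_distrib_right)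
      finally show ?thesis unfolding split by (simp add: w_def)
    qed
    moreover have "M' d c = 0" for d using e by (simp add: M'_def)
    ultimately have "\<forall>x\<in>insert c C. (\<Sum>d\<in>D. w d * M d x) = 0" using u(2) by auto
    moreover have "\<exists>d\<in>D. w d \<noteq> 0" using u(1) by (auto simp: w_def)
    ultimately show ?thesis by blast
  qed
qed

lemma rows_indep_card_le:
  assumes "finite C" "finite D" "rows_indep D C M"
  shows "card D \<le> card C"
  using underdetermined_system[OF assms(1,2), of M] assms(3) unfolding rows_indep_def
  by (meson not_le)

text \<open>The elimination is free of division, so entries that are polynomials in the entries of a
  matrix remain so; \<open>generic_rows_indep\<close> depends on this.\<close>

lemma rows_indep_eliminate:
  fixes M :: "'d \<Rightarrow> 'c \<Rightarrow> 'k::field"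
  assumes fin: "finite D" and e: "e \<notin> D" and ind: "rows_indep (insert e D) C M" and c: "M e c \<noteq> 0"
  shows "rows_indep D C (\<lambda>d x. M e c * M d x - M d c * M e x)"
proof (rule rows_indepI)
  fix u d assume z: "\<forall>x\<in>C. (\<Sum>d\<in>D. u d * (M e c * M d x - M d c * M e x)) = 0" and d: "d \<in> D"
  define w where "w = (\<lambda>d. u d * M e c)(e := - (\<Sum>d\<in>D. u d * M d c))"
  have "(\<Sum>d\<in>insert e D. w d * M d x) = 0" if "x \<in> C" for x
  proof -
    have "(\<Sum>d\<in>D. w d * M d x) = (\<Sum>d\<in>D. u d * M e c * M d x)"
      using e by (intro sum.cong) (auto simp: w_def)
    moreover have "(\<Sum>d\<in>insert e D. w d * M d x) = w e * M e x + (\<Sum>d\<in>D. w d * M d x)"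
      using fin e by simp
    moreover have "(\<Sum>d\<in>D. u d * (M e c * M d x - M d c * M e x))
        = (\<Sum>d\<in>D. u d * M e c * M d x) - (\<Sum>d\<in>D. u d * M d c) * M e x"
      by (simp only: right_diff_distrib sum_subtractf sum_distrib_right mult.assoc)
    ultimately show ?thesis using z that by (simp add: w_def)
  qed
  from rows_indepD[OF ind this, of d] d e c show "u d = 0"
    by (auto simp: w_def split: if_splits)
qed

lemma rows_indep_nonzero_entry:
  assumes "finite D" "e \<notin> D" "rows_indep (insert e D) C M"
  obtains c where "c \<in> C" "M e c \<noteq> 0"
proof (rule ccontr)
  assume "\<not> thesis"
  then have "\<And>c. c \<in> C \<Longrightarrow> M e c = 0" using that by blast
  then have "(\<Sum>d\<in>insert e D. (if d = e then 1 else 0) * M d c) = 0" if "c \<in> C" for c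
    using that assms(1,2) by (auto intro!: sum.neutral)
  from rows_indepD[OF assms(3) this, of e] show False by auto
qed

text \<open>Full row rank makes the system solvable for every right-hand side. The eliminated rows
  are solved first; they vanish in column \<open>c\<close>, so the unknown at \<open>c\<close> can
  still be adjusted to satisfy row \<open>e\<close>.\<close>

lemma rows_indep_solvable:
  fixes M :: "'d \<Rightarrow> 'c \<Rightarrow> 'k::field"
  assumes "finite D" "finite C" "rows_indep D C M"
  shows "\<exists>x. \<forall>d\<in>D. (\<Sum>c\<in>C. M d c * x c) = b d"
  using assms(1,3)
proof (induction D arbitrary: M b rule: finite_induct)
  case empty
  then show ?case by simp
next
  case (insert e D)
  obtain c where c: "c \<in> C" "M e c \<noteq> 0" using rows_indep_nonzero_entry[OF insert.hyps(1,2) insert.prems] by blast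
  define M' where "M' = (\<lambda>d x. M e c * M d x - M d c * M e x)"
  have "rows_indep D C M'" unfolding M'_def
    by (rule rows_indep_eliminate[OF insert.hyps(1,2) insert.prems c(2)])
  from insert.IH[OF this, of "\<lambda>d. M e c * b d - M d c * b e"]
  obtain y where y: "\<forall>d\<in>D. (\<Sum>x\<in>C. M' d x * y x) = M e c * b d - M d c * b e" by blast
  define t where "t = (b e - (\<Sum>x\<in>C. M e x * y x)) / M e c"
  define z where "z = y(c := y c + t)"
  have z: "(\<Sum>x\<in>C. N x * z x) = (\<Sum>x\<in>C. N x * y x) + N c * t" for N :: "'c \<Rightarrow> 'k"
  proof -
    have "(\<Sum>x\<in>C. N x * z x) = (\<Sum>x\<in>C. N x * y x + (if x = c then N c * t else 0))"
      by (intro sum.cong) (auto simp: z_def algebra_simps)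
    then show ?thesis using assms(2) c by (simp add: sum.distrib)
  qed
  have ze: "(\<Sum>x\<in>C. M e x * z x) = b e" using c by (simp add: z t_def)
  have "(\<Sum>x\<in>C. M d x * z x) = b d" if "d \<in> D" for d
  proof -
    have "(\<Sum>x\<in>C. M' d x * z x) = M e c * b d - M d c * b e"
      using y that by (simp add: z M'_def)
    moreover have "(\<Sum>x\<in>C. M' d x * z x)
        = M e c * (\<Sum>x\<in>C. M d x * z x) - M d c * (\<Sum>x\<in>C. M e x * z x)"
      by (simp only: M'_def left_diff_distrib sum_subtractf sum_distrib_left mult.assoc)
    ultimately show ?thesis using ze c by simp
  qed
  then show ?case using ze by blast
qed

section \<open>Evaluation of polynomials\<close>

definition mono_eval :: "('i \<Rightarrow> 'a::comm_ring_1) \<Rightarrow> 'i::finite monomial \<Rightarrow> 'a" where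
  "mono_eval v m = (\<Prod>i\<in>UNIV. v i ^ lookup m i)"

lemma mono_eval_keys: "(\<Prod>i\<in>keys m. v i ^ lookup m i) = mono_eval v m"
  unfolding mono_eval_def
  by (rule prod.mono_neutral_left) (auto simp: in_keys_iff)

lemma mono_eval_add: "mono_eval v (m + n) = mono_eval v m * mono_eval v n"
  by (simp add: mono_eval_def lookup_add power_add prod.distrib)

lemma mono_eval_0 [simp]: "mono_eval v 0 = 1"
  by (simp add: mono_eval_def)

lemma mono_eval_var [simp]: "mono_eval v (var_mono i) = v i"
proof -
  have "mono_eval v (var_mono i) = (\<Prod>j\<in>UNIV. if j = i then v i else 1)"
    unfolding mono_eval_def var_mono_def by (intro prod.cong) (auto simp: lookup_single)
  then show ?thesis by simp
qed

lemma poly_mapping_sum_single: "p = (\<Sum>m\<in>keys p. Poly_Mapping.single m (lookup p m))"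
  by (rule poly_mapping_eqI)
    (auto simp: lookup_sum lookup_single when_def in_keys_iff sum.delta')

lemma poly_subst_eq: "poly_subst h v p = (\<Sum>m\<in>keys p. h (lookup p m) * mono_eval v m)"
  by (simp add: poly_subst_def mono_eval_keys)

text \<open>Ring homomorphisms. Substitution along one of them is again an instance, which is how
  substitutions are composed.\<close>

locale coeff_hom =
  fixes h :: "'k::comm_ring_1 \<Rightarrow> 'a::comm_ring_1"
  assumes zero: "h 0 = 0" and one: "h 1 = 1"
    and add: "h (x + y) = h x + h y" and mult: "h (x * y) = h x * h y"
begin

lemma subst_superset:
  fixes p :: "('i::finite, 'k) mpoly"
  assumes "finite S" "keys p \<subseteq> S"
  shows "poly_subst h v p = (\<Sum>m\<in>S. h (lookup p m) * mono_eval v m)"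
  unfolding poly_subst_eq using assms
  by (intro sum.mono_neutral_left) (auto simp: in_keys_iff zero)

lemma subst_add:
  fixes p q :: "('i::finite, 'k) mpoly"
  shows "poly_subst h v (p + q) = poly_subst h v p + poly_subst h v q"
proof -
  let ?S = "keys p \<union> keys q"
  have "keys (p + q) \<subseteq> ?S" by (rule keys_add)
  then show ?thesis
    by (simp add: subst_superset[of ?S] lookup_add add distrib_right sum.distrib)
qed

lemma subst_single: "poly_subst h (v :: 'i::finite \<Rightarrow> 'a) (Poly_Mapping.single m c) = h c * mono_eval v m"
  by (cases "c = 0") (simp_all add: poly_subst_eq zero)

lemma subst_0: "poly_subst h (v :: 'i::finite \<Rightarrow> 'a) 0 = 0"
  by (simp add: poly_subst_def)

lemma subst_1: "poly_subst h (v :: 'i::finite \<Rightarrow> 'a) 1 = 1"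
  using subst_single[of v 0 1] by (simp add: one)

lemma subst_sum:
  fixes f :: "'s \<Rightarrow> ('i::finite, 'k) mpoly"
  shows "poly_subst h v (\<Sum>s\<in>S. f s) = (\<Sum>s\<in>S. poly_subst h v (f s))"
  by (induction S rule: infinite_finite_induct) (simp_all add: subst_0 subst_add)

lemma subst_mult:
  fixes p q :: "('i::finite, 'k) mpoly"
  shows "poly_subst h v (p * q) = poly_subst h v p * poly_subst h v q"
proof -
  have pq: "p * q = (\<Sum>m\<in>keys p. \<Sum>n\<in>keys q. Poly_Mapping.single (m + n) (lookup p m * lookup q n))"
    by (subst poly_mapping_sum_single[of p], subst poly_mapping_sum_single[of q])
      (simp add: sum_product mult_single)
  have "poly_subst h v (p * q) =
      (\<Sum>m\<in>keys p. \<Sum>n\<in>keys q. (h (lookup p m) * mono_eval v m) * (h (lookup q n) * mono_eval v n))"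
    unfolding pq by (simp only: subst_sum subst_single mult mono_eval_add mult_ac)
  then show ?thesis by (simp only: poly_subst_eq sum_product)
qed

lemma subst_var: "poly_subst h (v :: 'i::finite \<Rightarrow> 'a) (var i) = v i"
  by (simp add: mono_poly_def subst_single one)

lemma subst_const: "poly_subst h (v :: 'i::finite \<Rightarrow> 'a) (const_poly c) = h c"
  by (simp add: const_poly_def subst_single)

end

interpretation id_hom: coeff_hom "id :: 'k::comm_ring_1 \<Rightarrow> 'k"
  by unfold_locales simp_all

interpretation const_hom: coeff_hom "const_poly :: 'k::comm_ring_1 \<Rightarrow> ('n, 'k) mpoly"
  by unfold_locales (simp_all add: const_poly_def single_add mult_single)

section \<open>Generic matrices\<close>

text \<open>The regular functions on the affine space of all square matrices, singular ones
  included.\<close>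

definition polyfun :: "('k::field^'n^'n \<Rightarrow> 'k) \<Rightarrow> bool" where
  "polyfun g \<longleftrightarrow> (\<exists>f :: ('n::finite \<times> 'n, 'k) mpoly. \<forall>A. g A = poly_subst id (\<lambda>(i, j). A $ i $ j) f)"

lemma polyfun_const [simp]: "polyfun (\<lambda>A. c)"
  unfolding polyfun_def by (intro exI[of _ "const_poly c"]) (simp add: id_hom.subst_const)

lemma polyfun_entry [simp]: "polyfun (\<lambda>A. A $ i $ j)"
  unfolding polyfun_def by (intro exI[of _ "var (i, j)"]) (simp add: id_hom.subst_var)

lemma polyfun_add [intro]: "polyfun f \<Longrightarrow> polyfun g \<Longrightarrow> polyfun (\<lambda>A. f A + g A)"
  unfolding polyfun_def by (metis id_hom.subst_add)

lemma polyfun_mult [intro]: "polyfun f \<Longrightarrow> polyfun g \<Longrightarrow> polyfun (\<lambda>A. f A * g A)"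
  unfolding polyfun_def by (metis id_hom.subst_mult)

lemma polyfun_uminus [intro]: "polyfun f \<Longrightarrow> polyfun (\<lambda>A. - f A)"
  using polyfun_mult[OF polyfun_const[of "-1"], of f] by simp

lemma polyfun_diff [intro]: "polyfun f \<Longrightarrow> polyfun g \<Longrightarrow> polyfun (\<lambda>A. f A - g A)"
  using polyfun_add[OF _ polyfun_uminus, of f g] by simp

lemma polyfun_sum [intro]: "(\<And>s. s \<in> S \<Longrightarrow> polyfun (f s)) \<Longrightarrow> polyfun (\<lambda>A. \<Sum>s\<in>S. f s A)"
  by (induction S rule: infinite_finite_induct) (auto simp: polyfun_add)

lemma polyfun_prod [intro]: "(\<And>s. s \<in> S \<Longrightarrow> polyfun (f s)) \<Longrightarrow> polyfun (\<lambda>A. \<Prod>s\<in>S. f s A)"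
  by (induction S rule: infinite_finite_induct) (auto simp: polyfun_mult)

lemma polyfun_det: "polyfun det"
  unfolding det_def by (intro polyfun_sum polyfun_mult polyfun_prod) simp_all

lemma polyfun_line:
  assumes "polyfun g"
  shows "\<exists>q. \<forall>t. g (\<chi> i j. A $ i $ j + t * (B $ i $ j - A $ i $ j)) = poly q t"
proof -
  obtain f where f: "\<And>A. g A = poly_subst id (\<lambda>(i, j). A $ i $ j) f"
    using assms unfolding polyfun_def by blast
  let ?q = "\<Sum>m\<in>keys f. [:lookup f m:] *
      (\<Prod>(i, j)\<in>UNIV. [:A $ i $ j, B $ i $ j - A $ i $ j:] ^ lookup m (i, j))"
  show ?thesis
    by (intro exI[of _ ?q])
      (simp add: f poly_subst_eq mono_eval_def poly_sum poly_prod case_prod_unfold)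
qed

text \<open>Irreducibility of the space of matrices: on the line through \<open>A\<close> and
  \<open>B\<close> both functions are nonzero polynomials in one variable, whose product has only
  finitely many roots in an infinite field.\<close>

lemma polyfun_common_nonzero:
  fixes g h :: "'k::field_char_0^'n^'n \<Rightarrow> 'k"
  assumes "polyfun g" "polyfun h" "g A \<noteq> 0" "h B \<noteq> 0"
  shows "\<exists>X. g X \<noteq> 0 \<and> h X \<noteq> 0"
proof -
  let ?L = "\<lambda>t. \<chi> i j. A $ i $ j + t * (B $ i $ j - A $ i $ j)"
  obtain p q where p: "\<And>t. g (?L t) = poly p t" and q: "\<And>t. h (?L t) = poly q t"
    using polyfun_line[OF assms(1)] polyfun_line[OF assms(2)] by metis
  have "?L 0 = A" "?L 1 = B" by (simp_all add: vec_eq_iff)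
  then have "poly p 0 = g A" "poly q 1 = h B" using p[of 0] q[of 1] by simp_all
  then have "p * q \<noteq> 0" using assms(3,4) by auto
  then have "finite {t. poly (p * q) t = 0}" by (rule poly_roots_finite)
  then obtain t where "poly (p * q) t \<noteq> 0"
    using ex_new_if_finite[OF infinite_UNIV_char_0[where 'a='k]] by blast
  then have "g (?L t) \<noteq> 0 \<and> h (?L t) \<noteq> 0" using p[of t] q[of t] by simp
  then show ?thesis by blast
qed

text \<open>Truth on a nonempty principal open set of the whole matrix space. Invertibility enters
  as one more generic condition, so the matrix that shows nonemptiness may be singular.\<close>

definition generic :: "('k::field^'n^'n \<Rightarrow> bool) \<Rightarrow> bool" where
  "generic P \<longleftrightarrow> (\<exists>g. polyfun g \<and> (\<exists>A. g A \<noteq> 0) \<and> (\<forall>A. g A \<noteq> 0 \<longrightarrow> P A))"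

lemma genericI: "polyfun g \<Longrightarrow> g A \<noteq> 0 \<Longrightarrow> (\<And>A. g A \<noteq> 0 \<Longrightarrow> P A) \<Longrightarrow> generic P"
  unfolding generic_def by blast

lemma generic_ex: "generic P \<Longrightarrow> \<exists>A. P A"
  unfolding generic_def by blast

lemma generic_mono: "generic P \<Longrightarrow> (\<And>A. P A \<Longrightarrow> Q A) \<Longrightarrow> generic Q"
  unfolding generic_def by blast

lemma generic_True: "generic (\<lambda>A. True)"
  by (rule genericI[of "\<lambda>A. 1"]) auto

lemma generic_conj:
  fixes P Q :: "'k::field_char_0^'n^'n \<Rightarrow> bool"
  assumes "generic P" "generic Q"
  shows "generic (\<lambda>A. P A \<and> Q A)"
proof -
  obtain g h A B where "polyfun g" "polyfun h" "g A \<noteq> 0" "h B \<noteq> 0"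
    and gh: "\<And>A. g A \<noteq> 0 \<Longrightarrow> P A" "\<And>A. h A \<noteq> 0 \<Longrightarrow> Q A"
    using assms unfolding generic_def by blast
  moreover from this obtain X where "g X \<noteq> 0" "h X \<noteq> 0" using polyfun_common_nonzero by metis
  ultimately show ?thesis
    by (intro genericI[of "\<lambda>A. g A * h A" X]) auto
qed

lemma generic_ball:
  fixes P :: "'s \<Rightarrow> 'k::field_char_0^'n^'n \<Rightarrow> bool"
  assumes "finite S" "\<And>s. s \<in> S \<Longrightarrow> generic (P s)"
  shows "generic (\<lambda>A. \<forall>s\<in>S. P s A)"
  using assms by (induction S rule: finite_induct) (auto simp: generic_True intro: generic_conj)

lemma generic_invertible: "generic (\<lambda>A :: 'k::field^'n^'n. invertible A)"
  by (rule genericI[OF polyfun_det, of "mat 1"]) (auto simp: invertible_det_nz)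

text \<open>Full row rank is an open condition. Instead of exhibiting a nonzero minor, the induction
  collects pivots: the witness \<open>A\<close> provides a pivot column, and wherever this pivot is
  nonzero, independence after elimination implies independence before it.\<close>

lemma generic_rows_indep:
  fixes M :: "'k::field_char_0^'n^'n \<Rightarrow> 'd \<Rightarrow> 'c \<Rightarrow> 'k"
  assumes "finite D" "\<And>d c. d \<in> D \<Longrightarrow> c \<in> C \<Longrightarrow> polyfun (\<lambda>A. M A d c)" "rows_indep D C (M A)"
  shows "generic (\<lambda>A. rows_indep D C (M A))"
  using assms
proof (induction D arbitrary: M rule: finite_induct)
  case empty
  then show ?case by (simp add: rows_indep_def generic_True)
next
  case (insert e D)
  obtain c where c: "c \<in> C" "M A e c \<noteq> 0" using rows_indep_nonzero_entry[OF insert.hyps(1,2) insert.prems(2)] by blast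
  define M' where "M' = (\<lambda>A d x. M A e c * M A d x - M A d c * M A e x)"
  have "rows_indep D C (M' A)" unfolding M'_def
    by (rule rows_indep_eliminate[OF insert.hyps(1,2) insert.prems(2) c(2)])
  then have "generic (\<lambda>A. rows_indep D C (M' A))"
    using insert.prems(1) c by (intro insert.IH) (auto simp: M'_def intro!: polyfun_diff polyfun_mult)
  moreover have "generic (\<lambda>A. M A e c \<noteq> 0)"
    using insert.prems(1) c by (intro genericI[of "\<lambda>A. M A e c" A]) auto
  ultimately have "generic (\<lambda>A. rows_indep D C (M' A) \<and> M A e c \<noteq> 0)" by (rule generic_conj)
  then show ?case
  proof (rule generic_mono)
    fix A assume A: "rows_indep D C (M' A) \<and> M A e c \<noteq> 0"
    show "rows_indep (insert e D) C (M A)"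
    proof (rule rows_indepI)
      fix u d assume z: "\<forall>c\<in>C. (\<Sum>d\<in>insert e D. u d * M A d c) = 0" and d: "d \<in> insert e D"
      have z': "u e * M A e x + (\<Sum>d\<in>D. u d * M A d x) = 0" if "x \<in> C" for x
        using z that insert.hyps by simp
      have "(\<Sum>d\<in>D. u d * M' A d x) = 0" if "x \<in> C" for x
      proof -
        have "(\<Sum>d\<in>D. u d * M' A d x)
          = M A e c * (\<Sum>d\<in>D. u d * M A d x) - M A e x * (\<Sum>d\<in>D. u d * M A d c)"
          by (simp only: M'_def right_diff_distrib sum_subtractf sum_distrib_left mult_ac)
        also have "(\<Sum>d\<in>D. u d * M A d x) = - (u e * M A e x)"
          using z'[OF that] by (simp add: eq_neg_iff_add_eq_0 add.commute)
        also have "(\<Sum>d\<in>D. u d * M A d c) = - (u e * M A e c)"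
          using z'[OF c(1)] by (simp add: eq_neg_iff_add_eq_0 add.commute)
        finally show ?thesis by simp
      qed
      then have u: "u d = 0" if "d \<in> D" for d using rows_indepD A that by metis
      then have "u e = 0" using z'[OF c(1)] A by simp
      then show "u d = 0" using u d by auto
    qed
  qed
qed

section \<open>Monomials and degrees\<close>

definition mdeg :: "'n::finite monomial \<Rightarrow> nat" where
  "mdeg m = (\<Sum>i\<in>UNIV. lookup m i)"

lemma mdeg_0 [simp]: "mdeg 0 = 0"
  by (simp add: mdeg_def)

lemma mdeg_add [simp]: "mdeg (m + n) = mdeg m + mdeg n"
  by (simp add: mdeg_def lookup_add sum.distrib)

lemma lookup_var_mono: "lookup (var_mono i) j = (if i = j then 1 else 0)"
  by (simp add: var_mono_def lookup_single)

lemma var_mono_eq_iff [simp]: "var_mono i = var_mono j \<longleftrightarrow> i = j"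
  using lookup_var_mono by (metis zero_neq_one)

lemma mdeg_var [simp]: "mdeg (var_mono i) = 1"
  by (simp add: mdeg_def lookup_var_mono)

lemma lookup_le_mdeg: "lookup m i \<le> mdeg m"
  unfolding mdeg_def by (rule member_le_sum) auto

lemma finite_mdeg_le: "finite {m :: 'n::finite monomial. mdeg m \<le> d}"
proof -
  have "{m :: 'n monomial. mdeg m \<le> d} \<subseteq> lookup -` (UNIV \<rightarrow>\<^sub>E {..d})"
    using lookup_le_mdeg order_trans by (fastforce simp: PiE_def)
  moreover have "finite (lookup -` (UNIV \<rightarrow>\<^sub>E {..d}) :: 'n monomial set)"
    by (intro finite_vimageI finite_PiE) (auto simp: inj_on_def)
  ultimately show ?thesis by (rule finite_subset)
qed

lemma finite_mdeg: "finite {m :: 'n::finite monomial. mdeg m = d}"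
  by (rule finite_subset[OF _ finite_mdeg_le[of d]]) auto

lemma monomial_diff:
  fixes s t :: "'n monomial"
  assumes "\<And>i. lookup s i \<le> lookup t i" shows "t = s + (t - s)"
  by (rule poly_mapping_eqI) (simp add: lookup_add lookup_minus assms)

lemma finite_splits: "finite {(s, t :: 'n::finite monomial). s + t = m}"
  by (rule finite_subset[of _ "{s. mdeg s \<le> mdeg m} \<times> {t. mdeg t \<le> mdeg m}"])
    (auto intro: finite_mdeg_le)

lemma lookup_mult_splits:
  fixes p q :: "('n::finite, 'k::comm_ring_1) mpoly"
  shows "lookup (p * q) m = (\<Sum>(s, t)\<in>{(s, t). s + t = m}. lookup p s * lookup q t)"
proof -
  have pq: "p * q = (\<Sum>(s, t)\<in>keys p \<times> keys q. Poly_Mapping.single (s + t) (lookup p s * lookup q t))"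
    by (subst poly_mapping_sum_single[of p], subst poly_mapping_sum_single[of q])
      (simp add: sum_product mult_single sum.cartesian_product)
  have "lookup (p * q) m =
      (\<Sum>(s, t)\<in>keys p \<times> keys q. if s + t = m then lookup p s * lookup q t else 0)"
    unfolding pq by (simp add: lookup_sum lookup_single when_def case_prod_unfold)
  also have "\<dots> = (\<Sum>(s, t)\<in>(keys p \<times> keys q) \<inter> {(s, t). s + t = m}. lookup p s * lookup q t)"
    by (simp add: sum.inter_restrict case_prod_unfold)
  also have "\<dots> = (\<Sum>(s, t)\<in>{(s, t). s + t = m}. lookup p s * lookup q t)"
    by (rule sum.mono_neutral_left[OF finite_splits]) (auto simp: in_keys_iff)
  finally show ?thesis .
qed

lemma lookup_mono_mult:
  fixes p :: "('n, 'k::comm_ring_1) mpoly"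
  shows "lookup (mono_poly t * p) (t + m) = lookup p m"
proof -
  have "mono_poly t * p = (\<Sum>s\<in>keys p. Poly_Mapping.single (t + s) (lookup p s))"
    by (subst poly_mapping_sum_single[of p]) (simp add: sum_distrib_left mult_single mono_poly_def)
  then show ?thesis
    by (simp add: lookup_sum lookup_single when_def in_keys_iff sum.delta')
qed

lemma keys_mono_mult:
  fixes p :: "('n, 'k::comm_ring_1) mpoly"
  shows "keys (mono_poly t * p) = (+) t ` keys p"
proof
  show "keys (mono_poly t * p) \<subseteq> (+) t ` keys p"
    using keys_mult[of "mono_poly t" p] by (auto simp: mono_poly_def)
qed (auto simp: in_keys_iff lookup_mono_mult)

lemma mono_poly_add: "mono_poly (s + t) = (mono_poly s * mono_poly t :: ('n, 'k::comm_ring_1) mpoly)"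
  by (simp add: mono_poly_def mult_single)

lemma mono_poly_0 [simp]: "mono_poly 0 = (1 :: ('n, 'k::comm_ring_1) mpoly)"
  by (simp add: mono_poly_def)

lemma mono_poly_sum:
  "finite S \<Longrightarrow> mono_poly (\<Sum>s\<in>S. f s) = (\<Prod>s\<in>S. mono_poly (f s) :: ('n, 'k::comm_ring_1) mpoly)"
  by (induction S rule: finite_induct) (simp_all add: mono_poly_add)

lemma var_power: "var i ^ k = (mono_poly (Poly_Mapping.single i k) :: ('n, 'k::comm_ring_1) mpoly)"
proof (induction k)
  case (Suc k)
  have "Poly_Mapping.single i (Suc k) = var_mono i + Poly_Mapping.single i k"
    by (simp add: var_mono_def flip: single_add)
  then show ?case using Suc by (simp add: mono_poly_add)
qed simp

lemma mono_eval_var_mono: "mono_eval var m = (mono_poly m :: ('n::finite, 'k::comm_ring_1) mpoly)"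
proof -
  have "m = (\<Sum>i\<in>UNIV. Poly_Mapping.single i (lookup m i))"
    by (rule poly_mapping_eqI) (simp add: lookup_sum lookup_single when_def)
  then have "mono_poly m = (\<Prod>i\<in>UNIV. mono_poly (Poly_Mapping.single i (lookup m i)) :: ('n, 'k) mpoly)"
    using mono_poly_sum[of UNIV "\<lambda>i. Poly_Mapping.single i (lookup m i)"] by simp
  then show ?thesis by (simp add: mono_eval_def var_power)
qed

lemma const_mult_mono: "const_poly c * mono_poly m = (Poly_Mapping.single m c :: ('n, 'k::comm_ring_1) mpoly)"
  by (simp add: const_poly_def mono_poly_def mult_single)

lemma lookup_const_mult [simp]:
  fixes p :: "('n, 'k::comm_ring_1) mpoly"
  shows "lookup (const_poly c * p) m = c * lookup p m"
proof -
  have "const_poly c * p = (\<Sum>s\<in>keys p. Poly_Mapping.single s (c * lookup p s))"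
    by (subst poly_mapping_sum_single[of p]) (simp add: sum_distrib_left mult_single const_poly_def)
  then show ?thesis
    by (simp add: lookup_sum lookup_single when_def in_keys_iff sum.delta')
qed

section \<open>Homogeneous parts\<close>

definition homog :: "nat \<Rightarrow> ('n::finite, 'k::zero) mpoly \<Rightarrow> bool" where
  "homog d p \<longleftrightarrow> (\<forall>m\<in>keys p. mdeg m = d)"

definition hpart :: "nat \<Rightarrow> ('n::finite, 'k::comm_ring_1) mpoly \<Rightarrow> ('n, 'k) mpoly" where
  "hpart d p = (\<Sum>m\<in>{m\<in>keys p. mdeg m = d}. Poly_Mapping.single m (lookup p m))"

lemma homog_0 [simp]: "homog d 0"
  by (simp add: homog_def)

lemma homog_add: "homog d p \<Longrightarrow> homog d q \<Longrightarrow> homog d (p + q)"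
  unfolding homog_def using keys_add[of p q] by blast

lemma homog_sum: "(\<And>s. s \<in> S \<Longrightarrow> homog d (f s)) \<Longrightarrow> homog d (\<Sum>s\<in>S. f s)"
  by (induction S rule: infinite_finite_induct) (auto intro: homog_add)

lemma homog_mult:
  fixes p q :: "('n::finite, 'k::comm_ring_1) mpoly"
  shows "homog d p \<Longrightarrow> homog e q \<Longrightarrow> homog (d + e) (p * q)"
  unfolding homog_def using keys_mult[of p q] by fastforce

lemma homog_1: "homog 0 (1 :: ('n::finite, 'k::comm_ring_1) mpoly)"
  by (simp add: homog_def)

lemma homog_power:
  fixes p :: "('n::finite, 'k::comm_ring_1) mpoly"
  shows "homog d p \<Longrightarrow> homog (k * d) (p ^ k)"
  by (induction k) (simp_all add: homog_1 homog_mult)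

lemma homog_prod:
  fixes f :: "'s \<Rightarrow> ('n::finite, 'k::comm_ring_1) mpoly"
  shows "(\<And>s. s \<in> S \<Longrightarrow> homog (d s) (f s)) \<Longrightarrow> homog (\<Sum>s\<in>S. d s) (\<Prod>s\<in>S. f s)"
  by (induction S rule: infinite_finite_induct) (auto simp: homog_1 homog_mult)

lemma homog_single: "homog (mdeg m) (Poly_Mapping.single m c)"
  by (simp add: homog_def)

lemma homog_mono_poly: "homog (mdeg m) (mono_poly m)"
  by (simp add: mono_poly_def homog_single)

lemma homog_const: "homog 0 (const_poly c)"
  using homog_single[of 0 c] by (simp add: const_poly_def)

lemma homog_const_mult:
  fixes p :: "('n::finite, 'k::comm_ring_1) mpoly"
  shows "homog d p \<Longrightarrow> homog d (const_poly c * p)"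
  using homog_mult[OF homog_const] by force

lemma lookup_hpart: "lookup (hpart d p) m = (if mdeg m = d then lookup p m else 0)"
  unfolding hpart_def
  by (auto simp: lookup_sum lookup_single when_def in_keys_iff sum.delta' cong: conj_cong)

lemma keys_hpart: "keys (hpart d p) = {m\<in>keys p. mdeg m = d}"
  by (auto simp: in_keys_iff lookup_hpart split: if_splits)

lemma homog_hpart: "homog d (hpart d p)"
  by (simp add: homog_def keys_hpart)

lemma hpart_of_homog: "homog e p \<Longrightarrow> hpart d p = (if d = e then p else 0)"
  by (rule poly_mapping_eqI) (auto simp: lookup_hpart homog_def in_keys_iff)

lemma hpart_add: "hpart d (p + q) = hpart d p + hpart d q"
  by (rule poly_mapping_eqI) (simp add: lookup_hpart lookup_add)

lemma hpart_0 [simp]: "hpart d 0 = 0"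
  by (rule poly_mapping_eqI) (simp add: lookup_hpart)

lemma hpart_sum: "hpart d (\<Sum>s\<in>S. f s) = (\<Sum>s\<in>S. hpart d (f s))"
  by (induction S rule: infinite_finite_induct) (simp_all add: hpart_add)

lemma sum_hpart: "finite D \<Longrightarrow> mdeg ` keys p \<subseteq> D \<Longrightarrow> (\<Sum>d\<in>D. hpart d p) = p"
  by (rule poly_mapping_eqI) (force simp: lookup_sum lookup_hpart in_keys_iff)

lemma hpart_homog_mult:
  fixes p q :: "('n::finite, 'k::comm_ring_1) mpoly"
  assumes "homog e q"
  shows "hpart d (q * p) = (if e \<le> d then q * hpart (d - e) p else 0)"
proof -
  \<comment> \<open>The degree \<open>d - e\<close> is added so that the final sum contains this
    index even if \<open>p\<close> has no term of that degree.\<close>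
  let ?D = "mdeg ` keys p \<union> {d - e}"
  have "q * p = (\<Sum>c\<in>?D. q * hpart c p)"
    by (simp only: sum_distrib_left[symmetric]) (subst sum_hpart; auto)
  then have "hpart d (q * p) = (\<Sum>c\<in>?D. hpart d (q * hpart c p))"
    by (simp only: hpart_sum)
  also have "\<dots> = (\<Sum>c\<in>?D. if c = d - e \<and> e \<le> d then q * hpart c p else 0)"
    by (intro sum.cong) (auto simp: hpart_of_homog[OF homog_mult[OF assms homog_hpart]])
  finally show ?thesis by (auto simp: sum.delta)
qed

text \<open>For an ideal this is the usual notion of being homogeneous.\<close>

definition hclosed :: "('n::finite, 'k::comm_ring_1) mpoly set \<Rightarrow> bool" where
  "hclosed I \<longleftrightarrow> (\<forall>p\<in>I. \<forall>d. hpart d p \<in> I)"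

lemma hclosed_span:
  fixes S :: "('n::finite, 'k::comm_ring_1) mpoly set"
  assumes "hclosed S" shows "hclosed (ideal.span S)"
  unfolding hclosed_def
proof (intro ballI allI)
  fix p d assume "p \<in> ideal.span S"
  then show "hpart d p \<in> ideal.span S"
  proof (induction rule: ideal.span_induct_alt)
    case base
    then show ?case by (simp add: ideal.span_zero)
  next
    case (step c x y)
    have "hpart e x \<in> ideal.span S" for e
      using assms step(1) by (simp add: hclosed_def ideal.span_base)
    then have "hpart d (Poly_Mapping.single m a * x) \<in> ideal.span S" for m a
      by (simp add: hpart_homog_mult[OF homog_single] ideal.span_zero ideal.span_scale)
    \<comment> \<open>The multiplier is split into terms because \<open>hpart_homog_mult\<close>
      treats homogeneous factors.\<close>
    moreover have "c * x = (\<Sum>m\<in>keys c. Poly_Mapping.single m (lookup c m) * x)"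
      by (subst poly_mapping_sum_single[of c]) (simp add: sum_distrib_right)
    ultimately have "hpart d (c * x) \<in> ideal.span S"
      by (simp add: hpart_sum ideal.span_sum)
    then show ?case using step by (simp add: hpart_add ideal.span_add)
  qed
qed

section \<open>Linear changes of variables\<close>

lemma (in coeff_hom) hom_sum: "h (\<Sum>s\<in>S. f s) = (\<Sum>s\<in>S. h (f s))"
  by (induction S rule: infinite_finite_induct) (simp_all add: zero add)

lemma (in coeff_hom) hom_power: "h (x ^ k) = h x ^ k"
  by (induction k) (simp_all add: one mult)

lemma (in coeff_hom) hom_prod: "h (\<Prod>s\<in>S. f s) = (\<Prod>s\<in>S. h (f s))"
  by (induction S rule: infinite_finite_induct) (simp_all add: one mult)

lemma (in coeff_hom) hom_poly_subst:
  fixes p :: "('i::finite, 'c::comm_ring_1) mpoly"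
  shows "h (poly_subst g v p) = poly_subst (\<lambda>c. h (g c)) (\<lambda>i. h (v i)) p"
  by (simp add: poly_subst_eq mono_eval_def hom_sum mult hom_prod hom_power)

lemma (in coeff_hom) subst_coeff_hom: "coeff_hom (poly_subst h (v :: 'i::finite \<Rightarrow> 'a))"
  by unfold_locales (simp_all add: subst_0 subst_1 subst_add subst_mult)

interpretation change: coeff_hom "linear_change A"
  for A :: "'k::comm_ring_1^'n^'n::finite"
  unfolding linear_change_def by (rule const_hom.subst_coeff_hom)

definition linear_form :: "('n::finite \<Rightarrow> 'k::comm_ring_1) \<Rightarrow> ('n, 'k) mpoly" where
  "linear_form c = (\<Sum>i\<in>UNIV. const_poly (c i) * var i)"

lemma linear_change_var: "linear_change A (var j) = linear_form (\<lambda>i. A $ i $ j)"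
  by (simp add: linear_change_def const_hom.subst_var linear_form_def)

lemma linear_change_const [simp]: "linear_change A (const_poly c) = const_poly c"
  by (simp add: linear_change_def const_hom.subst_const)

lemma homog_linear_form: "homog 1 (linear_form c)"
  unfolding linear_form_def
  by (intro homog_sum homog_const_mult) (metis homog_mono_poly mdeg_var)

lemma linear_change_linear_form:
  "linear_change A (linear_form c) = linear_form (\<lambda>k. \<Sum>i\<in>UNIV. A $ k $ i * c i)"
proof -
  have "linear_change A (const_poly (c i) * var i) = (\<Sum>k\<in>UNIV. const_poly (A $ k $ i * c i) * var k)" for i
    by (simp only: change.mult linear_change_const linear_change_var linear_form_def
        sum_distrib_left const_hom.mult mult_ac)
  then have "linear_change A (linear_form c)
      = (\<Sum>i\<in>UNIV. \<Sum>k\<in>UNIV. const_poly (A $ k $ i * c i) * var k)"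
    by (simp only: linear_form_def[of c] change.hom_sum)
  also have "\<dots> = (\<Sum>k\<in>UNIV. \<Sum>i\<in>UNIV. const_poly (A $ k $ i * c i) * var k)"
    by (rule sum.swap)
  finally show ?thesis by (simp add: linear_form_def const_hom.hom_sum sum_distrib_right)
qed

lemma linear_change_compose:
  "linear_change A (linear_change B p) = linear_change (A ** B) p"
proof -
  have "linear_change A (linear_change B p) = linear_change A (poly_subst const_poly (\<lambda>j. linear_form (\<lambda>i. B $ i $ j)) p)"
    by (simp add: linear_change_def linear_form_def)
  also have "\<dots> = poly_subst const_poly (\<lambda>j. linear_form (\<lambda>i. (A ** B) $ i $ j)) p"
    by (simp add: change.hom_poly_subst linear_change_linear_form matrix_matrix_mult_def)
  finally show ?thesis by (simp add: linear_change_def linear_form_def)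
qed

lemma linear_change_id [simp]: "linear_change (mat 1) p = p"
proof -
  have "linear_form (\<lambda>i. mat 1 $ i $ j) = (var j :: ('a, 'b) mpoly)" for j
  proof -
    have "const_poly (mat 1 $ i $ j) * var i = (if i = j then var j else 0 :: ('a, 'b) mpoly)" for i
      by (simp add: mat_def const_hom.zero const_hom.one)
    then show ?thesis by (simp add: linear_form_def)
  qed
  then have "linear_change (mat 1) p = poly_subst const_poly var p"
    by (simp add: linear_change_def linear_form_def)
  also have "\<dots> = p"
    by (subst (2) poly_mapping_sum_single) (simp add: poly_subst_eq mono_eval_var_mono const_mult_mono)
  finally show ?thesis .
qed

lemma linear_change_inverse:
  fixes A :: "'k::field^'n^'n::finite"
  assumes "invertible A"
  obtains B where "\<And>p. linear_change A (linear_change B p) = p"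
    and "\<And>p. linear_change B (linear_change A p) = p"
proof -
  obtain B where "A ** B = mat 1" "B ** A = mat 1" using assms unfolding invertible_def by blast
  then show ?thesis using that[of B] by (simp add: linear_change_compose)
qed

lemma linear_change_eq_0_iff:
  fixes A :: "'k::field^'n^'n::finite"
  assumes "invertible A" shows "linear_change A p = 0 \<longleftrightarrow> p = 0"
  using linear_change_inverse[OF assms] change.zero by metis

lemma homog_linear_change:
  assumes "homog d p" shows "homog d (linear_change A p)"
proof -
  have "homog (mdeg m) (mono_eval (\<lambda>j. linear_form (\<lambda>i. A $ i $ j)) m)" for m
    unfolding mono_eval_def mdeg_def
    by (rule homog_prod) (metis homog_power homog_linear_form mult.right_neutral)
  then show ?thesis using assms
    by (auto simp: linear_change_def poly_subst_eq homog_def[of d p] linear_form_def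
        intro!: homog_sum homog_const_mult)
qed

lemma hpart_linear_change: "hpart d (linear_change A p) = linear_change A (hpart d p)"
proof -
  let ?D = "insert d (mdeg ` keys p)"
  have "linear_change A p = (\<Sum>e\<in>?D. linear_change A (hpart e p))"
    by (subst change.hom_sum[symmetric], subst sum_hpart) auto
  then have "hpart d (linear_change A p) = (\<Sum>e\<in>?D. hpart d (linear_change A (hpart e p)))"
    by (simp only: hpart_sum)
  also have "\<dots> = (\<Sum>e\<in>?D. if e = d then linear_change A (hpart e p) else 0)"
    by (intro sum.cong) (auto simp: hpart_of_homog[OF homog_linear_change[OF homog_hpart]])
  finally show ?thesis by simp
qed

abbreviation peval :: "('n::finite \<Rightarrow> 'k::comm_ring_1) \<Rightarrow> ('n, 'k) mpoly \<Rightarrow> 'k" where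
  "peval u \<equiv> poly_subst id u"

text \<open>On points the substitution acts dually, by sending the row vector \<open>u\<close> to
  \<open>u\<close> times \<open>A\<close>. This turns zeros of \<open>p\<close> into zeros of the
  transformed polynomial.\<close>

lemma peval_linear_change:
  "peval u (linear_change A p) = peval (\<lambda>j. \<Sum>i\<in>UNIV. u i * A $ i $ j) p"
proof -
  interpret ev: coeff_hom "peval u" by (rule id_hom.subst_coeff_hom)
  have "peval u (linear_change A p) = poly_subst (\<lambda>c. peval u (const_poly c))
      (\<lambda>j. peval u (\<Sum>i\<in>UNIV. const_poly (A $ i $ j) * var i)) p"
    unfolding linear_change_def by (rule ev.hom_poly_subst)
  also have "(\<lambda>c. peval u (const_poly c)) = id"
    by (simp add: id_hom.subst_const fun_eq_iff)
  also have "(\<lambda>j. peval u (\<Sum>i\<in>UNIV. const_poly (A $ i $ j) * var i)) = (\<lambda>j. \<Sum>i\<in>UNIV. u i * A $ i $ j)"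
    by (simp add: ev.hom_sum ev.mult id_hom.subst_const id_hom.subst_var mult.commute)
  finally show ?thesis .
qed

text \<open>Algebraic families of polynomials over the space of matrices.\<close>

definition polycoeff :: "('k::field^'n^'n \<Rightarrow> ('n::finite, 'k) mpoly) \<Rightarrow> bool" where
  "polycoeff P \<longleftrightarrow> (\<forall>m. polyfun (\<lambda>A. lookup (P A) m))"

lemma polycoeff_const: "polycoeff (\<lambda>A. p)"
  by (simp add: polycoeff_def)

lemma polycoeff_add: "polycoeff P \<Longrightarrow> polycoeff Q \<Longrightarrow> polycoeff (\<lambda>A. P A + Q A)"
  unfolding polycoeff_def lookup_add by auto

lemma polycoeff_sum: "(\<And>s. s \<in> S \<Longrightarrow> polycoeff (P s)) \<Longrightarrow> polycoeff (\<lambda>A. \<Sum>s\<in>S. P s A)"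
  unfolding polycoeff_def lookup_sum by auto

lemma polycoeff_mult: "polycoeff P \<Longrightarrow> polycoeff Q \<Longrightarrow> polycoeff (\<lambda>A. P A * Q A)"
  unfolding polycoeff_def lookup_mult_splits case_prod_unfold
  by (intro allI polyfun_sum polyfun_mult) blast+

lemma polycoeff_power: "polycoeff P \<Longrightarrow> polycoeff (\<lambda>A. P A ^ k)"
  by (induction k) (simp_all add: polycoeff_const polycoeff_mult)

lemma polycoeff_prod: "(\<And>s. s \<in> S \<Longrightarrow> polycoeff (P s)) \<Longrightarrow> polycoeff (\<lambda>A. \<Prod>s\<in>S. P s A)"
  by (induction S rule: infinite_finite_induct) (simp_all add: polycoeff_const polycoeff_mult)

lemma polycoeff_scale: "polyfun g \<Longrightarrow> polycoeff P \<Longrightarrow> polycoeff (\<lambda>A. const_poly (g A) * P A)"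
  unfolding polycoeff_def lookup_const_mult by (intro allI polyfun_mult) blast+

lemma polycoeff_linear_change: "polycoeff (\<lambda>A. linear_change A p)"
  unfolding linear_change_def poly_subst_eq mono_eval_def
  by (intro polycoeff_sum polycoeff_mult polycoeff_prod polycoeff_power polycoeff_const
      polycoeff_scale polyfun_entry)

lemma polycoeff_hpart:
  assumes "polycoeff P" shows "polycoeff (\<lambda>A. hpart d (P A))"
  unfolding polycoeff_def lookup_hpart
proof
  fix m show "polyfun (\<lambda>A. if mdeg m = d then lookup (P A) m else 0)"
    using assms by (cases "mdeg m = d") (simp_all add: polycoeff_def)
qed

section \<open>Leading monomials\<close>

text \<open>The exponents occurring in the initial ideal, given by witness polynomials rather than
  through the description operator in \<open>lead_mono\<close>.\<close>

definition leads :: "'n monomial rel \<Rightarrow> ('n, 'k::zero) mpoly set \<Rightarrow> 'n monomial set" where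
  "leads \<sigma> V = {m. \<exists>p\<in>V. m \<in> keys p \<and> (\<forall>t\<in>keys p. (t, m) \<in> \<sigma>)}"

definition mono_closed :: "'n monomial set \<Rightarrow> bool" where
  "mono_closed E \<longleftrightarrow> (\<forall>m\<in>E. \<forall>t. t + m \<in> E)"

definition mono_ideal :: "'n monomial set \<Rightarrow> ('n, 'k::zero) mpoly set" where
  "mono_ideal E = {p. keys p \<subseteq> E}"

lemma mono_ideal_subspace:
  assumes "mono_closed E"
  shows "ideal.subspace (mono_ideal E :: ('n, 'k::comm_ring_1) mpoly set)"
proof (rule ideal.subspaceI)
  fix x y :: "('n, 'k) mpoly" assume "x \<in> mono_ideal E" "y \<in> mono_ideal E"
  then show "x + y \<in> mono_ideal E" using keys_add[of x y] by (auto simp: mono_ideal_def)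
next
  fix c x :: "('n, 'k) mpoly" assume "x \<in> mono_ideal E"
  then show "c * x \<in> mono_ideal E"
    using keys_mult[of c x] assms by (force simp: mono_ideal_def mono_closed_def)
qed (simp add: mono_ideal_def)

lemma span_mono_poly:
  assumes "mono_closed E"
  shows "ideal.span (mono_poly ` E) = (mono_ideal E :: ('n, 'k::comm_ring_1) mpoly set)"
proof
  show "ideal.span (mono_poly ` E) \<subseteq> (mono_ideal E :: ('n, 'k) mpoly set)"
    by (intro ideal.span_minimal mono_ideal_subspace assms) (auto simp: mono_ideal_def mono_poly_def)
next
  show "(mono_ideal E :: ('n, 'k) mpoly set) \<subseteq> ideal.span (mono_poly ` E)"
  proof
    fix p :: "('n, 'k) mpoly" assume "p \<in> mono_ideal E"
    then have "const_poly (lookup p m) * mono_poly m \<in> ideal.span (mono_poly ` E)" if "m \<in> keys p" for m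
      using that by (intro ideal.span_scale ideal.span_base) (auto simp: mono_ideal_def)
    then have "(\<Sum>m\<in>keys p. const_poly (lookup p m) * mono_poly m) \<in> ideal.span (mono_poly ` E)"
      by (rule ideal.span_sum)
    then show "p \<in> ideal.span (mono_poly ` E)"
      using poly_mapping_sum_single[of p] by (simp add: const_mult_mono)
  qed
qed

lemma mono_ideal_eq_iff:
  "mono_ideal E = (mono_ideal F :: ('n, 'k::comm_ring_1) mpoly set) \<longleftrightarrow> E = F"
proof
  assume eq: "mono_ideal E = (mono_ideal F :: ('n, 'k) mpoly set)"
  have "m \<in> G \<longleftrightarrow> mono_poly m \<in> (mono_ideal G :: ('n, 'k) mpoly set)" for m G
    by (simp add: mono_ideal_def mono_poly_def)
  then show "E = F" using eq by blast
qed simp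

lemma hclosed_mono_ideal: "hclosed (mono_ideal E)"
  by (auto simp: hclosed_def mono_ideal_def keys_hpart)

locale monomial_order =
  fixes \<sigma> :: "'n::finite monomial rel"
  assumes order: "term_order \<sigma>"
begin

lemma ord_refl: "(m, m) \<in> \<sigma>"
  using order by (simp add: term_order_def linear_order_on_def partial_order_on_def preorder_on_def refl_on_def)

lemma ord_trans: "(l, m) \<in> \<sigma> \<Longrightarrow> (m, n) \<in> \<sigma> \<Longrightarrow> (l, n) \<in> \<sigma>"
  using order unfolding term_order_def linear_order_on_def partial_order_on_def preorder_on_def
  by (meson transD)

lemma ord_antisym: "(m, n) \<in> \<sigma> \<Longrightarrow> (n, m) \<in> \<sigma> \<Longrightarrow> m = n"
  using order unfolding term_order_def linear_order_on_def partial_order_on_def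
  by (meson antisymD)

lemma ord_total: "(m, n) \<in> \<sigma> \<or> (n, m) \<in> \<sigma>"
  using order ord_refl[of m] unfolding term_order_def linear_order_on_def total_on_def
  by (cases "m = n") auto

lemma ord_add: "(m, n) \<in> \<sigma> \<Longrightarrow> (m + t, n + t) \<in> \<sigma>"
  using order unfolding term_order_def by blast

lemma ex_max:
  assumes "finite S" "S \<noteq> {}" shows "\<exists>m\<in>S. \<forall>t\<in>S. (t, m) \<in> \<sigma>"
  using assms
proof (induction S rule: finite_ne_induct)
  case (insert x S)
  then obtain m where "m \<in> S" "\<forall>t\<in>S. (t, m) \<in> \<sigma>" by blast
  then show ?case using ord_total[of x m] ord_refl ord_trans by blast
qed (simp add: ord_refl)

lemma ex_min:
  assumes "finite S" "S \<noteq> {}" shows "\<exists>m\<in>S. \<forall>t\<in>S. (m, t) \<in> \<sigma>"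
  using assms
proof (induction S rule: finite_ne_induct)
  case (insert x S)
  then obtain m where "m \<in> S" "\<forall>t\<in>S. (m, t) \<in> \<sigma>" by blast
  then show ?case using ord_total[of x m] ord_refl ord_trans by blast
qed (simp add: ord_refl)

lemma lead_mono_eqI:
  assumes "m \<in> keys p" "\<And>t. t \<in> keys p \<Longrightarrow> (t, m) \<in> \<sigma>"
  shows "lead_mono \<sigma> p = m"
  unfolding lead_mono_def using assms ord_antisym by (intro the_equality) blast+

lemma leads_eq: "leads \<sigma> V = {lead_mono \<sigma> p |p. p \<in> V \<and> p \<noteq> 0}"
proof
  show "leads \<sigma> V \<subseteq> {lead_mono \<sigma> p |p. p \<in> V \<and> p \<noteq> 0}"
  proof
    fix m assume "m \<in> leads \<sigma> V"
    then obtain p where "p \<in> V" "m \<in> keys p" "\<And>t. t \<in> keys p \<Longrightarrow> (t, m) \<in> \<sigma>"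
      by (auto simp: leads_def)
    moreover from this have "lead_mono \<sigma> p = m" "p \<noteq> 0" by (auto intro: lead_mono_eqI)
    ultimately show "m \<in> {lead_mono \<sigma> p |p. p \<in> V \<and> p \<noteq> 0}" by blast
  qed
next
  show "{lead_mono \<sigma> p |p. p \<in> V \<and> p \<noteq> 0} \<subseteq> leads \<sigma> V"
  proof clarify
    fix p assume "p \<in> V" "p \<noteq> 0"
    then obtain m where "m \<in> keys p" "\<forall>t\<in>keys p. (t, m) \<in> \<sigma>"
      using ex_max[of "keys p"] by auto
    then show "lead_mono \<sigma> p \<in> leads \<sigma> V"
      using \<open>p \<in> V\<close> lead_mono_eqI[of m p] by (auto simp: leads_def)
  qed
qed

lemma mono_closed_leads:
  fixes V :: "('n, 'k::comm_ring_1) mpoly set"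
  assumes "ideal.subspace V" shows "mono_closed (leads \<sigma> V)"
  unfolding mono_closed_def
proof (intro ballI allI)
  fix m t assume "m \<in> leads \<sigma> V"
  then obtain p where p: "p \<in> V" "m \<in> keys p" "\<forall>s\<in>keys p. (s, m) \<in> \<sigma>" by (auto simp: leads_def)
  have "mono_poly t * p \<in> V" using assms p(1) by (rule ideal.subspace_scale)
  moreover have "t + m \<in> keys (mono_poly t * p)" "\<forall>s\<in>keys (mono_poly t * p). (s, t + m) \<in> \<sigma>"
    using p(2,3) ord_add by (auto simp: keys_mono_mult add.commute[of t])
  ultimately show "t + m \<in> leads \<sigma> V" unfolding leads_def by blast
qed

lemma initial_ideal_eq:
  fixes V :: "('n, 'k::comm_ring_1) mpoly set"
  assumes "ideal.subspace V"
  shows "initial_ideal \<sigma> V = mono_ideal (leads \<sigma> V)"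
proof -
  have "{mono_poly (lead_mono \<sigma> p) |p. p \<in> V \<and> p \<noteq> 0} = (mono_poly ` leads \<sigma> V :: ('n, 'k) mpoly set)"
    by (auto simp: leads_eq)
  then show ?thesis
    by (simp add: initial_ideal_def span_mono_poly mono_closed_leads assms)
qed

lemma homog_lead:
  fixes V :: "('n, 'k::comm_ring_1) mpoly set"
  assumes "hclosed V" "m \<in> leads \<sigma> V"
  obtains p where "p \<in> V" "homog (mdeg m) p" "m \<in> keys p" "\<And>t. t \<in> keys p \<Longrightarrow> (t, m) \<in> \<sigma>"
proof -
  obtain p where "p \<in> V" "m \<in> keys p" "\<forall>t\<in>keys p. (t, m) \<in> \<sigma>" using assms by (auto simp: leads_def)
  then show ?thesis using assms(1) that[of "hpart (mdeg m) p"]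
    by (auto simp: hclosed_def homog_hpart keys_hpart)
qed

text \<open>In a vanishing combination consider the largest leading monomial with nonzero
  coefficient: rows led by smaller monomials do not contain it, so nothing cancels it.\<close>

lemma distinct_leads_indep:
  fixes f :: "'n monomial \<Rightarrow> ('n, 'k::field) mpoly"
  assumes "finite S" "S \<subseteq> C" "\<And>m. m \<in> S \<Longrightarrow> m \<in> keys (f m)"
    and lead: "\<And>m t. m \<in> S \<Longrightarrow> t \<in> keys (f m) \<Longrightarrow> (t, m) \<in> \<sigma>"
  shows "rows_indep S C (\<lambda>m t. lookup (f m) t)"
proof (rule rows_indepI, rule ccontr)
  fix u d assume z: "\<forall>t\<in>C. (\<Sum>m\<in>S. u m * lookup (f m) t) = 0" and "d \<in> S" "u d \<noteq> 0"
  then obtain m where m: "m \<in> S" "u m \<noteq> 0" "\<And>t. t \<in> S \<Longrightarrow> u t \<noteq> 0 \<Longrightarrow> (t, m) \<in> \<sigma>"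
    using ex_max[of "{m\<in>S. u m \<noteq> 0}"] assms(1) by auto
  have zero: "u t * lookup (f t) m = 0" if "t \<in> S" "t \<noteq> m" for t
  proof (rule ccontr)
    assume "u t * lookup (f t) m \<noteq> 0"
    then have "(t, m) \<in> \<sigma>" "(m, t) \<in> \<sigma>" using m lead that by (auto simp: in_keys_iff)
    then show False using ord_antisym that by blast
  qed
  have "(\<Sum>t\<in>S. u t * lookup (f t) m) = (\<Sum>t\<in>S. if t = m then u m * lookup (f m) m else 0)"
    using zero by (intro sum.cong) simp_all
  then have "(\<Sum>t\<in>S. u t * lookup (f t) m) = u m * lookup (f m) m"
    using assms(1) m(1) by simp
  then show False using z m assms(2,3) by (auto simp: in_keys_iff)
qed

text \<open>The final segments of one degree. A form with a nonzero coefficient inside such a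
  segment also has its leading monomial inside, which ties counts of leading monomials to
  ranks.\<close>

definition upset :: "nat \<Rightarrow> 'n monomial set \<Rightarrow> bool" where
  "upset d C \<longleftrightarrow> (\<forall>m\<in>C. mdeg m = d) \<and> (\<forall>m\<in>C. \<forall>t. mdeg t = d \<longrightarrow> (m, t) \<in> \<sigma> \<longrightarrow> t \<in> C)"

lemma upset_finite: "upset d C \<Longrightarrow> finite C"
  by (rule finite_subset[OF _ finite_mdeg[of d]]) (auto simp: upset_def)

lemma upset_all: "upset d {m. mdeg m = d}"
  by (simp add: upset_def)

text \<open>With more rows than leading monomials in \<open>C\<close>, a nontrivial combination has
  coefficient zero at all of them. Independence on the columns \<open>C\<close> leaves a nonzero
  coefficient in \<open>C\<close>, so its leading monomial lies in \<open>C\<close> as well, a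
  contradiction.\<close>

lemma card_le_leads:
  fixes V :: "('n, 'k::field) mpoly set" and f :: "'d \<Rightarrow> ('n, 'k) mpoly"
  assumes "ideal.subspace V" "finite D" "upset d C"
    and f: "\<And>s. s \<in> D \<Longrightarrow> f s \<in> V" "\<And>s. s \<in> D \<Longrightarrow> homog d (f s)"
    and ind: "rows_indep D C (\<lambda>s m. lookup (f s) m)"
  shows "card D \<le> card (leads \<sigma> V \<inter> C)"
proof (rule ccontr)
  assume "\<not> card D \<le> card (leads \<sigma> V \<inter> C)"
  then obtain u where u: "\<exists>s\<in>D. u s \<noteq> 0" "\<And>m. m \<in> leads \<sigma> V \<inter> C \<Longrightarrow> (\<Sum>s\<in>D. u s * lookup (f s) m) = 0"
    using underdetermined_system[of "leads \<sigma> V \<inter> C" D "\<lambda>s m. lookup (f s) m"]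
      upset_finite[OF assms(3)] assms(2) by auto
  define p where "p = (\<Sum>s\<in>D. const_poly (u s) * f s)"
  have lookup_p: "lookup p m = (\<Sum>s\<in>D. u s * lookup (f s) m)" for m
    by (simp add: p_def lookup_sum)
  have pV: "p \<in> V" unfolding p_def
    using assms(1) f(1) by (intro ideal.subspace_sum ideal.subspace_scale)
  have hp: "homog d p" unfolding p_def using f(2) by (intro homog_sum homog_const_mult)
  obtain c where c: "c \<in> C" "lookup p c \<noteq> 0"
    using ind u(1) unfolding rows_indep_def lookup_p by blast
  then have "keys p \<noteq> {}" by (auto simp: in_keys_iff)
  then obtain m where m: "m \<in> keys p" "\<And>t. t \<in> keys p \<Longrightarrow> (t, m) \<in> \<sigma>"
    using ex_max[OF finite_keys] by blast
  then have "m \<in> leads \<sigma> V" using pV by (auto simp: leads_def)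
  moreover have "(c, m) \<in> \<sigma>" using m(2)[of c] c by (simp add: in_keys_iff)
  moreover have "mdeg m = d" using hp m(1) by (simp add: homog_def)
  ultimately have "m \<in> leads \<sigma> V" "m \<in> C" using assms(3) c(1) unfolding upset_def by blast+
  then have "lookup p m = 0" using u(2) by (simp add: lookup_p)
  then show False using m(1) by (simp add: in_keys_iff)
qed

end

section \<open>The orbit of an ideal\<close>

text \<open>For singular matrices the image of an ideal need not be an ideal; passing to the span lets
  specialization arguments use singular matrices as well.\<close>

definition orbit_ideal :: "('n::finite, 'k::comm_ring_1) mpoly set \<Rightarrow> 'k^'n^'n \<Rightarrow> ('n, 'k) mpoly set" where
  "orbit_ideal I A = ideal.span (linear_change A ` I)"

lemma orbit_ideal_subspace: "ideal.subspace (orbit_ideal I A)"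
  by (simp add: orbit_ideal_def ideal.subspace_span)

lemma linear_change_in_orbit: "p \<in> I \<Longrightarrow> linear_change A p \<in> orbit_ideal I A"
  by (simp add: orbit_ideal_def ideal.span_base)

text \<open>The image is already an ideal because multipliers can be pulled back through the inverse
  substitution.\<close>

lemma orbit_ideal_invertible:
  fixes A :: "'k::field^'n^'n::finite"
  assumes "ideal.subspace I" "invertible A"
  shows "orbit_ideal I A = linear_change A ` I"
  unfolding orbit_ideal_def ideal.span_eq_iff
proof (rule ideal.subspaceI)
  show "0 \<in> linear_change A ` I"
    using ideal.subspace_0[OF assms(1)] change.zero[of A] by (metis image_eqI)
next
  fix x y assume "x \<in> linear_change A ` I" "y \<in> linear_change A ` I"
  then show "x + y \<in> linear_change A ` I"
    using ideal.subspace_add[OF assms(1)] by (auto simp flip: change.add)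
next
  fix c x assume "x \<in> linear_change A ` I"
  then obtain y where y: "y \<in> I" "x = linear_change A y" by blast
  obtain B where "\<And>p. linear_change A (linear_change B p) = p"
    using linear_change_inverse[OF assms(2)] by blast
  then have "c * x = linear_change A (linear_change B c * y)" by (simp add: change.mult y)
  then show "c * x \<in> linear_change A ` I"
    using ideal.subspace_scale[OF assms(1) y(1)] by blast
qed

lemma hclosed_orbit_ideal: "hclosed I \<Longrightarrow> hclosed (orbit_ideal I A)"
  unfolding orbit_ideal_def
  by (rule hclosed_span) (auto simp: hclosed_def hpart_linear_change)

text \<open>An element found at one matrix deforms with the matrix: the multipliers of a
  representation stay fixed while the transformed generators move.\<close>

lemma orbit_ideal_family:
  fixes A :: "'k::field^'n^'n::finite"
  assumes "p \<in> orbit_ideal I A"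
  shows "\<exists>P. P A = p \<and> polycoeff P \<and> (\<forall>B. P B \<in> orbit_ideal I B)"
  using assms unfolding orbit_ideal_def
proof (induction rule: ideal.span_induct_alt)
  case base
  show ?case by (intro exI[of _ "\<lambda>_. 0"]) (simp add: polycoeff_const ideal.span_zero)
next
  case (step c x y)
  obtain f where f: "f \<in> I" "x = linear_change A f" using step(1) by blast
  obtain P where P: "P A = y" "polycoeff P" "\<forall>B. P B \<in> ideal.span (linear_change B ` I)"
    using step(2) by blast
  show ?case
  proof (intro exI[of _ "\<lambda>B. c * linear_change B f + P B"] conjI allI)
    show "polycoeff (\<lambda>B. c * linear_change B f + P B)"
      using P(2) by (intro polycoeff_add polycoeff_mult polycoeff_const polycoeff_linear_change)
    show "c * linear_change B f + P B \<in> ideal.span (linear_change B ` I)" for B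
      using f(1) P(3) by (intro ideal.span_add ideal.span_scale) (auto intro: ideal.span_base)
  qed (simp add: f P)
qed

section \<open>Semicontinuity of leading monomials and Hilbert functions\<close>

context monomial_order
begin

text \<open>Lower semicontinuity of the count. Deformed witnesses may change their leading
  monomials, but their independence on the columns \<open>C\<close> persists generically, and
  \<open>card_le_leads\<close> turns it back into a count. The matrix \<open>A\<close> may be
  singular, which the forest matrices exploit.\<close>

lemma generic_card_leads:
  fixes A :: "'k::field_char_0^'n^'n"
  assumes "hclosed I" "upset d C"
  shows "generic (\<lambda>B. card (leads \<sigma> (orbit_ideal I A) \<inter> C) \<le> card (leads \<sigma> (orbit_ideal I B) \<inter> C))"
proof -
  let ?S = "leads \<sigma> (orbit_ideal I A) \<inter> C"
  have fin: "finite ?S" using upset_finite[OF assms(2)] by simp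
  have "\<forall>m\<in>?S. \<exists>P. polycoeff P \<and> (\<forall>B. P B \<in> orbit_ideal I B) \<and> (\<forall>B. homog d (P B)) \<and>
      m \<in> keys (P A) \<and> (\<forall>t\<in>keys (P A). (t, m) \<in> \<sigma>)"
  proof
    fix m assume that: "m \<in> ?S"
    have "m \<in> leads \<sigma> (orbit_ideal I A)" "mdeg m = d" using that assms(2) by (auto simp: upset_def)
    then obtain p where p: "p \<in> orbit_ideal I A" "homog d p" "m \<in> keys p" "\<And>t. t \<in> keys p \<Longrightarrow> (t, m) \<in> \<sigma>"
      using homog_lead[OF hclosed_orbit_ideal[OF assms(1)]] by metis
    obtain P where P: "P A = p" "polycoeff P" "\<And>B. P B \<in> orbit_ideal I B"
      using orbit_ideal_family[OF p(1)] by blast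
    \<comment> \<open>Truncation to degree \<open>d\<close> keeps the witness at \<open>A\<close>
      and makes the whole family homogeneous.\<close>
    have "hpart d (P A) = p" using P(1) p(2) by (simp add: hpart_of_homog)
    then show "\<exists>P. polycoeff P \<and> (\<forall>B. P B \<in> orbit_ideal I B) \<and> (\<forall>B. homog d (P B)) \<and>
      m \<in> keys (P A) \<and> (\<forall>t\<in>keys (P A). (t, m) \<in> \<sigma>)"
      using P p hclosed_orbit_ideal[OF assms(1)]
      by (intro exI[of _ "\<lambda>B. hpart d (P B)"])
        (auto simp: hclosed_def polycoeff_hpart homog_hpart)
  qed
  from bchoice[OF this] obtain P where P: "\<And>m. m \<in> ?S \<Longrightarrow> polycoeff (P m)" "\<And>m B. m \<in> ?S \<Longrightarrow> P m B \<in> orbit_ideal I B"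
      "\<And>m B. m \<in> ?S \<Longrightarrow> homog d (P m B)" "\<And>m. m \<in> ?S \<Longrightarrow> m \<in> keys (P m A)"
      "\<And>m t. m \<in> ?S \<Longrightarrow> t \<in> keys (P m A) \<Longrightarrow> (t, m) \<in> \<sigma>"
    by blast
  have "rows_indep ?S C (\<lambda>m t. lookup (P m A) t)"
    using fin P by (intro distinct_leads_indep) auto
  then have "generic (\<lambda>B. rows_indep ?S C (\<lambda>m t. lookup (P m B) t))"
    using P(1) fin by (intro generic_rows_indep[of _ _ "\<lambda>B m t. lookup (P m B) t"]) (auto simp: polycoeff_def)
  then show ?thesis
    using P fin assms(2) by (elim generic_mono, intro card_le_leads[OF orbit_ideal_subspace]) auto
qed

text \<open>Invariance of the Hilbert function. Images of the monomials in \<open>E\<close> are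
  independent and so produce enough leading monomials; conversely, forms with distinct leading
  monomials pull back to independent forms supported on \<open>E\<close>.\<close>

lemma card_leads_mono_ideal:
  fixes A :: "'k::field^'n^'n"
  assumes E: "mono_closed E" and A: "invertible A"
  shows "card (leads \<sigma> (orbit_ideal (mono_ideal E) A) \<inter> {m. mdeg m = d}) = card {m\<in>E. mdeg m = d}"
proof (rule antisym_conv[THEN iffD1])
  let ?I = "mono_ideal E :: ('n, 'k) mpoly set"
  let ?V = "orbit_ideal ?I A"
  have zero: "p = 0" if "homog d p" "\<And>m. mdeg m = d \<Longrightarrow> lookup p m = 0" for p :: "('n, 'k) mpoly"
    using that by (intro poly_mapping_eqI) (metis homog_def in_keys_iff lookup_zero)
  have finE: "finite {m\<in>E. mdeg m = d}"
    by (rule finite_subset[OF _ finite_mdeg[of d]]) auto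
  have indE: "rows_indep {m\<in>E. mdeg m = d} {m. mdeg m = d} (\<lambda>m t. lookup (linear_change A (mono_poly m)) t)"
  proof (rule rows_indepI)
    fix u s
    define q where "q = (\<Sum>m\<in>{m\<in>E. mdeg m = d}. const_poly (u m) * mono_poly m :: ('n, 'k) mpoly)"
    assume z: "\<forall>c\<in>{m. mdeg m = d}. (\<Sum>m\<in>{m\<in>E. mdeg m = d}. u m * lookup (linear_change A (mono_poly m)) c) = 0"
      and s: "s \<in> {m\<in>E. mdeg m = d}"
    have hq: "homog d q" unfolding q_def
      by (intro homog_sum homog_const_mult) (metis (lifting) homog_mono_poly mem_Collect_eq)
    have "linear_change A q = (\<Sum>m\<in>{m\<in>E. mdeg m = d}. const_poly (u m) * linear_change A (mono_poly m))"
      by (simp add: q_def change.hom_sum change.mult)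
    then have "lookup (linear_change A q) c = 0" if "mdeg c = d" for c
      using z that by (simp add: lookup_sum)
    then have "linear_change A q = 0" by (intro zero homog_linear_change hq)
    then have "q = 0" using linear_change_eq_0_iff[OF A] by blast
    moreover have "lookup (const_poly (u m) * mono_poly m) s = (if m = s then u s else 0)" for m
      by (simp add: mono_poly_def lookup_single when_def)
    then have "lookup q s = u s" using s finE by (simp add: q_def lookup_sum)
    ultimately show "u s = 0" by simp
  qed
  show "card {m\<in>E. mdeg m = d} \<le> card (leads \<sigma> ?V \<inter> {m. mdeg m = d})"
    using finE indE
    by (intro card_le_leads[OF orbit_ideal_subspace _ upset_all])
      (auto simp: mono_ideal_def mono_poly_def
        intro!: linear_change_in_orbit homog_linear_change homog_single)
  show "card (leads \<sigma> ?V \<inter> {m. mdeg m = d}) \<le> card {m\<in>E. mdeg m = d}"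
  proof -
    let ?S = "leads \<sigma> ?V \<inter> {m. mdeg m = d}"
    have fin: "finite ?S" by (rule finite_subset[OF _ finite_mdeg[of d]]) auto
    have "\<forall>m\<in>?S. \<exists>g. g \<in> ?I \<and> homog d g \<and> homog d (linear_change A g) \<and> m \<in> keys (linear_change A g) \<and>
        (\<forall>t\<in>keys (linear_change A g). (t, m) \<in> \<sigma>)"
    proof
      fix m assume m: "m \<in> ?S"
      obtain p where p: "p \<in> ?V" "homog d p" "m \<in> keys p" "\<And>t. t \<in> keys p \<Longrightarrow> (t, m) \<in> \<sigma>"
        using homog_lead[OF hclosed_orbit_ideal[OF hclosed_mono_ideal]] m by (metis (lifting) IntD1 IntD2 mem_Collect_eq)
      obtain g where g: "g \<in> ?I" "p = linear_change A g"
        using p(1) orbit_ideal_invertible[OF mono_ideal_subspace[OF E] A] by blast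
      have "linear_change A (hpart d g) = p"
        using g p(2) by (simp add: hpart_linear_change[symmetric] hpart_of_homog)
      then show "\<exists>g. g \<in> ?I \<and> homog d g \<and> homog d (linear_change A g) \<and> m \<in> keys (linear_change A g) \<and>
        (\<forall>t\<in>keys (linear_change A g). (t, m) \<in> \<sigma>)"
        using g p hclosed_mono_ideal[of E]
        by (intro exI[of _ "hpart d g"]) (auto simp: homog_hpart hclosed_def)
    qed
    from bchoice[OF this] obtain g where g: "\<And>m. m \<in> ?S \<Longrightarrow> g m \<in> ?I" "\<And>m. m \<in> ?S \<Longrightarrow> homog d (g m)"
        "\<And>m. m \<in> ?S \<Longrightarrow> m \<in> keys (linear_change A (g m))"
        "\<And>m t. m \<in> ?S \<Longrightarrow> t \<in> keys (linear_change A (g m)) \<Longrightarrow> (t, m) \<in> \<sigma>"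
      by blast
    have ind: "rows_indep ?S UNIV (\<lambda>m t. lookup (linear_change A (g m)) t)"
      using fin g by (intro distinct_leads_indep) auto
    have "rows_indep ?S {m\<in>E. mdeg m = d} (\<lambda>m t. lookup (g m) t)"
    proof (rule rows_indepI)
      fix u s
      assume z: "\<forall>t\<in>{m\<in>E. mdeg m = d}. (\<Sum>m\<in>?S. u m * lookup (g m) t) = 0" and s: "s \<in> ?S"
      define q where "q = (\<Sum>m\<in>?S. const_poly (u m) * g m)"
      have "lookup q t = 0" for t
      proof (cases "t \<in> {m\<in>E. mdeg m = d}")
        case True
        then show ?thesis using z by (simp add: q_def lookup_sum)
      next
        case False
        then have "lookup (g m) t = 0" if "m \<in> ?S" for m
          using g(1,2)[OF that] by (auto simp: mono_ideal_def homog_def in_keys_iff)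
        then show ?thesis by (simp add: q_def lookup_sum)
      qed
      then have "q = 0" by (intro poly_mapping_eqI) simp
      then have "linear_change A q = 0" by (simp add: change.zero)
      moreover have "linear_change A q = (\<Sum>m\<in>?S. const_poly (u m) * linear_change A (g m))"
        by (simp add: q_def change.hom_sum change.mult)
      ultimately have "lookup (\<Sum>m\<in>?S. const_poly (u m) * linear_change A (g m)) t = 0" for t
        by simp
      then have "(\<Sum>m\<in>?S. u m * lookup (linear_change A (g m)) t) = 0" for t
        by (simp add: lookup_sum)
      then show "u s = 0" using rows_indepD[OF ind _ s] by blast
    qed
    then show ?thesis using fin finE by (intro rows_indep_card_le) auto
  qed
qed

text \<open>The smallest element \<open>m\<close> of \<open>C\<close> is decided last. Above it the
  leading monomials are generically constant by induction. If \<open>m\<close> is leading at one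
  matrix with this generic upper part, semicontinuity of the count makes it leading generically;
  otherwise it is leading at no such matrix.\<close>

lemma generic_leads_upset:
  assumes "hclosed (I :: ('n, 'k::field_char_0) mpoly set)" "upset d C"
  shows "\<exists>S. generic (\<lambda>A. leads \<sigma> (orbit_ideal I A) \<inter> C = S)"
  using assms(2)
proof (induction "card C" arbitrary: C)
  case 0
  then have "C = {}" using upset_finite by auto
  then show ?case using generic_True by (intro exI[of _ "{}"]) simp
next
  case (Suc k)
  let ?L = "\<lambda>A. leads \<sigma> (orbit_ideal I A)"
  have fin: "finite C" using Suc upset_finite by blast
  obtain m where m: "m \<in> C" "\<And>t. t \<in> C \<Longrightarrow> (m, t) \<in> \<sigma>" using ex_min[of C] fin Suc(2) by fastforce
  let ?C = "C - {m}"
  have "upset d ?C" using Suc(3) m ord_antisym unfolding upset_def by blast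
  moreover have "k = card ?C" using Suc(2) m(1) fin by simp
  ultimately obtain S where S: "generic (\<lambda>A. ?L A \<inter> ?C = S)" using Suc(1) by blast
  show ?case
  proof (cases "\<exists>A. ?L A \<inter> ?C = S \<and> m \<in> ?L A")
    case True
    then obtain A where A: "?L A \<inter> ?C = S" "m \<in> ?L A" by blast
    then have LA: "?L A \<inter> C = insert m S" "m \<notin> S" "finite S" using m(1) fin by auto
    have "generic (\<lambda>B. ?L B \<inter> ?C = S \<and> card (?L A \<inter> C) \<le> card (?L B \<inter> C))"
      by (intro generic_conj S generic_card_leads[of _ d] assms Suc(3))
    then have "generic (\<lambda>B. ?L B \<inter> C = insert m S)"
    proof (rule generic_mono)
      fix B assume B: "?L B \<inter> ?C = S \<and> card (?L A \<inter> C) \<le> card (?L B \<inter> C)"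
      have "m \<in> ?L B"
      proof (rule ccontr)
        assume "m \<notin> ?L B"
        then have "?L B \<inter> C = S" using B by blast
        then show False using B LA by simp
      qed
      then show "?L B \<inter> C = insert m S" using B m(1) by blast
    qed
    then show ?thesis by blast
  next
    case False
    have "generic (\<lambda>B. ?L B \<inter> C = S)"
      using S by (rule generic_mono) (use False m(1) in blast)
    then show ?thesis by blast
  qed
qed

end

section \<open>Dickson's lemma\<close>

lemma nat_incseq_subseq:
  fixes f :: "nat \<Rightarrow> nat"
  shows "\<exists>r. strict_mono r \<and> incseq (\<lambda>n. f (r n))"
proof -
  obtain g where g: "strict_mono g" "monoseq (\<lambda>n. f (g n))" using seq_monosub by blast
  show ?thesis
  proof (cases "incseq (\<lambda>n. f (g n))")
    case False
    then have dec: "decseq (\<lambda>n. f (g n))" using g(2) by (auto simp: monoseq_iff)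
    obtain N where N: "\<And>n. f (g N) \<le> f (g n)"
      using ex_has_least_nat[of "\<lambda>_. True" 0 "\<lambda>n. f (g n)"] by auto
    have "f (g (N + n)) = f (g N)" for n using N[of "N + n"] decseqD[OF dec, of N "N + n"] by simp
    then show ?thesis using g(1)
      by (intro exI[of _ "\<lambda>n. g (N + n)"]) (auto simp: strict_mono_def incseq_def)
  qed (use g in blast)
qed

text \<open>\<open>Y\<close> consists of the minimal elements for divisibility. If there were
  infinitely many, a sequence of them, thinned out once for each variable, would become monotone in
  every exponent, and two distinct minimal elements would be comparable.\<close>

lemma dickson:
  fixes X :: "'n::finite monomial set"
  shows "\<exists>Y\<subseteq>X. finite Y \<and> (\<forall>x\<in>X. \<exists>y\<in>Y. \<forall>i. lookup y i \<le> lookup x i)"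
proof -
  define le where "le = (\<lambda>s t :: 'n monomial. \<forall>i. lookup s i \<le> lookup t i)"
  define Y where "Y = {y\<in>X. \<forall>x\<in>X. le x y \<longrightarrow> x = y}"
  have above: "\<exists>y\<in>Y. le y x" if "x \<in> X" for x
    using that
  proof (induction "mdeg x" arbitrary: x rule: less_induct)
    case less
    show ?case
    proof (cases "x \<in> Y")
      case False
      then obtain z where z: "z \<in> X" "le z x" "z \<noteq> x" using less(2) by (auto simp: Y_def)
      then have "x = z + (x - z)" using monomial_diff unfolding le_def by blast
      then have "mdeg x = mdeg z + mdeg (x - z)" "x - z \<noteq> 0" using z(3) by (metis mdeg_add, force)
      moreover have "mdeg m \<noteq> 0" if "m \<noteq> 0" for m :: "'n monomial"
        using that by (auto simp: mdeg_def poly_mapping_eq_iff fun_eq_iff)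
      ultimately obtain y where "y \<in> Y" "le y z" using less(1)[of z] z(1) by fastforce
      then show ?thesis using z(2) order_trans unfolding le_def by blast
    qed (auto simp: le_def)
  qed
  have "finite Y"
  proof (rule ccontr)
    assume "infinite Y"
    then obtain s :: "nat \<Rightarrow> 'n monomial" where s: "inj s" "range s \<subseteq> Y"
      using infinite_countable_subset by blast
    have "\<exists>r. strict_mono r \<and> (\<forall>i\<in>V. incseq (\<lambda>n. lookup (s (r n)) i))" if "finite V" for V
      using that
    proof (induction V rule: finite_induct)
      case empty
      then show ?case using strict_mono_id by blast
    next
      case (insert i V)
      then obtain r where r: "strict_mono r" "\<forall>i\<in>V. incseq (\<lambda>n. lookup (s (r n)) i)" by blast
      obtain q where q: "strict_mono q" "incseq (\<lambda>n. lookup (s (r (q n))) i)"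
        using nat_incseq_subseq[of "\<lambda>n. lookup (s (r n)) i"] by blast
      have "incseq (\<lambda>n. lookup (s (r (q n))) j)" if "j \<in> V" for j
        using r(2) that q(1) by (auto simp: incseq_def strict_mono_less_eq)
      then show ?case using r(1) q by (intro exI[of _ "\<lambda>n. r (q n)"]) (auto simp: strict_mono_def)
    qed
    from this[of UNIV] obtain r where r: "strict_mono r" "\<And>i. incseq (\<lambda>n. lookup (s (r n)) i)" by auto
    have "le (s (r 0)) (s (r 1))" using incseqD[OF r(2), of 0 1] by (simp add: le_def)
    moreover have "s (r 0) \<in> Y" "s (r 1) \<in> Y" using s(2) by auto
    ultimately have "s (r 0) = s (r 1)" unfolding Y_def by blast
    then have "r 0 = r 1" using s(1) by (simp add: inj_eq)
    then show False using strict_monoD[OF r(1), of 0 1] by simp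
  qed
  moreover have "Y \<subseteq> X" by (auto simp: Y_def)
  ultimately show ?thesis using above unfolding le_def by (intro exI[of _ Y]) simp
qed

section \<open>Existence and uniqueness of the generic initial ideal\<close>

context monomial_order
begin

text \<open>Each degree is settled by an open condition, but infinitely many such conditions need
  not have a common matrix. The minimal generators \<open>Y\<close> of the candidate
  \<open>J\<close> live in finitely many degrees. Fixing these puts \<open>J\<close> inside the
  leading monomials in all degrees, and equality of Hilbert functions leaves no room for
  more.\<close>

lemma ex_generic_leads:
  assumes E: "mono_closed E"
  shows "\<exists>J. generic (\<lambda>A :: 'k::field_char_0^'n^'n. leads \<sigma> (orbit_ideal (mono_ideal E) A) = J)"
proof -
  let ?L = "\<lambda>A :: 'k^'n^'n. leads \<sigma> (orbit_ideal (mono_ideal E) A)"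
  have "\<exists>S. generic (\<lambda>A. ?L A \<inter> {m. mdeg m = d} = S)" for d
    by (rule generic_leads_upset[OF hclosed_mono_ideal upset_all])
  then obtain S where S: "\<And>d. generic (\<lambda>A. ?L A \<inter> {m. mdeg m = d} = S d)" by metis
  have Sd: "finite (S d) \<and> card (S d) = card {m\<in>E. mdeg m = d} \<and> (\<forall>m\<in>S d. mdeg m = d)" for d
  proof -
    obtain A where "invertible A" "?L A \<inter> {m. mdeg m = d} = S d"
      using generic_ex[OF generic_conj[OF generic_invertible S]] by blast
    moreover have "finite (S d)"
      by (rule finite_subset[OF _ finite_mdeg[of d]]) (use calculation in auto)
    ultimately show ?thesis using card_leads_mono_ideal[OF E, of A d] by auto
  qed
  define J where "J = (\<Union>d. S d)"
  obtain Y where Y: "Y \<subseteq> J" "finite Y" "\<And>x. x \<in> J \<Longrightarrow> \<exists>y\<in>Y. \<forall>i. lookup y i \<le> lookup x i"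
    using dickson[of J] by blast
  have "generic (\<lambda>A. invertible A \<and> (\<forall>d\<in>mdeg ` Y. ?L A \<inter> {m. mdeg m = d} = S d))"
    using Y(2) S by (intro generic_conj generic_invertible generic_ball) auto
  then have "generic (\<lambda>A. ?L A = J)"
  proof (rule generic_mono)
    fix A assume A: "invertible A \<and> (\<forall>d\<in>mdeg ` Y. ?L A \<inter> {m. mdeg m = d} = S d)"
    have "Y \<subseteq> ?L A"
    proof
      fix y assume y: "y \<in> Y"
      then obtain d where "y \<in> S d" using Y(1) by (auto simp: J_def)
      then have "y \<in> S (mdeg y)" using Sd by metis
      then show "y \<in> ?L A" using A y by blast
    qed
    moreover have "mono_closed (?L A)" by (rule mono_closed_leads[OF orbit_ideal_subspace])
    ultimately have sub: "J \<subseteq> ?L A"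
      using Y(3) monomial_diff unfolding mono_closed_def by (metis add.commute subset_iff)
    have "?L A \<inter> {m. mdeg m = d} = S d" for d
      using sub Sd[of d] A card_leads_mono_ideal[OF E, of A d] finite_mdeg[of d]
      by (intro card_subset_eq[symmetric]) (auto simp: J_def)
    then show "?L A = J" unfolding J_def by blast
  qed
  then show ?thesis by blast
qed

end

text \<open>The definite description is legitimate because any two nonempty open sets of matrices
  share an invertible matrix.\<close>

lemma gin_eqI:
  fixes I :: "('n::finite, 'k::field_char_0) mpoly set"
  assumes "generic (\<lambda>A. initial_ideal \<sigma> (linear_change A ` I) = J)"
  shows "gin \<sigma> I = J"
  unfolding gin_def
proof (rule the_equality)
  obtain g A where g: "polyfun g" "g A \<noteq> 0" "\<And>A. g A \<noteq> 0 \<Longrightarrow> initial_ideal \<sigma> (linear_change A ` I) = J"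
    using assms unfolding generic_def by blast
  then obtain f where f: "\<And>A. g A = poly_subst id (\<lambda>(i, j). A $ i $ j) f"
    unfolding polyfun_def by blast
  let ?U = "{A. invertible A \<and> g A \<noteq> 0}"
  have "zariski_open_GL ?U" unfolding zariski_open_GL_def
    by (intro exI[of _ "{f}"]) (simp add: f)
  moreover have "generic (\<lambda>A. invertible A \<and> g A \<noteq> 0)"
    using g by (intro generic_conj generic_invertible) (auto intro: genericI)
  then have "?U \<noteq> {}" using generic_ex by blast
  ultimately show "\<exists>U. zariski_open_GL U \<and> U \<noteq> {} \<and> (\<forall>A\<in>U. initial_ideal \<sigma> (linear_change A ` I) = J)"
    using g(3) by (intro exI[of _ ?U]) auto
next
  fix J' assume "\<exists>U. zariski_open_GL U \<and> U \<noteq> {} \<and> (\<forall>A\<in>U. initial_ideal \<sigma> (linear_change A ` I) = J')"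
  then obtain U A and F :: "('n \<times> 'n, 'k) mpoly set" where
    U: "U = {A. invertible A \<and> (\<exists>f\<in>F. poly_subst id (\<lambda>(i, j). A $ i $ j) f \<noteq> 0)}" "A \<in> U"
      "\<And>A. A \<in> U \<Longrightarrow> initial_ideal \<sigma> (linear_change A ` I) = J'"
    unfolding zariski_open_GL_def by blast
  then obtain f where f: "f \<in> F" "poly_subst id (\<lambda>(i, j). A $ i $ j) f \<noteq> 0" by blast
  have "generic (\<lambda>A. poly_subst id (\<lambda>(i, j). A $ i $ j) f \<noteq> 0)"
    by (rule genericI[of "\<lambda>A. poly_subst id (\<lambda>(i, j). A $ i $ j) f" A])
      (use f(2) in \<open>unfold polyfun_def, blast+\<close>)
  from generic_ex[OF generic_conj[OF generic_conj[OF this generic_invertible] assms]]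
  show "J' = J" using U f(1) by blast
qed

lemma generic_gin:
  fixes I :: "('n::finite, 'k::field_char_0) mpoly set"
  assumes "term_order \<sigma>" "ideal.subspace I" "generic (\<lambda>A. leads \<sigma> (orbit_ideal I A) = J)"
  shows "gin \<sigma> I = mono_ideal J"
proof -
  interpret monomial_order \<sigma> by unfold_locales (rule assms)
  from generic_conj[OF generic_invertible assms(3)] show ?thesis
  proof (intro gin_eqI, elim generic_mono conjE)
    fix A :: "'k^'n^'n" assume A: "invertible A" "leads \<sigma> (orbit_ideal I A) = J"
    then show "initial_ideal \<sigma> (linear_change A ` I) = mono_ideal J"
      using initial_ideal_eq[OF orbit_ideal_subspace] orbit_ideal_invertible[OF assms(2) A(1)] by metis
  qed
qed

section \<open>Edge ideals\<close>

definition edge_monos :: "'n set set \<Rightarrow> 'n monomial set" where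
  "edge_monos G = {m. \<exists>i j. i \<noteq> j \<and> {i, j} \<in> G \<and> 0 < lookup m i \<and> 0 < lookup m j}"

lemma mono_closed_edge_monos: "mono_closed (edge_monos G)"
  unfolding mono_closed_def edge_monos_def by (fastforce simp: lookup_add)

lemma edge_ideal_eq: "edge_ideal G = (mono_ideal (edge_monos G) :: ('n, 'k::comm_ring_1) mpoly set)"
proof
  have "var i * var j \<in> (mono_ideal (edge_monos G) :: ('n, 'k) mpoly set)" if "i \<noteq> j" "{i, j} \<in> G" for i j
  proof -
    have "var_mono i + var_mono j \<in> edge_monos G"
      unfolding edge_monos_def
      by (intro CollectI exI[of _ i] exI[of _ j]) (simp add: lookup_add lookup_var_mono that)
    moreover have "var i * var j = (mono_poly (var_mono i + var_mono j) :: ('n, 'k) mpoly)"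
      by (simp add: mono_poly_add)
    ultimately show ?thesis by (simp add: mono_ideal_def) (simp add: mono_poly_def)
  qed
  then show "edge_ideal G \<subseteq> (mono_ideal (edge_monos G) :: ('n, 'k) mpoly set)"
    unfolding edge_ideal_def
    by (intro ideal.span_minimal mono_ideal_subspace mono_closed_edge_monos) auto
next
  have "mono_poly m \<in> (edge_ideal G :: ('n, 'k) mpoly set)" if m: "m \<in> edge_monos G" for m
  proof -
    obtain i j where ij: "i \<noteq> j" "{i, j} \<in> G" "0 < lookup m i" "0 < lookup m j"
      using m unfolding edge_monos_def by blast
    have "m = (var_mono i + var_mono j) + (m - (var_mono i + var_mono j))"
      using ij by (intro monomial_diff) (auto simp: lookup_add lookup_var_mono)
    then have eq: "mono_poly m = mono_poly (m - (var_mono i + var_mono j)) * (var i * var j :: ('n, 'k) mpoly)"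
      by (metis mono_poly_add mult.commute)
    show ?thesis unfolding edge_ideal_def eq
      using ij by (intro ideal.span_scale ideal.span_base) blast
  qed
  then show "(mono_ideal (edge_monos G) :: ('n, 'k) mpoly set) \<subseteq> edge_ideal G"
    unfolding span_mono_poly[OF mono_closed_edge_monos, symmetric]
    by (intro ideal.span_minimal) (auto simp: edge_ideal_def)
qed

lemma var_mono_sum_eq_iff:
  "var_mono k + var_mono l = var_mono i + var_mono j \<longleftrightarrow> k = i \<and> l = j \<or> k = j \<and> l = i"
proof
  assume eq: "var_mono k + var_mono l = var_mono i + var_mono j"
  have "k = i \<or> k = j"
    using arg_cong[OF eq, of "\<lambda>m. lookup m k"]
    by (auto simp: lookup_add lookup_var_mono split: if_splits)
  then show "k = i \<and> l = j \<or> k = j \<and> l = i"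
  proof
    assume "k = i"
    then have "var_mono l = var_mono j" using eq by simp
    then show ?thesis using \<open>k = i\<close> by simp
  next
    assume "k = j"
    then have "var_mono l = var_mono i" using eq by (metis add.commute add_left_cancel)
    then show ?thesis using \<open>k = j\<close> by simp
  qed
qed (auto simp: add.commute)

lemma linear_form_mult:
  "linear_form v * linear_form w
     = (\<Sum>k\<in>UNIV. \<Sum>l\<in>UNIV. Poly_Mapping.single (var_mono k + var_mono l) (v k * w l))"
  by (simp add: linear_form_def const_mult_mono sum_product mult_single)

lemma lookup_linear_form_mult:
  "lookup (linear_form v * linear_form w) (var_mono i + var_mono j)
     = (if i = j then v i * w i else v i * w j + v j * w i)"
proof -
  have "lookup (linear_form v * linear_form w) (var_mono i + var_mono j)
      = (\<Sum>k\<in>UNIV. \<Sum>l\<in>UNIV. if k = i \<and> l = j \<or> k = j \<and> l = i then v k * w l else 0)"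
    by (simp add: linear_form_mult lookup_sum lookup_single when_def var_mono_sum_eq_iff)
  also have "\<dots> = (\<Sum>k\<in>UNIV. (if k = i then v i * w j else 0) +
      (if k = j \<and> i \<noteq> j then v j * w i else 0))"
  proof (rule sum.cong)
    fix k
    have "(\<Sum>l\<in>UNIV. if k = i \<and> l = j \<or> k = j \<and> l = i then v k * w l else 0)
      = (\<Sum>l\<in>UNIV. (if l = j then if k = i then v k * w l else 0 else 0)
          + (if l = i then if k = j \<and> i \<noteq> j then v k * w l else 0 else 0))"
      by (rule sum.cong) auto
    then show "(\<Sum>l\<in>UNIV. if k = i \<and> l = j \<or> k = j \<and> l = i then v k * w l else 0)
      = (if k = i then v i * w j else 0) + (if k = j \<and> i \<noteq> j then v j * w i else 0)"
      by (simp add: sum.distrib)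
  qed simp
  also have "\<dots> = (if i = j then v i * w i else v i * w j + v j * w i)"
    by (cases "i = j") (simp_all add: sum.distrib)
  finally show ?thesis .
qed

lemma keys_linear_form_mult:
  "keys (linear_form v * linear_form w) \<subseteq> {var_mono k + var_mono l |k l. v k \<noteq> 0 \<and> w l \<noteq> 0}"
proof
  fix m assume m: "m \<in> keys (linear_form v * linear_form w)"
  show "m \<in> {var_mono k + var_mono l |k l. v k \<noteq> 0 \<and> w l \<noteq> 0}"
  proof (rule ccontr)
    assume "m \<notin> {var_mono k + var_mono l |k l. v k \<noteq> 0 \<and> w l \<noteq> 0}"
    then have "lookup (Poly_Mapping.single (var_mono k + var_mono l) (v k * w l)) m = 0" for k l
      by (cases "v k = 0 \<or> w l = 0") (auto simp: lookup_single when_def)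
    then have "lookup (linear_form v * linear_form w) m = 0"
      by (simp add: linear_form_mult lookup_sum)
    then show False using m by (simp add: in_keys_iff)
  qed
qed

section \<open>Positions of variables\<close>

text \<open>The syntax \<open>'k^'n^'n\<close> forces the sort \<open>finite\<close> on \<open>'n\<close> and so excludes linearly ordered index types.\<close>

type_synonym ('k, 'n) sqmat = "(('k, 'n) vec, 'n) vec"

text \<open>Counting starts at 1, so that conditions on sums of indices can be expressed for an
  abstract ordered index type.\<close>

definition pos :: "'n::{finite, linorder} \<Rightarrow> nat" where
  "pos i = card {k. k \<le> i}"

lemma card_Compl: "card (- S :: 'a::finite set) = CARD('a) - card S"
  by (simp add: Compl_eq_Diff_UNIV card_Diff_subset)

lemma pos_mono: "i \<le> j \<Longrightarrow> pos i \<le> pos j"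
  unfolding pos_def by (rule card_mono) auto

lemma pos_strict_mono:
  assumes "i < j" shows "pos i < pos j"
proof -
  have "{k. k \<le> i} \<subseteq> {k. k \<le> j}" "j \<in> {k. k \<le> j}" "j \<notin> {k. k \<le> i}" using assms by auto
  then have "{k. k \<le> i} \<subset> {k. k \<le> j}" by blast
  then show ?thesis unfolding pos_def by (intro psubset_card_mono) auto
qed

lemma pos_le_iff: "pos i \<le> pos j \<longleftrightarrow> i \<le> j"
  using pos_mono pos_strict_mono by (metis not_le)

lemma pos_less_iff: "pos i < pos j \<longleftrightarrow> i < j"
  using pos_le_iff by (metis not_le)

lemma pos_eq_iff [simp]: "pos i = pos j \<longleftrightarrow> i = j"
  by (metis pos_le_iff antisym order_refl)

lemma bij_pos: "bij_betw (pos :: 'n::{finite, linorder} \<Rightarrow> nat) UNIV {1..CARD('n)}"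
proof -
  have inj: "inj (pos :: 'n \<Rightarrow> nat)" by (simp add: inj_on_def)
  have "1 \<le> pos i \<and> pos i \<le> CARD('n)" for i :: 'n
    unfolding pos_def by (auto intro!: card_mono simp: Suc_le_eq card_gt_0_iff)
  then have "range (pos :: 'n \<Rightarrow> nat) \<subseteq> {1..CARD('n)}" by auto
  moreover have "card (range (pos :: 'n \<Rightarrow> nat)) = card {1..CARD('n)}"
    using inj by (simp add: card_image)
  ultimately show ?thesis using inj by (simp add: bij_betw_def card_subset_eq)
qed

lemma ex_pos: "1 \<le> q \<Longrightarrow> q \<le> CARD('n) \<Longrightarrow> \<exists>i :: 'n::{finite, linorder}. pos i = q"
  using bij_pos[where 'n='n] unfolding bij_betw_def by (metis atLeastAtMost_iff imageE)

lemma pos_ge_1: "1 \<le> pos i" and pos_le_card: "pos (i :: 'n::{finite, linorder}) \<le> CARD('n)"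
  using bij_betwE[OF bij_pos[where 'n='n]] by auto

lemma card_pos_vimage:
  assumes "S \<subseteq> {1..CARD('n)}"
  shows "card {i :: 'n::{finite, linorder}. pos i \<in> S} = card S"
proof -
  have "pos ` {i :: 'n. pos i \<in> S} = S" using assms ex_pos[where 'n='n] by fastforce
  moreover have "card (pos ` {i :: 'n. pos i \<in> S}) = card {i :: 'n. pos i \<in> S}"
    by (rule card_image) (simp add: inj_on_def)
  ultimately show ?thesis by simp
qed

section \<open>The generic initial ideal of a complete bipartite graph\<close>

definition bip_monos :: "nat \<Rightarrow> nat \<Rightarrow> 'n::{finite, linorder} monomial set" where
  "bip_monos a b = {m. \<exists>i j. i \<le> j \<and> pos i \<le> a \<and> pos i + pos j \<le> a + b \<and>
     (\<forall>k. lookup (var_mono i + var_mono j) k \<le> lookup m k)}"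

text \<open>Let \<open>v\<close> and \<open>w\<close> be combinations of the images of
  \<open>P\<close> and of \<open>Q\<close>. The rows prescribe the coefficients of \<open>v\<close>
  up to \<open>i\<close> and of \<open>w - v\<close> up to \<open>j\<close>, which are
  \<open>pos i + pos j\<close> conditions on \<open>card P + card Q\<close> weights. In the witness
  matrix each vertex of \<open>P\<close> and \<open>Q\<close> goes to a single variable.\<close>

lemma bip_row_indep:
  fixes P Q :: "'n::{finite, linorder} set"
  assumes PQ: "P \<inter> Q = {}" "card P \<le> card Q"
    and ij: "i \<le> j" "pos i \<le> card P" "pos i + pos j \<le> card P + card Q"
  shows "\<exists>A :: ('k::field, 'n) sqmat. rows_indep ({..i} <+> {..j}) (P \<union> Q)
    (\<lambda>d c. case d of Inl k \<Rightarrow> if c \<in> P then A $ k $ c else 0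
                   | Inr k \<Rightarrow> if c \<in> Q then A $ k $ c else - A $ k $ c)"
proof -
  let ?a = "card P" and ?b = "card Q"
  have ab: "?a + ?b \<le> CARD('n)"
    using PQ(1) by (subst card_Un_disjoint[symmetric]) (auto intro!: card_mono)
  let ?R = "{k :: 'n. pos k \<in> {1..?a}}" and ?S = "{k :: 'n. pos k \<in> {1..pos i} \<union> {?a<..?a + ?b - pos i}}"
  have "card ?R = ?a" using ab by (subst card_pos_vimage) auto
  then obtain f where f: "bij_betw f P ?R"
    using finite_same_card_bij[of P ?R] by auto
  have "card ?S = card ({1..pos i} \<union> {?a<..?a + ?b - pos i})"
    using ab pos_le_card[of i] by (intro card_pos_vimage) auto
  also have "\<dots> = pos i + (?b - pos i)" using ij(2) by (subst card_Un_disjoint) auto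
  also have "\<dots> = ?b" using ij(2) PQ(2) by simp
  finally obtain g where g: "bij_betw g Q ?S"
    using finite_same_card_bij[of Q ?S] by auto
  define A :: "('k, 'n) sqmat" where
    "A = (\<chi> k c. if c \<in> P then if k = f c then 1 else 0 else if c \<in> Q then if k = g c then 1 else 0 else 0)"
  have "rows_indep ({..i} <+> {..j}) (P \<union> Q)
    (\<lambda>d c. case d of Inl k \<Rightarrow> if c \<in> P then A $ k $ c else 0
                   | Inr k \<Rightarrow> if c \<in> Q then A $ k $ c else - A $ k $ c)" (is "rows_indep ?D _ ?M")
  proof (rule rows_indepI)
    fix u d assume z: "\<forall>c\<in>P \<union> Q. (\<Sum>d\<in>?D. u d * ?M d c) = 0" and d: "d \<in> ?D"
    have z': "(\<Sum>k\<in>{..i}. u (Inl k) * ?M (Inl k) c) + (\<Sum>k\<in>{..j}. u (Inr k) * ?M (Inr k) c) = 0"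
      if "c \<in> P \<union> Q" for c
      using z that by (simp add: sum.Plus)
    have zQ: "u (Inr (g c)) = 0" if c: "c \<in> Q" "g c \<le> j" for c
    proof -
      have "c \<notin> P" using PQ(1) c(1) by auto
      then have "?M (Inl k) c = 0" "u (Inr k) * ?M (Inr k) c = (if k = g c then u (Inr k) else 0)" for k
        using c(1) by (auto simp: A_def)
      then show ?thesis using z'[of c] c by simp
    qed
    have zP: "(if f c \<le> i then u (Inl (f c)) else 0) = u (Inr (f c))" if c: "c \<in> P" "f c \<le> j" for c
    proof -
      have "c \<notin> Q" using PQ(1) c(1) by auto
      then have "u (Inl k) * ?M (Inl k) c = (if k = f c then u (Inl k) else 0)"
        "u (Inr k) * ?M (Inr k) c = (if k = f c then - u (Inr k) else 0)" for k
        using c(1) by (auto simp: A_def)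
      then have "(if f c \<le> i then u (Inl (f c)) else 0) - u (Inr (f c)) = 0" using z'[of c] c by simp
      then show ?thesis by simp
    qed
    have big: "u (Inr k) = 0" if k: "k \<le> j" "k \<le> i \<or> ?a < pos k" for k
    proof -
      have "pos k \<le> pos j" using k(1) by (rule pos_mono)
      then have "k \<in> ?S" using k ij(3) pos_ge_1[of k] pos_mono[of k i] by auto
      then obtain c where "c \<in> Q" "k = g c" using g unfolding bij_betw_def by blast
      then show ?thesis using zQ k(1) by blast
    qed
    have small: "(if k \<le> i then u (Inl k) else 0) = u (Inr k)" if k: "k \<le> j" "pos k \<le> ?a" for k
    proof -
      have "k \<in> ?R" using k pos_ge_1[of k] by auto
      then obtain c where "c \<in> P" "k = f c" using f unfolding bij_betw_def by blast
      then show ?thesis using zP k(1) by blast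
    qed
    have r: "u (Inr k) = 0" if "k \<le> j" for k
      using big[OF that] small[OF that] by (cases "pos k \<le> ?a \<and> \<not> k \<le> i") auto
    have l: "u (Inl k) = 0" if "k \<le> i" for k
    proof -
      have "k \<le> j" "pos k \<le> ?a" using that ij pos_mono[OF that] by auto
      then show ?thesis using small[of k] r[of k] that by simp
    qed
    show "u d = 0" using d l r by auto
  qed
  then show ?thesis by blast
qed

context
  fixes \<sigma> :: "'n::{finite, linorder} monomial rel"
  assumes ord: "term_order \<sigma>" and dec: "decreasing_vars \<sigma>"
begin

interpretation monomial_order \<sigma> by unfold_locales (rule ord)

lemma var_mono_order: "i \<le> j \<Longrightarrow> (var_mono j, var_mono i) \<in> \<sigma>"
  using dec ord_refl unfolding decreasing_vars_def by (cases "i = j") auto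

text \<open>The weights \<open>s\<close> make \<open>v\<close> and \<open>w\<close> agree up to
  \<open>j\<close> and start with \<open>x_i\<close>; the weights \<open>t\<close> make
  \<open>w - v\<close> equal to \<open>x_j\<close> up to \<open>j\<close>. Modulo the variables
  after \<open>x_j\<close> the quadric is \<open>v s\<close> times \<open>x_j\<close>, and none of
  the four forms has a variable before \<open>x_i\<close>. So each term \<open>x_k x_l\<close> with
  \<open>k \<le> l\<close> satisfies \<open>i \<le> k\<close> and \<open>j \<le> l\<close>, and is
  at most \<open>x_i x_j\<close> in every order with decreasing variables.\<close>

lemma bip_quadric_lead:
  fixes A :: "('k::field, 'n) sqmat"
  assumes PQ: "P \<inter> Q = {}" and closed: "mono_closed E"
    and E: "\<And>k l. k \<in> P \<Longrightarrow> l \<in> Q \<Longrightarrow> var_mono k + var_mono l \<in> E"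
    and ij: "i \<le> j"
    and ind: "rows_indep ({..i} <+> {..j}) (P \<union> Q)
      (\<lambda>d c. case d of Inl k \<Rightarrow> if c \<in> P then A $ k $ c else 0
                     | Inr k \<Rightarrow> if c \<in> Q then A $ k $ c else - A $ k $ c)" (is "rows_indep ?D _ ?M")
  shows "var_mono i + var_mono j \<in> leads \<sigma> (orbit_ideal (mono_ideal E) A)"
proof -
  define v where "v = (\<lambda>x k. \<Sum>c\<in>UNIV. A $ k $ c * (if c \<in> P then x c else 0))"
  define w where "w = (\<lambda>x k. \<Sum>c\<in>UNIV. A $ k $ c * (if c \<in> Q then x c else 0))"
  have Inl: "(\<Sum>c\<in>P \<union> Q. ?M (Inl k) c * x c) = v x k" for x k
    unfolding v_def by (rule sum.mono_neutral_cong_left) auto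
  have Inr: "(\<Sum>c\<in>P \<union> Q. ?M (Inr k) c * x c) = w x k - v x k" for x k
    unfolding v_def w_def sum_subtractf[symmetric]
    using PQ by (intro sum.mono_neutral_cong_left) auto
  have solve: "\<exists>x. (\<forall>k\<le>i. v x k = b (Inl k)) \<and> (\<forall>k\<le>j. w x k - v x k = b (Inr k))" for b
  proof -
    obtain x where x: "\<And>d. d \<in> ?D \<Longrightarrow> (\<Sum>c\<in>P \<union> Q. ?M d c * x c) = b d"
      using rows_indep_solvable[OF _ _ ind, of b] by auto
    have "v x k = b (Inl k)" if "k \<le> i" for k
      unfolding Inl[symmetric] using that by (intro x) blast
    moreover have "w x k - v x k = b (Inr k)" if "k \<le> j" for k
      unfolding Inr[symmetric] using that by (intro x) blast
    ultimately show ?thesis by blast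
  qed
  obtain s where s: "\<And>k. k \<le> i \<Longrightarrow> v s k = (if k = i then 1 else 0)" "\<And>k. k \<le> j \<Longrightarrow> w s k = v s k"
    using solve[of "\<lambda>d. if d = Inl i then 1 else 0"] by auto
  obtain t where t: "\<And>k. k \<le> i \<Longrightarrow> v t k = 0" "\<And>k. k \<le> j \<Longrightarrow> w t k = v t k + (if k = j then 1 else 0)"
    using solve[of "\<lambda>d. if d = Inr j then 1 else 0"] by (auto simp: algebra_simps)
  define p where "p = (\<lambda>S x. linear_form (\<lambda>c. if c \<in> S then x c else 0) :: ('n, 'k) mpoly)"
  define q where "q = linear_form (v s) * linear_form (w t) - linear_form (v t) * linear_form (w s)"
  have "q = linear_change A (p P s * p Q t + const_poly (-1) * (p P t * p Q s))"
    by (simp add: q_def p_def change.add change.mult linear_change_linear_form v_def[abs_def] w_def[abs_def])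
      (simp add: const_poly_def single_uminus)
  moreover have pq: "p P x * p Q y \<in> mono_ideal E" for x y
    unfolding mono_ideal_def p_def using keys_linear_form_mult E by (fastforce split: if_splits)
  then have "p P s * p Q t + const_poly (-1) * (p P t * p Q s) \<in> mono_ideal E"
    by (intro ideal.subspace_add[OF mono_ideal_subspace[OF closed]]
        ideal.subspace_scale[OF mono_ideal_subspace[OF closed], of "p P t * p Q s"] pq)
  ultimately have q: "q \<in> orbit_ideal (mono_ideal E) A" by (simp add: linear_change_in_orbit)
  have lookup_q: "lookup q (var_mono k + var_mono l) = (if k = l then v s k * w t k - v t k * w s k
      else v s k * w t l + v s l * w t k - (v t k * w s l + v t l * w s k))" for k l
    by (simp add: q_def lookup_minus lookup_linear_form_mult)
  have vanish: "lookup q (var_mono k + var_mono l) = 0" if "k \<le> l" "k < i \<or> l < j" for k l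
  proof (cases "k < i")
    case True
    then have "v s k = 0" "w s k = 0" "v t k = 0" "w t k = 0" using s t ij by auto
    then show ?thesis by (cases "k = l") (auto simp: lookup_q)
  next
    case False
    \<comment> \<open>Before \<open>x_j\<close> the coefficients of \<open>v\<close> and
      \<open>w\<close> agree for both weights, so the two products cancel.\<close>
    then have "l < j" "k < j" using that by auto
    then have "w s k = v s k" "w s l = v s l" "w t k = v t k" "w t l = v t l" using s t by auto
    then show ?thesis by (simp add: lookup_q mult.commute)
  qed
  have "lookup q (var_mono i + var_mono j) = 1"
  proof (cases "i = j")
    case True
    then show ?thesis using s(1)[of i] t(1)[of i] t(2)[of j] by (simp add: lookup_q)
  next
    case False
    then have "i < j" using ij by simp
    then have "v s i = 1" "w s i = 1" "v t i = 0" "w t i = 0" "w t j = v t j + 1"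
      using s(1)[of i] s(2)[of i] t(1)[of i] t(2)[of i] t(2)[of j] by auto
    then show ?thesis using False by (simp add: lookup_q)
  qed
  then have "var_mono i + var_mono j \<in> keys q" by (simp add: in_keys_iff)
  moreover have "(m, var_mono i + var_mono j) \<in> \<sigma>" if m: "m \<in> keys q" for m
  proof -
    have "m \<in> {var_mono k + var_mono l |k l. True}"
      using m keys_diff[of "linear_form (v s) * linear_form (w t)" "linear_form (v t) * linear_form (w s)"]
        keys_linear_form_mult[of "v s" "w t"] keys_linear_form_mult[of "v t" "w s"]
      unfolding q_def by blast
    then obtain k' l' where "m = var_mono k' + var_mono l'" by blast
    then obtain k l where kl: "m = var_mono k + var_mono l" "k \<le> l"
      using that[of k' l'] that[of l' k'] by (cases "k' \<le> l'") (simp_all add: add.commute)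
    have "\<not> (k < i \<or> l < j)" using m vanish[OF kl(2)] unfolding kl(1) in_keys_iff by blast
    then have "i \<le> k" "j \<le> l" by auto
    then have "(var_mono k, var_mono i) \<in> \<sigma>" "(var_mono l, var_mono j) \<in> \<sigma>"
      by (auto intro: var_mono_order)
    then show ?thesis unfolding kl using ord_add ord_trans by (metis add.commute)
  qed
  ultimately show ?thesis using q unfolding leads_def by blast
qed

text \<open>Only finitely many quadrics are involved, so their conditions hold together generically;
  multiples of leading monomials are leading.\<close>

lemma bip_monos_generic_leads:
  assumes PQ: "P \<inter> Q = {}" "card P \<le> card Q"
    and E: "mono_closed E" "\<And>k l. k \<in> P \<Longrightarrow> l \<in> Q \<Longrightarrow> var_mono k + var_mono l \<in> E"
  shows "generic (\<lambda>A :: ('k::field_char_0, 'n) sqmat.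
    bip_monos (card P) (card Q) \<subseteq> leads \<sigma> (orbit_ideal (mono_ideal E) A))"
proof -
  let ?V = "\<lambda>A :: ('k, 'n) sqmat. orbit_ideal (mono_ideal E) A"
  let ?S = "{(i, j :: 'n). i \<le> j \<and> pos i \<le> card P \<and> pos i + pos j \<le> card P + card Q}"
  have "generic (\<lambda>A. var_mono i + var_mono j \<in> leads \<sigma> (?V A))" if "(i, j) \<in> ?S" for i j
  proof -
    let ?M = "\<lambda>(A :: ('k, 'n) sqmat) d c. case d of Inl k \<Rightarrow> if c \<in> P then A $ k $ c else 0
                     | Inr k \<Rightarrow> if c \<in> Q then A $ k $ c else - A $ k $ c"
    obtain A :: "('k, 'n) sqmat" where "rows_indep ({..i} <+> {..j}) (P \<union> Q) (?M A)"
      using bip_row_indep[OF PQ, of i j] \<open>(i, j) \<in> ?S\<close> by auto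
    moreover have "polyfun (\<lambda>A. ?M A d c)" for d c
      by (cases d; cases "c \<in> P"; cases "c \<in> Q") (auto intro: polyfun_uminus)
    ultimately have "generic (\<lambda>A. rows_indep ({..i} <+> {..j}) (P \<union> Q) (?M A))"
      by (intro generic_rows_indep) auto
    then show ?thesis
      by (rule generic_mono) (use bip_quadric_lead[OF PQ(1) E] \<open>(i, j) \<in> ?S\<close> in blast)
  qed
  then have "generic (\<lambda>A. \<forall>(i, j)\<in>?S. var_mono i + var_mono j \<in> leads \<sigma> (?V A))"
    by (intro generic_ball) auto
  then show ?thesis
  proof (rule generic_mono)
    fix A :: "('k, 'n) sqmat" assume A: "\<forall>(i, j)\<in>?S. var_mono i + var_mono j \<in> leads \<sigma> (?V A)"
    show "bip_monos (card P) (card Q) \<subseteq> leads \<sigma> (?V A)"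
    proof
      fix m :: "'n monomial" assume "m \<in> bip_monos (card P) (card Q)"
      then obtain i j where ij: "(i, j) \<in> ?S" "\<And>k. lookup (var_mono i + var_mono j) k \<le> lookup m k"
        unfolding bip_monos_def by blast
      then have "m = (m - (var_mono i + var_mono j)) + (var_mono i + var_mono j)"
        using monomial_diff[OF ij(2)] by (simp add: add.commute)
      then show "m \<in> leads \<sigma> (?V A)"
        using mono_closed_leads[OF orbit_ideal_subspace, of "mono_ideal E" A] A ij(1)
        unfolding mono_closed_def by (metis (no_types, lifting) case_prodD)
    qed
  qed
qed

end

section \<open>Counting the monomials outside the candidate\<close>

definition supported :: "'n set \<Rightarrow> 'n monomial set" where
  "supported U = {m. \<forall>k. 0 < lookup m k \<longrightarrow> k \<in> U}"

text \<open>Renaming of variables, read backwards along \<open>f\<close> so that the exponents can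
  be written down directly.\<close>

definition pull :: "('n \<Rightarrow> 'n) \<Rightarrow> 'n set \<Rightarrow> 'n::finite monomial \<Rightarrow> 'n monomial" where
  "pull f V m = Abs_poly_mapping (\<lambda>v. if v \<in> V then lookup m (f v) else 0)"

lemma lookup_pull: "lookup (pull f V m) v = (if v \<in> V then lookup m (f v) else 0)"
  unfolding pull_def by (subst lookup_Abs_poly_mapping) auto

lemma pull_supported: "pull f V m \<in> supported V"
  by (simp add: supported_def lookup_pull)

lemma mdeg_pull:
  assumes "bij_betw f V U" "m \<in> supported U" shows "mdeg (pull f V m) = mdeg m"
proof -
  have "mdeg (pull f V m) = (\<Sum>v\<in>V. lookup m (f v))"
    unfolding mdeg_def lookup_pull by (simp add: sum.inter_restrict[symmetric])
  also have "\<dots> = (\<Sum>u\<in>U. lookup m u)" using assms(1) by (rule sum.reindex_bij_betw)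
  also have "\<dots> = mdeg m" unfolding mdeg_def
    using assms(2) by (intro sum.mono_neutral_left) (auto simp: supported_def)
  finally show ?thesis .
qed

lemma inj_pull:
  assumes "bij_betw f V U" shows "inj_on (pull f V) (supported U)"
proof (rule inj_onI, rule poly_mapping_eqI)
  fix m m' k assume m: "m \<in> supported U" "m' \<in> supported U" and eq: "pull f V m = pull f V m'"
  show "lookup m k = lookup m' k"
  proof (cases "k \<in> U")
    case True
    then obtain v where "v \<in> V" "k = f v" using assms unfolding bij_betw_def by blast
    then show ?thesis using arg_cong[OF eq, of "\<lambda>m. lookup m v"] by (simp add: lookup_pull)
  next
    case False
    then have "\<not> 0 < lookup m k" "\<not> 0 < lookup m' k" using m unfolding supported_def by blast+
    then show ?thesis by simp
  qed
qed

text \<open>The right side counts the monomials outside the ideal of the complete bipartite graph.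
  Those outside \<open>bip_monos\<close> are of two kinds. Monomials on positions above
  \<open>card P\<close> correspond to monomials avoiding \<open>P\<close>. The others are
  \<open>x_i m\<close>, with \<open>x_i\<close> the first variable,
  \<open>pos i \<le> card P\<close>, and \<open>m\<close> on positions beyond
  \<open>card P + card Q - pos i\<close>; they inject into the monomials that avoid \<open>Q\<close>
  but meet \<open>P\<close>.\<close>

lemma card_compl_bip_monos:
  fixes P Q :: "'n::{finite, linorder} set"
  assumes PQ: "P \<inter> Q = {}" "card P \<le> card Q"
  shows "card {m :: 'n monomial. mdeg m = d \<and> m \<notin> bip_monos (card P) (card Q)}
    \<le> card {m. mdeg m = d \<and> m \<in> supported (- P) \<union> supported (- Q)}"
proof -
  let ?a = "card P" and ?b = "card Q"
  have ab: "?a + ?b \<le> CARD('n)"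
    using PQ(1) by (subst card_Un_disjoint[symmetric]) (auto intro!: card_mono)
  have fin: "finite {m :: 'n monomial. mdeg m = d \<and> R m}" for R
    by (rule finite_subset[OF _ finite_mdeg[of d]]) auto
  let ?N1 = "{m :: 'n monomial. mdeg m = d \<and> m \<in> supported {k. ?a < pos k}}"
  let ?N2 = "{m :: 'n monomial. mdeg m = d \<and> m \<notin> bip_monos ?a ?b \<and> m \<notin> supported {k. ?a < pos k}}"
  let ?S1 = "{m. mdeg m = d \<and> m \<in> supported (- P)}"
  let ?S2 = "{m. mdeg m = d \<and> m \<in> supported (- Q) \<and> m \<notin> supported (- P)}"
  have "{k :: 'n. ?a < pos k} = - {k. pos k \<in> {1..?a}}" using pos_ge_1 by (auto simp: not_le)
  moreover have "card {k :: 'n. pos k \<in> {1..?a}} = ?a" using ab by (subst card_pos_vimage) auto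
  ultimately have "card {k :: 'n. ?a < pos k} = CARD('n) - ?a" by (simp only: card_Compl)
  then obtain f where f: "bij_betw f (- P) {k :: 'n. ?a < pos k}"
    using finite_same_card_bij[of "- P" "{k :: 'n. ?a < pos k}"] by (auto simp: card_Compl)
  have c1: "card ?N1 \<le> card ?S1"
  proof (rule card_inj_on_le[OF _ _ fin])
    show "inj_on (pull f (- P)) ?N1" using inj_pull[OF f] by (rule inj_on_subset) auto
  qed (auto simp: mdeg_pull[OF f] pull_supported)
  have "card {k :: 'n. pos k \<in> {?b<..?a + ?b}} = ?a" using ab by (subst card_pos_vimage) auto
  then obtain g where g: "bij_betw g P {k :: 'n. pos k \<in> {?b<..?a + ?b}}"
    using finite_same_card_bij[of P "{k :: 'n. pos k \<in> {?b<..?a + ?b}}"] by auto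
  have "- P - Q = - (P \<union> Q)" by auto
  moreover have "card (P \<union> Q) = ?a + ?b" using PQ(1) by (intro card_Un_disjoint) auto
  ultimately have "card (- P - Q) = CARD('n) - (?a + ?b)" by (simp only: card_Compl)
  moreover have "card {k :: 'n. pos k \<in> {?a + ?b<..CARD('n)}} = CARD('n) - (?a + ?b)"
    by (subst card_pos_vimage) auto
  ultimately obtain g' where g': "bij_betw g' (- P - Q) {k :: 'n. pos k \<in> {?a + ?b<..CARD('n)}}"
    using finite_same_card_bij[of "- P - Q" "{k :: 'n. pos k \<in> {?a + ?b<..CARD('n)}}"] by auto
  \<comment> \<open>\<open>P\<close> is matched with the \<open>?a\<close> positions directly after
    \<open>?b\<close>, so a variable in that range signals a vertex of \<open>P\<close>.\<close>
  define h where "h = (\<lambda>k. if k \<in> P then g k else g' k)"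
  have "bij_betw h (P \<union> (- P - Q)) ({k :: 'n. pos k \<in> {?b<..?a + ?b}} \<union> {k. pos k \<in> {?a + ?b<..CARD('n)}})"
    unfolding h_def by (rule bij_betw_disjoint_Un[OF g g']) auto
  moreover have "P \<union> (- P - Q) = - Q" using PQ(1) by auto
  moreover have "{k :: 'n. pos k \<in> {?b<..?a + ?b}} \<union> {k. pos k \<in> {?a + ?b<..CARD('n)}} = {k. ?b < pos k}"
    using pos_le_card by (auto simp: not_le)
  ultimately have h: "bij_betw h (- Q) {k :: 'n. ?b < pos k}" by simp
  define T where "T = {(i :: 'n, m :: 'n monomial). pos i \<le> ?a \<and> mdeg m + 1 = d \<and>
      m \<in> supported {k. ?a + ?b < pos i + pos k}}"
  have finT: "finite T"
    by (rule finite_subset[of _ "UNIV \<times> {m. mdeg m \<le> d}"]) (auto simp: T_def finite_mdeg_le)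
  have "?N2 \<subseteq> (\<lambda>(i, m). var_mono i + m) ` T"
  proof
    fix m assume m: "m \<in> ?N2"
    then have "\<exists>k. 0 < lookup m k \<and> pos k \<le> ?a" by (auto simp: supported_def not_less)
    then have ne: "{k. 0 < lookup m k} \<noteq> {}" by auto
    define i where "i = Min {k. 0 < lookup m k}"
    have i: "0 < lookup m i" "\<And>k. 0 < lookup m k \<Longrightarrow> i \<le> k"
      using Min_in[OF _ ne] by (auto simp: i_def)
    then have ia: "pos i \<le> ?a" using \<open>\<exists>k. _\<close> pos_mono order_trans by blast
    have split: "m = var_mono i + (m - var_mono i)"
      using i(1) by (intro monomial_diff) (auto simp: lookup_var_mono)
    have "?a + ?b < pos i + pos k" if k: "0 < lookup (m - var_mono i) k" for k
    proof -
      have "0 < lookup m k" using k by (simp add: lookup_minus)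
      then have "i \<le> k" by (rule i)
      moreover have "lookup (var_mono i + var_mono k) l \<le> lookup m l" for l
        using k i(1) \<open>0 < lookup m k\<close> by (auto simp: lookup_add lookup_var_mono lookup_minus split: if_splits)
      ultimately have "m \<in> bip_monos ?a ?b" if "pos i + pos k \<le> ?a + ?b"
        unfolding bip_monos_def using ia that by blast
      then show ?thesis using m by (auto simp: not_le[symmetric])
    qed
    moreover have "mdeg (m - var_mono i) + 1 = d" using m arg_cong[OF split, of mdeg] by simp
    ultimately have "(i, m - var_mono i) \<in> T" using ia by (simp add: T_def supported_def)
    then show "m \<in> (\<lambda>(i, m). var_mono i + m) ` T" using split by force
  qed
  then have "card ?N2 \<le> card ((\<lambda>(i, m). var_mono i + m) ` T)"
    using finT by (intro card_mono finite_imageI)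
  also have "\<dots> \<le> card T" using finT by (rule card_image_le)
  finally have c2: "card ?N2 \<le> card T" .
  \<comment> \<open>\<open>x_i\<close> is replaced by the variable at the first position where
    \<open>m\<close> may live. That variable comes first in the new monomial and thus determines
    \<open>i\<close>, and its position lies in the range matched with \<open>P\<close>.\<close>
  have "\<forall>i\<in>{i :: 'n. pos i \<le> ?a}. \<exists>k :: 'n. pos k + pos i = ?a + ?b + 1"
  proof
    fix i :: 'n assume "i \<in> {i. pos i \<le> ?a}"
    then have i: "pos i \<le> ?a" by simp
    then have "1 \<le> ?a + ?b + 1 - pos i" "?a + ?b + 1 - pos i \<le> CARD('n)"
      using pos_ge_1[of i] ab by linarith+
    then obtain k :: 'n where "pos k = ?a + ?b + 1 - pos i" using ex_pos by blast
    then show "\<exists>k :: 'n. pos k + pos i = ?a + ?b + 1" using i by (intro exI[of _ k]) simp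
  qed
  from bchoice[OF this] obtain r :: "'n \<Rightarrow> 'n"
    where r: "\<And>i :: 'n. pos i \<le> ?a \<Longrightarrow> pos (r i) + pos i = ?a + ?b + 1"
    by blast
  define \<theta> where "\<theta> = (\<lambda>(i, m). var_mono (r i) + m)"
  have \<theta>: "mdeg (\<theta> x) = d \<and> \<theta> x \<in> supported {k. ?b < pos k} \<and>
      (\<exists>k. 0 < lookup (\<theta> x) k \<and> ?b < pos k \<and> pos k \<le> ?a + ?b)" if "x \<in> T" for x
  proof -
    obtain i m where x: "x = (i, m)" by fastforce
    have im: "pos i \<le> ?a" "mdeg m + 1 = d" "m \<in> supported {k. ?a + ?b < pos i + pos k}"
      using that by (auto simp: T_def x)
    have "?b < pos (r i)" "pos (r i) \<le> ?a + ?b" using r[OF im(1)] im(1) pos_ge_1[of i] by linarith+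
    moreover have "?b < pos k" if "?a + ?b < pos i + pos k" for k using that im(1) by linarith
    ultimately show ?thesis using im
      by (auto simp: \<theta>_def x supported_def lookup_add lookup_var_mono split: if_splits
          intro!: exI[of _ "r i"])
  qed
  have inj\<theta>: "inj_on \<theta> T"
  proof (rule inj_onI)
    fix x y assume xy: "x \<in> T" "y \<in> T" "\<theta> x = \<theta> y"
    have *: False if "(i, m) \<in> T" "(k, n) \<in> T" "\<theta> (i, m) = \<theta> (k, n)" "pos i < pos k" for i k m n
    proof -
      have rr: "pos (r i) + pos i = ?a + ?b + 1" "pos (r k) + pos k = ?a + ?b + 1"
        using that(1,2) r by (auto simp: T_def)
      have "0 < lookup (\<theta> (i, m)) (r k)"
        unfolding that(3) by (simp add: \<theta>_def lookup_add lookup_var_mono)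
      moreover have "r i \<noteq> r k" using rr that(4) by auto
      ultimately have "0 < lookup m (r k)"
        by (simp add: \<theta>_def lookup_add lookup_var_mono)
      then have "?a + ?b < pos i + pos (r k)" using that(1) by (auto simp: T_def supported_def)
      then show False using rr that(4) by linarith
    qed
    obtain i m k n where eq: "x = (i, m)" "y = (k, n)" by fastforce
    have "i = k" using *[of i m k n] *[of k n i m] xy unfolding eq
      by (metis linorder_neqE_nat pos_eq_iff)
    then show "x = y" using xy(3) by (simp add: eq \<theta>_def)
  qed
  have c3: "card T \<le> card ?S2"
  proof (rule card_inj_on_le[OF _ _ fin])
    show "inj_on (\<lambda>x. pull h (- Q) (\<theta> x)) T"
    proof -
      have "\<theta> ` T \<subseteq> supported {k. ?b < pos k}" using \<theta> by blast
      from comp_inj_on[OF inj\<theta> inj_on_subset[OF inj_pull[OF h] this]] show ?thesis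
        by (simp add: comp_def)
    qed
    show "(\<lambda>x. pull h (- Q) (\<theta> x)) ` T \<subseteq> ?S2"
    proof clarify
      fix i m assume "(i, m) \<in> T"
      from \<theta>[OF this] obtain k where k: "mdeg (\<theta> (i, m)) = d" "\<theta> (i, m) \<in> supported {k. ?b < pos k}"
        "0 < lookup (\<theta> (i, m)) k" "?b < pos k" "pos k \<le> ?a + ?b" by blast
      then obtain v where v: "v \<in> P" "k = g v" using g unfolding bij_betw_def by force
      then have "v \<notin> Q" "h v = k" using PQ(1) by (auto simp: h_def)
      then have "0 < lookup (pull h (- Q) (\<theta> (i, m))) v" using k by (simp add: lookup_pull)
      then have "pull h (- Q) (\<theta> (i, m)) \<notin> supported (- P)" using v(1) by (auto simp: supported_def)
      then show "mdeg (pull h (- Q) (\<theta> (i, m))) = d \<and> pull h (- Q) (\<theta> (i, m)) \<in> supported (- Q) \<and>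
          pull h (- Q) (\<theta> (i, m)) \<notin> supported (- P)"
        using k mdeg_pull[OF h] pull_supported by blast
    qed
  qed
  have "card {m :: 'n monomial. mdeg m = d \<and> m \<notin> bip_monos ?a ?b} \<le> card (?N1 \<union> ?N2)"
    using fin by (intro card_mono) auto
  also have "\<dots> \<le> card ?N1 + card ?N2" by (rule card_Un_le)
  also have "\<dots> \<le> card ?S1 + card ?S2" using c1 c2 c3 by linarith
  also have "\<dots> = card (?S1 \<union> ?S2)" using fin by (subst card_Un_disjoint) auto
  also have "?S1 \<union> ?S2 = {m. mdeg m = d \<and> m \<in> supported (- P) \<union> supported (- Q)}" by auto
  finally show ?thesis .
qed

text \<open>One inclusion is generic by the quadrics. The other follows in each degree: the
  complement of \<open>bip_monos\<close> is at most as large as that of the edge ideal, whose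
  Hilbert function the leading monomials share.\<close>

lemma gin_bipartite:
  fixes P Q :: "'n::{finite, linorder} set"
  assumes ord: "term_order \<sigma>" "decreasing_vars \<sigma>"
    and PQ: "P \<inter> Q = {}" "card P \<le> card Q"
    and G: "\<And>i j. i \<noteq> j \<Longrightarrow> {i, j} \<in> G \<longleftrightarrow> i \<in> P \<and> j \<in> Q \<or> i \<in> Q \<and> j \<in> P"
  shows "gin \<sigma> (edge_ideal G :: ('n, 'k::field_char_0) mpoly set) = mono_ideal (bip_monos (card P) (card Q))"
proof -
  interpret monomial_order \<sigma> by unfold_locales (rule ord)
  let ?J = "bip_monos (card P) (card Q) :: 'n monomial set"
  let ?E = "edge_monos G"
  let ?L = "\<lambda>A :: ('k, 'n) sqmat. leads \<sigma> (orbit_ideal (mono_ideal ?E) A)"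
  have compl: "m \<notin> ?E \<longleftrightarrow> m \<in> supported (- P) \<union> supported (- Q)" for m
  proof -
    have "m \<in> ?E \<longleftrightarrow> (\<exists>i j. i \<in> P \<and> j \<in> Q \<and> 0 < lookup m i \<and> 0 < lookup m j)"
    proof
      assume "m \<in> ?E"
      then obtain i j where ij: "i \<noteq> j" "{i, j} \<in> G" "0 < lookup m i" "0 < lookup m j"
        unfolding edge_monos_def by blast
      then show "\<exists>i j. i \<in> P \<and> j \<in> Q \<and> 0 < lookup m i \<and> 0 < lookup m j"
        using G[OF ij(1)] by blast
    next
      assume "\<exists>i j. i \<in> P \<and> j \<in> Q \<and> 0 < lookup m i \<and> 0 < lookup m j"
      then obtain i j where ij: "i \<in> P" "j \<in> Q" "0 < lookup m i" "0 < lookup m j" by blast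
      then have "i \<noteq> j" using PQ(1) by blast
      then show "m \<in> ?E" using G[of i j] ij unfolding edge_monos_def by blast
    qed
    then show ?thesis by (auto simp: supported_def)
  qed
  have E: "var_mono k + var_mono l \<in> ?E" if "k \<in> P" "l \<in> Q" for k l
  proof -
    have "k \<noteq> l" using that PQ(1) by blast
    then show ?thesis using that G[of k l] unfolding edge_monos_def
      by (intro CollectI exI[of _ k] exI[of _ l]) (simp add: lookup_add lookup_var_mono)
  qed
  have "generic (\<lambda>A. invertible A \<and> ?J \<subseteq> ?L A)"
    by (intro generic_conj generic_invertible bip_monos_generic_leads ord PQ mono_closed_edge_monos E)
  then have "generic (\<lambda>A. ?L A = ?J)"
  proof (rule generic_mono, elim conjE)
    fix A :: "('k, 'n) sqmat" assume A: "invertible A" "?J \<subseteq> ?L A"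
    have "?J \<inter> {m. mdeg m = d} = ?L A \<inter> {m. mdeg m = d}" for d
    proof (rule card_subset_eq)
      have fin: "finite {m :: 'n monomial. mdeg m = d \<and> R m}" for R
        by (rule finite_subset[OF _ finite_mdeg[of d]]) auto
      have part: "card {m :: 'n monomial. mdeg m = d} = card (X \<inter> {m. mdeg m = d}) + card {m. mdeg m = d \<and> m \<notin> X}" for X :: "'n monomial set"
        using fin[of "\<lambda>m. m \<in> X"] fin[of "\<lambda>m. m \<notin> X"]
        by (subst card_Un_disjoint[symmetric]) (auto simp: Int_def conj_commute intro!: arg_cong[of _ _ card])
      have "card (?L A \<inter> {m. mdeg m = d}) = card (?E \<inter> {m. mdeg m = d})"
        using card_leads_mono_ideal[OF mono_closed_edge_monos A(1)] by (simp add: Int_def)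
      also have "\<dots> \<le> card (?J \<inter> {m. mdeg m = d})"
        using part[of ?E] part[of ?J] card_compl_bip_monos[OF PQ, of d] by (simp add: compl)
      finally have "card (?L A \<inter> {m. mdeg m = d}) \<le> card (?J \<inter> {m. mdeg m = d})" .
      moreover have "card (?J \<inter> {m. mdeg m = d}) \<le> card (?L A \<inter> {m. mdeg m = d})"
        using A(2) finite_mdeg[of d] by (intro card_mono) auto
      ultimately show "card (?J \<inter> {m. mdeg m = d}) = card (?L A \<inter> {m. mdeg m = d})" by simp
      show "finite (?L A \<inter> {m. mdeg m = d})" using finite_mdeg[of d] by auto
    qed (use A(2) in auto)
    then show "?L A = ?J" by blast
  qed
  then show ?thesis
    unfolding edge_ideal_eq by (intro generic_gin ord mono_ideal_subspace mono_closed_edge_monos)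
qed

section \<open>The lexicographic and the reverse lexicographic order\<close>

definition lex_order :: "'n::{finite, linorder} monomial rel" where
  "lex_order = {(s, t). s = t \<or> (\<exists>i. lookup s i < lookup t i \<and> (\<forall>k<i. lookup s k = lookup t k))}"

text \<open>At the last difference the larger exponent belongs to the smaller monomial. Degrees are
  compared first, since otherwise 1 would exceed every variable.\<close>

definition revlex_order :: "'n::{finite, linorder} monomial rel" where
  "revlex_order = {(s, t). mdeg s < mdeg t \<or> mdeg s = mdeg t \<and>
     (s = t \<or> (\<exists>i. lookup t i < lookup s i \<and> (\<forall>k>i. lookup s k = lookup t k)))}"

lemma first_difference:
  fixes s t :: "'n::{finite, linorder} monomial"
  assumes "s \<noteq> t"
  obtains i where "lookup s i \<noteq> lookup t i" "\<And>k. k < i \<Longrightarrow> lookup s k = lookup t k"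
proof -
  let ?D = "{k. lookup s k \<noteq> lookup t k}"
  have "?D \<noteq> {}" using assms by (auto simp: poly_mapping_eq_iff fun_eq_iff)
  then have "Min ?D \<in> ?D" by (intro Min_in) auto
  moreover have "lookup s k = lookup t k" if "k < Min ?D" for k
  proof (rule ccontr)
    assume "lookup s k \<noteq> lookup t k"
    then have "Min ?D \<le> k" by (intro Min_le) auto
    then show False using that by simp
  qed
  ultimately show ?thesis using that by blast
qed

lemma last_difference:
  fixes s t :: "'n::{finite, linorder} monomial"
  assumes "s \<noteq> t"
  obtains i where "lookup s i \<noteq> lookup t i" "\<And>k. i < k \<Longrightarrow> lookup s k = lookup t k"
proof -
  let ?D = "{k. lookup s k \<noteq> lookup t k}"
  have "?D \<noteq> {}" using assms by (auto simp: poly_mapping_eq_iff fun_eq_iff)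
  then have "Max ?D \<in> ?D" by (intro Max_in) auto
  moreover have "lookup s k = lookup t k" if "Max ?D < k" for k
  proof (rule ccontr)
    assume "lookup s k \<noteq> lookup t k"
    then have "k \<le> Max ?D" by (intro Max_ge) auto
    then show False using that by simp
  qed
  ultimately show ?thesis using that by blast
qed

lemma term_orderI:
  assumes "\<And>s. (s, s) \<in> \<sigma>" "\<And>s t u. (s, t) \<in> \<sigma> \<Longrightarrow> (t, u) \<in> \<sigma> \<Longrightarrow> (s, u) \<in> \<sigma>"
    "\<And>s t. (s, t) \<in> \<sigma> \<Longrightarrow> (t, s) \<in> \<sigma> \<Longrightarrow> s = t" "\<And>s t. (s, t) \<in> \<sigma> \<or> (t, s) \<in> \<sigma>"
    "\<And>s. (0, s) \<in> \<sigma>" "\<And>s t u. (s, t) \<in> \<sigma> \<Longrightarrow> (s + u, t + u) \<in> \<sigma>"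
  shows "term_order \<sigma>"
proof -
  have "refl \<sigma>" using assms(1) by (simp add: refl_on_def)
  moreover have "trans \<sigma>" using assms(2) by (intro transI)
  moreover have "antisym \<sigma>" using assms(3) by (intro antisymI)
  moreover have "total \<sigma>" using assms(4) by (auto simp: total_on_def)
  ultimately show ?thesis using assms(5,6)
    by (simp add: term_order_def linear_order_on_def partial_order_on_def preorder_on_def)
qed

lemma lex_term_order: "term_order (lex_order :: 'n::{finite, linorder} monomial rel)"
proof (rule term_orderI)
  fix s t u :: "'n monomial"
  show "(s, s) \<in> lex_order" by (simp add: lex_order_def)
  show "(s, u) \<in> lex_order" if st: "(s, t) \<in> lex_order" "(t, u) \<in> lex_order"
  proof (cases "s = t \<or> t = u")
    case False
    then obtain i k where i: "lookup s i < lookup t i" "\<And>l. l < i \<Longrightarrow> lookup s l = lookup t l"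
      and k: "lookup t k < lookup u k" "\<And>l. l < k \<Longrightarrow> lookup t l = lookup u l"
      using st unfolding lex_order_def by blast
    have "lookup s (min i k) < lookup u (min i k)"
      using i k by (cases i k rule: linorder_cases) (force simp: min_def)+
    moreover have "\<forall>l<min i k. lookup s l = lookup u l" using i(2) k(2) by simp
    ultimately show ?thesis unfolding lex_order_def by blast
  qed (use that in auto)
  show "s = t" if st: "(s, t) \<in> lex_order" "(t, s) \<in> lex_order"
  proof (rule ccontr)
    assume "s \<noteq> t"
    then obtain i k where i: "lookup s i < lookup t i" "\<And>l. l < i \<Longrightarrow> lookup s l = lookup t l"
      and k: "lookup t k < lookup s k" "\<And>l. l < k \<Longrightarrow> lookup t l = lookup s l"
      using st unfolding lex_order_def by blast
    then show False by (cases i k rule: linorder_cases) force+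
  qed
  show "(s, t) \<in> lex_order \<or> (t, s) \<in> lex_order"
  proof (cases "s = t")
    case False
    then obtain i where i: "lookup s i \<noteq> lookup t i" "\<And>k. k < i \<Longrightarrow> lookup s k = lookup t k"
      using first_difference by blast
    have i': "\<forall>k<i. lookup t k = lookup s k" using i(2) by simp
    show ?thesis
    proof (cases "lookup s i < lookup t i")
      case True
      then show ?thesis using i(2) unfolding lex_order_def by blast
    next
      case False
      then have "lookup t i < lookup s i" using i(1) by simp
      then show ?thesis using i' unfolding lex_order_def by blast
    qed
  qed (simp add: lex_order_def)
  show "(0, s) \<in> lex_order"
  proof (cases "s = 0")
    case False
    then obtain i where i: "lookup 0 i \<noteq> lookup s i" "\<And>k. k < i \<Longrightarrow> lookup 0 k = lookup s k"
      using first_difference[of 0 s] by metis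
    then have "lookup 0 i < lookup s i" by simp
    then show ?thesis using i(2) unfolding lex_order_def by blast
  qed (simp add: lex_order_def)
  show "(s + u, t + u) \<in> lex_order" if "(s, t) \<in> lex_order"
    using that by (auto simp: lex_order_def lookup_add)
qed

lemma mdeg_eq_0_iff: "mdeg m = 0 \<longleftrightarrow> m = 0"
  by (auto simp: mdeg_def poly_mapping_eq_iff fun_eq_iff)

lemma mdeg_eq_1:
  assumes "mdeg m = 1" obtains i where "m = var_mono i"
proof -
  obtain i where i: "0 < lookup m i"
    using assms unfolding mdeg_def by (metis (no_types, lifting) One_nat_def gr0I sum.neutral zero_neq_one)
  then have m: "m = var_mono i + (m - var_mono i)"
    by (intro monomial_diff) (auto simp: lookup_var_mono)
  then have "mdeg m = 1 + mdeg (m - var_mono i)" by (metis mdeg_add mdeg_var)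
  then have "m - var_mono i = 0" using assms mdeg_eq_0_iff by (metis add_left_cancel add.right_neutral)
  then have "m = var_mono i" using m by simp
  then show ?thesis by (rule that)
qed

lemma revlex_term_order: "term_order (revlex_order :: 'n::{finite, linorder} monomial rel)"
proof (rule term_orderI)
  fix s t u :: "'n monomial"
  show "(s, s) \<in> revlex_order" by (simp add: revlex_order_def)
  show "(s, u) \<in> revlex_order" if st: "(s, t) \<in> revlex_order" "(t, u) \<in> revlex_order"
  proof (cases "s = t \<or> t = u \<or> mdeg s < mdeg t \<or> mdeg t < mdeg u")
    case True
    then show ?thesis using st by (auto simp: revlex_order_def)
  next
    case False
    then obtain i k where i: "lookup t i < lookup s i" "\<And>l. i < l \<Longrightarrow> lookup s l = lookup t l"
      and k: "lookup u k < lookup t k" "\<And>l. k < l \<Longrightarrow> lookup t l = lookup u l"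
      and eq: "mdeg s = mdeg t" "mdeg t = mdeg u"
      using st unfolding revlex_order_def by blast
    have "lookup u (max i k) < lookup s (max i k)"
      using i k by (cases i k rule: linorder_cases) (force simp: max_def)+
    moreover have "\<forall>l>max i k. lookup s l = lookup u l" using i(2) k(2) by simp
    ultimately show ?thesis using eq unfolding revlex_order_def by auto
  qed
  show "s = t" if st: "(s, t) \<in> revlex_order" "(t, s) \<in> revlex_order"
  proof (rule ccontr)
    assume ne: "s \<noteq> t"
    have eq: "mdeg s = mdeg t" using st by (auto simp: revlex_order_def)
    have "\<exists>i. lookup t i < lookup s i \<and> (\<forall>l>i. lookup s l = lookup t l)"
      using st(1) ne eq by (simp add: revlex_order_def)
    then obtain i where i: "lookup t i < lookup s i" "\<And>l. i < l \<Longrightarrow> lookup s l = lookup t l" by blast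
    have "\<exists>k. lookup s k < lookup t k \<and> (\<forall>l>k. lookup t l = lookup s l)"
      using st(2) ne eq by (auto simp: revlex_order_def)
    then obtain k where k: "lookup s k < lookup t k" "\<And>l. k < l \<Longrightarrow> lookup t l = lookup s l" by blast
    show False using i k by (cases i k rule: linorder_cases) force+
  qed
  show "(s, t) \<in> revlex_order \<or> (t, s) \<in> revlex_order"
  proof (cases "s = t \<or> mdeg s \<noteq> mdeg t")
    case True
    then show ?thesis by (auto simp: revlex_order_def)
  next
    case False
    then obtain i where i: "lookup s i \<noteq> lookup t i" "\<And>k. i < k \<Longrightarrow> lookup s k = lookup t k"
      using last_difference[of s t] by blast
    have i': "\<forall>k>i. lookup t k = lookup s k" using i(2) by simp
    show ?thesis
    proof (cases "lookup t i < lookup s i")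
      case True
      then show ?thesis using i(2) False unfolding revlex_order_def by auto
    next
      case nless: False
      then have "lookup s i < lookup t i" using i(1) by simp
      then show ?thesis using i' False unfolding revlex_order_def by auto
    qed
  qed
  show "(0, s) \<in> revlex_order"
    using mdeg_eq_0_iff[of s] by (auto simp: revlex_order_def)
  show "(s + u, t + u) \<in> revlex_order" if "(s, t) \<in> revlex_order"
    using that by (auto simp: revlex_order_def lookup_add)
qed

lemma lex_decreasing: "decreasing_vars (lex_order :: 'n::{finite, linorder} monomial rel)"
  unfolding decreasing_vars_def
proof (intro allI impI)
  fix i j :: 'n assume "i < j"
  then have "lookup (var_mono j) i < lookup (var_mono i) i"
    "\<forall>k<i. lookup (var_mono j) k = lookup (var_mono i) k" by (auto simp: lookup_var_mono)
  then show "(var_mono j, var_mono i) \<in> lex_order - Id"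
    using \<open>i < j\<close> unfolding lex_order_def by auto
qed

lemma revlex_decreasing: "decreasing_vars (revlex_order :: 'n::{finite, linorder} monomial rel)"
  unfolding decreasing_vars_def
proof (intro allI impI)
  fix i j :: 'n assume "i < j"
  then have "lookup (var_mono i) j < lookup (var_mono j) j"
    "\<forall>k>j. lookup (var_mono j) k = lookup (var_mono i) k" by (auto simp: lookup_var_mono)
  then show "(var_mono j, var_mono i) \<in> revlex_order - Id"
    using \<open>i < j\<close> unfolding revlex_order_def by auto
qed

interpretation lex: monomial_order "lex_order :: 'n::{finite, linorder} monomial rel"
  by unfold_locales (rule lex_term_order)

interpretation revlex: monomial_order "revlex_order :: 'n::{finite, linorder} monomial rel"
  by unfold_locales (rule revlex_term_order)

section \<open>An obstruction for the reverse lexicographic order\<close>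

text \<open>A bijection from rows to columns gives a witness whose chosen block is a permutation
  matrix.\<close>

lemma generic_minor:
  fixes D C :: "'n::finite set"
  assumes "card D = card C"
  shows "generic (\<lambda>A :: 'k::field_char_0^'n^'n. rows_indep D C (\<lambda>k c. A $ k $ c))"
proof -
  obtain f where f: "bij_betw f D C" using assms finite_same_card_bij[of D C] by auto
  define A :: "'k^'n^'n" where "A = (\<chi> k c. if f k = c then 1 else 0)"
  have "rows_indep D C (\<lambda>k c. A $ k $ c)"
  proof (rule rows_indepI)
    fix u d assume z: "\<forall>c\<in>C. (\<Sum>k\<in>D. u k * A $ k $ c) = 0" and d: "d \<in> D"
    have "(\<Sum>k\<in>D. u k * A $ k $ f d) = (\<Sum>k\<in>D. if k = d then u d else 0)"
      using f d by (intro sum.cong) (auto simp: A_def bij_betw_def inj_on_def)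
    then have "(\<Sum>k\<in>D. u k * A $ k $ f d) = u d" using d by simp
    moreover have "f d \<in> C" using f d by (auto simp: bij_betw_def)
    ultimately show "u d = 0" using z by simp
  qed
  then show ?thesis by (intro generic_rows_indep) auto
qed

text \<open>This puts the image of the span of the first coordinate vectors in general position to
  all coordinate subspaces.\<close>

definition all_minors :: "'k::field^'n^'n \<Rightarrow> bool" where
  "all_minors A \<longleftrightarrow> (\<forall>D C. card D = card C \<longrightarrow> rows_indep D C (\<lambda>k c. A $ k $ c))"

lemma generic_all_minors: "generic (all_minors :: 'k::field_char_0^'n^'n \<Rightarrow> bool)"
proof -
  have "generic (\<lambda>A :: 'k^'n^'n. \<forall>(D, C)\<in>{(D, C). card D = card C}. rows_indep D C (\<lambda>k c. A $ k $ c))"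
    by (rule generic_ball) (auto intro: generic_minor)
  then show ?thesis by (rule generic_mono) (auto simp: all_minors_def)
qed

text \<open>There are \<open>pos j\<close> unknowns and \<open>pos j - 1\<close> equations, so a
  nonzero solution exists. If \<open>u j\<close> or a coordinate in \<open>T\<close> vanished as
  well, the solution would satisfy a square homogeneous system, which by \<open>all_minors\<close>
  has only the zero solution.\<close>

lemma point_with_support:
  fixes A :: "('k::field, 'n::{finite, linorder}) sqmat"
  assumes A: "all_minors A" and T: "pos j + card T = CARD('n) + 1"
  obtains u where "\<And>k. j < k \<Longrightarrow> u k = 0" "u j \<noteq> 0" "\<And>c. (\<Sum>k\<in>UNIV. u k * A $ k $ c) \<noteq> 0 \<longleftrightarrow> c \<in> T"
proof -
  have cardj: "card {..j} = pos j" by (simp add: pos_def atMost_def)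
  have cardT: "card (- T) = CARD('n) - card T" by (simp add: card_Compl)
  have cT: "card T \<le> CARD('n)" by (intro card_mono) auto
  have "card (- T) < card {..j}" using T cardj cardT cT by linarith
  then obtain u where u: "\<exists>k\<in>{..j}. u k \<noteq> 0" "\<forall>c\<in>- T. (\<Sum>k\<in>{..j}. u k * A $ k $ c) = 0"
    using underdetermined_system[of "- T" "{..j}" "\<lambda>k c. A $ k $ c"] by auto
  define w where "w = (\<lambda>k. if k \<le> j then u k else 0)"
  have w: "(\<Sum>k\<in>UNIV. w k * A $ k $ c) = (\<Sum>k\<in>{..j}. u k * A $ k $ c)" for c
    unfolding w_def by (rule sum.mono_neutral_cong_right) auto
  have "u j \<noteq> 0"
  proof
    assume uj: "u j = 0"
    have atMost: "{..j} = insert j {..<j}" by auto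
    have "card {..<j} = card (- T)" using cardj cardT T cT unfolding atMost by simp
    then have "rows_indep {..<j} (- T) (\<lambda>k c. A $ k $ c)" using A by (simp add: all_minors_def)
    moreover have "(\<Sum>k\<in>{..<j}. u k * A $ k $ c) = 0" if "c \<in> - T" for c
      using u(2) that uj unfolding atMost by simp
    ultimately have "u k = 0" if "k \<in> {..<j}" for k by (rule rows_indepD[OF _ _ that])
    then show False using u(1) uj unfolding atMost by auto
  qed
  moreover have "(\<Sum>k\<in>{..j}. u k * A $ k $ c) \<noteq> 0" if c: "c \<in> T" for c
  proof
    assume z: "(\<Sum>k\<in>{..j}. u k * A $ k $ c) = 0"
    have "card {..j} = card (insert c (- T))" using cardj cardT T cT c by simp
    then have "rows_indep {..j} (insert c (- T)) (\<lambda>k c. A $ k $ c)" using A by (simp add: all_minors_def)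
    moreover have "(\<Sum>k\<in>{..j}. u k * A $ k $ x) = 0" if "x \<in> insert c (- T)" for x
      using u(2) z that by auto
    ultimately have "u k = 0" if "k \<in> {..j}" for k by (rule rows_indepD[OF _ _ that])
    then show False using u(1) by auto
  qed
  ultimately show ?thesis using u(2) by (intro that[of w]) (auto simp: w, auto simp: w_def)
qed

text \<open>Starting from \<open>X0\<close>, vertices are added one at a time, each inside an
  independent set of \<open>r + 1\<close> vertices present by then. The points attached to these
  sets are triangular with respect to the insertion order, hence independent, one for each of the
  \<open>n - r\<close> vertices outside \<open>X0\<close>. Asking for a step from every proper
  superset leaves the order of insertion free.\<close>

definition spread :: "'n::finite set set \<Rightarrow> nat \<Rightarrow> bool" where
  "spread G r \<longleftrightarrow> (\<exists>X0. card X0 = r \<and> (\<forall>X. X0 \<subseteq> X \<longrightarrow> X \<noteq> UNIV \<longrightarrow>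
     (\<exists>v T. v \<notin> X \<and> v \<in> T \<and> T \<subseteq> insert v X \<and> card T = r + 1 \<and>
        (\<forall>i\<in>T. \<forall>l\<in>T. i \<noteq> l \<longrightarrow> {i, l} \<notin> G))))"

lemma grow_to_UNIV:
  fixes X0 :: "'n::finite set"
  assumes "R X0" "\<And>X. X0 \<subseteq> X \<Longrightarrow> R X \<Longrightarrow> X \<noteq> UNIV \<Longrightarrow> \<exists>v. v \<notin> X \<and> R (insert v X)"
  shows "R UNIV"
proof -
  have "R UNIV" if "X0 \<subseteq> X" "R X" for X
    using that
  proof (induction "card (- X)" arbitrary: X rule: less_induct)
    case less
    show ?case
    proof (cases "X = UNIV")
      case False
      then obtain v where v: "v \<notin> X" "R (insert v X)" using assms(2) less.prems by blast
      have "card (- insert v X) < card (- X)" using v(1) by (intro psubset_card_mono) auto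
      then show ?thesis using less.hyps[of "insert v X"] less.prems(1) v(2) by blast
    qed (use less.prems in simp)
  qed
  then show ?thesis using assms(1) by blast
qed

lemma mono_eval_single: "mono_eval u (Poly_Mapping.single j e) = u j ^ e"
proof -
  have "mono_eval u (Poly_Mapping.single j e) = (\<Prod>i\<in>UNIV. if i = j then u j ^ e else 1)"
    unfolding mono_eval_def by (intro prod.cong) (auto simp: lookup_single when_def)
  then show ?thesis by simp
qed

lemma mdeg_single [simp]: "mdeg (Poly_Mapping.single j e) = e"
  by (simp add: mdeg_def lookup_single when_def)

text \<open>A monomial without variables after \<open>x_j\<close> that is at most
  \<open>x_x x_j^e\<close> cannot have a smaller exponent at \<open>j\<close>, and the degree leaves
  room for one further factor.\<close>

lemma revlex_below_support:
  fixes x j :: "'n::{finite, linorder}"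
  assumes "x < j" "mdeg m = e + 1" "(m, var_mono x + Poly_Mapping.single j e) \<in> revlex_order"
    and supp: "\<And>k. 0 < lookup m k \<Longrightarrow> k \<le> j"
  shows "\<exists>l\<le>j. m = Poly_Mapping.single j e + var_mono l"
proof -
  let ?\<mu> = "var_mono x + Poly_Mapping.single j e"
  have \<mu>j: "lookup ?\<mu> j = e" using assms(1) by (auto simp: lookup_add lookup_var_mono)
  have "e \<le> lookup m j"
  proof (cases "m = ?\<mu>")
    case False
    then obtain i where i: "lookup ?\<mu> i < lookup m i" "\<And>k. i < k \<Longrightarrow> lookup m k = lookup ?\<mu> k"
      using assms(2,3) unfolding revlex_order_def by auto
    then have "i \<le> j" using supp[of i] by simp
    then show ?thesis using i \<mu>j by (cases "i = j") auto
  qed (use \<mu>j in simp)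
  then have m: "m = Poly_Mapping.single j e + (m - Poly_Mapping.single j e)"
    by (intro monomial_diff) (auto simp: lookup_single when_def)
  then have "mdeg m = e + mdeg (m - Poly_Mapping.single j e)" by (metis mdeg_add mdeg_single)
  then obtain l where "m - Poly_Mapping.single j e = var_mono l"
    using assms(2) mdeg_eq_1[of "m - Poly_Mapping.single j e"] by auto
  then have "m = Poly_Mapping.single j e + var_mono l" using m by simp
  moreover from this have "l \<le> j" by (intro supp) (simp add: lookup_add lookup_var_mono)
  ultimately show ?thesis by blast
qed

lemma revlex_obstruction:
  fixes A :: "('k::field_char_0, 'n::{finite, linorder}) sqmat"
  assumes G: "spread G r" and r: "pos j + r = CARD('n)" and x: "x < j"
    and A: "invertible A" "all_minors A"
  shows "var_mono x + Poly_Mapping.single j e \<notin> leads revlex_order (orbit_ideal (mono_ideal (edge_monos G)) A)"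
proof
  let ?\<mu> = "var_mono x + Poly_Mapping.single j e" and ?I = "mono_ideal (edge_monos G) :: ('n, 'k) mpoly set"
  let ?y = "\<lambda>u c. \<Sum>k\<in>UNIV. u k * A $ k $ c"
  assume lead: "?\<mu> \<in> leads revlex_order (orbit_ideal ?I A)"
  have deg: "mdeg ?\<mu> = e + 1" by simp
  obtain F where F: "F \<in> orbit_ideal ?I A" "homog (e + 1) F" "?\<mu> \<in> keys F"
      "\<And>t. t \<in> keys F \<Longrightarrow> (t, ?\<mu>) \<in> revlex_order"
    using revlex.homog_lead[OF hclosed_orbit_ideal[OF hclosed_mono_ideal] lead] unfolding deg by blast
  obtain f where f: "f \<in> ?I" "F = linear_change A f"
    using F(1) orbit_ideal_invertible[OF mono_ideal_subspace[OF mono_closed_edge_monos] A(1)] by blast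
  define c where "c = (\<lambda>l. lookup F (Poly_Mapping.single j e + var_mono l))"
  have cx: "c x \<noteq> 0" using F(3) by (simp add: c_def in_keys_iff add.commute)
  have evF: "peval u F = u j ^ e * (\<Sum>l\<in>{..j}. c l * u l)" if u: "\<And>k. j < k \<Longrightarrow> u k = 0" for u
  proof -
    let ?g = "\<lambda>l. Poly_Mapping.single j e + var_mono l" and ?S = "(\<lambda>l. Poly_Mapping.single j e + var_mono l) ` {..j}"
    have "lookup F m * mono_eval u m = 0" if m: "m \<in> keys F" "m \<notin> ?S" for m
    proof -
      have "\<exists>k. 0 < lookup m k \<and> \<not> k \<le> j"
        using revlex_below_support[OF x _ F(4)[OF m(1)]] m F(2) unfolding homog_def by blast
      then obtain k where "0 < lookup m k" "u k = 0" using u by auto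
      then have "mono_eval u m = 0" unfolding mono_eval_def by (intro prod_zero) (auto intro!: bexI[of _ k])
      then show ?thesis by simp
    qed
    then have "peval u F = (\<Sum>m\<in>?S. lookup F m * mono_eval u m)"
      unfolding poly_subst_eq id_apply
      by (intro sum.mono_neutral_cong) (auto simp: in_keys_iff)
    also have "\<dots> = (\<Sum>l\<in>{..j}. lookup F (?g l) * mono_eval u (?g l))"
      by (subst sum.reindex) (auto simp: inj_on_def)
    also have "\<dots> = (\<Sum>l\<in>{..j}. u j ^ e * (c l * u l))"
      by (simp only: c_def mono_eval_add mono_eval_single mono_eval_var mult_ac)
    finally show ?thesis by (simp only: sum_distrib_left)
  qed
  have orth: "(\<Sum>l\<in>{..j}. c l * u l) = 0"
    if u: "\<And>k. j < k \<Longrightarrow> u k = 0" "u j \<noteq> 0" "\<And>c. ?y u c \<noteq> 0 \<longleftrightarrow> c \<in> T"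
      and T: "\<forall>i\<in>T. \<forall>l\<in>T. i \<noteq> l \<longrightarrow> {i, l} \<notin> G" for u T
  proof -
    have "mono_eval (?y u) m = 0" if "m \<in> keys f" for m
    proof -
      have "m \<in> edge_monos G" using that f(1) by (auto simp: mono_ideal_def)
      then obtain k where "0 < lookup m k" "k \<notin> T" using T unfolding edge_monos_def by blast
      then show ?thesis
        using u(3) unfolding mono_eval_def by (intro prod_zero) (auto intro!: bexI[of _ k])
    qed
    then have "peval (?y u) f = 0" unfolding poly_subst_eq by simp
    then have "peval u F = 0" by (simp only: f(2) peval_linear_change)
    then show ?thesis using evF[of u] u(1,2) by simp
  qed
  obtain X0 where X0: "card X0 = r" "\<And>X. X0 \<subseteq> X \<Longrightarrow> X \<noteq> UNIV \<Longrightarrow>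
      \<exists>v T. v \<notin> X \<and> v \<in> T \<and> T \<subseteq> insert v X \<and> card T = r + 1 \<and>
        (\<forall>i\<in>T. \<forall>l\<in>T. i \<noteq> l \<longrightarrow> {i, l} \<notin> G)"
    using G unfolding spread_def by blast
  \<comment> \<open>Independence is recorded for the images under \<open>A\<close>, whose
    coordinates are indexed by vertices: the old images vanish outside \<open>X\<close>, whereas the
    image of the new point is nonzero at \<open>v\<close>.\<close>
  define R where "R = (\<lambda>X. \<exists>U. (\<forall>v\<in>X - X0. (\<forall>k>j. U v k = 0) \<and> (\<Sum>l\<in>{..j}. c l * U v l) = 0 \<and>
      (\<forall>z. z \<notin> X \<longrightarrow> ?y (U v) z = 0)) \<and> rows_indep (X - X0) UNIV (\<lambda>v. ?y (U v)))"
  have "R UNIV"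
  proof (rule grow_to_UNIV[of R X0])
    show "R X0" by (simp add: R_def rows_indep_def)
    fix X assume X: "X0 \<subseteq> X" "R X" "X \<noteq> UNIV"
    obtain U where U: "\<And>v. v \<in> X - X0 \<Longrightarrow> (\<forall>k>j. U v k = 0) \<and> (\<Sum>l\<in>{..j}. c l * U v l) = 0 \<and>
      (\<forall>z. z \<notin> X \<longrightarrow> ?y (U v) z = 0)" "rows_indep (X - X0) UNIV (\<lambda>v. ?y (U v))"
      using X(2) unfolding R_def by blast
    obtain v T where v: "v \<notin> X" "v \<in> T" "T \<subseteq> insert v X" "card T = r + 1"
        "\<forall>i\<in>T. \<forall>l\<in>T. i \<noteq> l \<longrightarrow> {i, l} \<notin> G"
      using X0(2)[OF X(1,3)] by blast
    obtain u where u: "\<And>k. j < k \<Longrightarrow> u k = 0" "u j \<noteq> 0" "\<And>c. ?y u c \<noteq> 0 \<longleftrightarrow> c \<in> T"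
      using point_with_support[OF A(2), of j T] r v(4) by auto
    define W where "W = U(v := u)"
    have diff: "insert v X - X0 = insert v (X - X0)" using v(1) X(1) by auto
    have Wother: "W d = U d" if "d \<in> X - X0" for d using that v(1) by (auto simp: W_def)
    have Wv: "W v = u" by (simp add: W_def)
    have "rows_indep (insert v (X - X0)) UNIV (\<lambda>v. ?y (W v))"
    proof (rule rows_indepI)
      fix w d assume z: "\<forall>z\<in>UNIV. (\<Sum>d\<in>insert v (X - X0). w d * ?y (W d) z) = 0" and d: "d \<in> insert v (X - X0)"
      have eq: "w v * ?y u z + (\<Sum>d\<in>X - X0. w d * ?y (U d) z) = 0" for z
      proof -
        have "(\<Sum>d\<in>insert v (X - X0). w d * ?y (W d) z)
            = w v * ?y (W v) z + (\<Sum>d\<in>X - X0. w d * ?y (W d) z)"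
          using v(1) by (intro sum.insert) auto
        also have "(\<Sum>d\<in>X - X0. w d * ?y (W d) z) = (\<Sum>d\<in>X - X0. w d * ?y (U d) z)"
          using Wother by (intro sum.cong) auto
        finally show ?thesis using z by (simp only: Wv) simp
      qed
      have "?y (U d) v = 0" if "d \<in> X - X0" for d using U(1)[OF that] v(1) by blast
      then have "(\<Sum>d\<in>X - X0. w d * ?y (U d) v) = 0"
        by (intro sum.neutral ballI) (simp only: mult_zero_right)
      then have "w v * ?y u v = 0" using eq[of v] by simp
      moreover have "?y u v \<noteq> 0" using u(3) v(2) by blast
      ultimately have wv: "w v = 0" by (metis mult_eq_0_iff)
      then have "(\<Sum>d\<in>X - X0. w d * ?y (U d) z) = 0" for z using eq[of z] by simp
      then have "w d = 0" if "d \<in> X - X0" using rows_indepD[OF U(2), of w d] that by blast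
      then show "w d = 0" using wv d by blast
    qed
    moreover have "(\<forall>k>j. W d k = 0) \<and> (\<Sum>l\<in>{..j}. c l * W d l) = 0 \<and>
      (\<forall>z. z \<notin> insert v X \<longrightarrow> ?y (W d) z = 0)" if d: "d \<in> insert v (X - X0)" for d
    proof (cases "d = v")
      case True
      have "?y u z = 0" if "z \<notin> insert v X" for z using u(3) v(3) that by blast
      then show ?thesis using u(1) orth[OF u v(5)] unfolding True Wv by blast
    next
      case False
      then have "d \<in> X - X0" using d by blast
      then show ?thesis using U(1) Wother by simp
    qed
    ultimately have "R (insert v X)" unfolding R_def diff by blast
    then show "\<exists>v. v \<notin> X \<and> R (insert v X)" using v(1) by blast
  qed
  then obtain U where U: "\<And>v. v \<in> - X0 \<Longrightarrow> \<forall>k>j. U v k = 0" "\<And>v. v \<in> - X0 \<Longrightarrow> (\<Sum>l\<in>{..j}. c l * U v l) = 0"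
    "rows_indep (- X0) UNIV (\<lambda>v. ?y (U v))"
    unfolding R_def Compl_eq_Diff_UNIV by blast
  \<comment> \<open>The unit vector at \<open>x\<close> joins the points. The linear form with
    coefficients \<open>c\<close> is zero at every point but not at this vector, so all of them are
    independent: one vector more than the dimension \<open>pos j\<close> allows.\<close>
  define N where "N = (\<lambda>d l. case d of None \<Rightarrow> if l = x then 1 else 0 | Some v \<Rightarrow> U v l)"
  let ?D = "insert None (Some ` (- X0))"
  have sumD: "(\<Sum>d\<in>?D. w d * N d l) = w None * N None l + (\<Sum>v\<in>- X0. w (Some v) * U v l)" for w l
    by (subst sum.insert) (auto simp: sum.reindex N_def)
  have "rows_indep ?D {..j} N"
  proof (rule rows_indepI)
    fix w d assume z: "\<forall>l\<in>{..j}. (\<Sum>d\<in>?D. w d * N d l) = 0" and d: "d \<in> ?D"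
    have "0 = (\<Sum>l\<in>{..j}. c l * (w None * N None l + (\<Sum>v\<in>- X0. w (Some v) * U v l)))"
      using z unfolding sumD by simp
    also have "\<dots> = (\<Sum>l\<in>{..j}. c l * (w None * N None l)) + (\<Sum>l\<in>{..j}. \<Sum>v\<in>- X0. w (Some v) * (c l * U v l))"
      by (simp only: distrib_left sum.distrib sum_distrib_left mult.left_commute)
    also have "(\<Sum>l\<in>{..j}. \<Sum>v\<in>- X0. w (Some v) * (c l * U v l)) = (\<Sum>v\<in>- X0. w (Some v) * (\<Sum>l\<in>{..j}. c l * U v l))"
      unfolding sum_distrib_left by (rule sum.swap)
    also have "\<dots> = 0" using U(2) by (intro sum.neutral ballI) (simp only: mult_zero_right)
    also have "(\<Sum>l\<in>{..j}. c l * (w None * N None l)) = (\<Sum>l\<in>{..j}. if l = x then c x * w None else 0)"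
      by (intro sum.cong) (auto simp: N_def)
    also have "\<dots> = c x * w None" using x by simp
    finally have w0: "w None = 0" using cx by simp
    have zU: "(\<Sum>v\<in>- X0. w (Some v) * U v l) = 0" for l
    proof (cases "l \<le> j")
      case True
      then show ?thesis using z w0 unfolding sumD by simp
    next
      case False
      then show ?thesis using U(1) by (intro sum.neutral) auto
    qed
    have "(\<Sum>v\<in>- X0. w (Some v) * ?y (U v) z) = 0" for z
    proof -
      have "(\<Sum>v\<in>- X0. w (Some v) * ?y (U v) z) = (\<Sum>v\<in>- X0. \<Sum>k\<in>UNIV. w (Some v) * U v k * A $ k $ z)"
        by (simp only: sum_distrib_left mult.assoc)
      also have "\<dots> = (\<Sum>k\<in>UNIV. \<Sum>v\<in>- X0. w (Some v) * U v k * A $ k $ z)" by (rule sum.swap)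
      also have "\<dots> = (\<Sum>k\<in>UNIV. (\<Sum>v\<in>- X0. w (Some v) * U v k) * A $ k $ z)"
        by (simp only: sum_distrib_right)
      finally show ?thesis using zU by simp
    qed
    then have "w (Some v) = 0" if "v \<in> - X0" for v
      using rows_indepD[OF U(3), of "\<lambda>v. w (Some v)" v] that by blast
    then show "w d = 0" using d w0 by auto
  qed
  then have "card ?D \<le> card {..j}" by (intro rows_indep_card_le) auto
  moreover have "card ?D = 1 + card (- X0)" by (simp add: card_image)
  moreover have "card (- X0) = CARD('n) - r" by (simp add: card_Compl X0(1))
  moreover have "card {..j} = pos j" by (simp add: pos_def atMost_def)
  ultimately show False using r by simp
qed

section \<open>Lexicographic leading monomials\<close>

text \<open>A monomial of this degree above \<open>x_x x_j^e\<close> contains \<open>x_x\<close>. If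
  its cofactor has a variable before \<open>x_j\<close>, a product from \<open>below\<close> divides
  it; otherwise the cofactor uses only variables from \<open>x_j\<close> on, has degree
  \<open>e\<close> and is not below \<open>x_j^e\<close>, so it equals \<open>x_j^e\<close>.\<close>

lemma lex_above:
  fixes x j :: "'n::{finite, linorder}"
  assumes closed: "mono_closed L" and x: "\<And>i. x \<le> i" "x < j"
    and below: "\<And>i. i < j \<Longrightarrow> var_mono x + var_mono i \<in> L"
    and \<mu>: "var_mono x + Poly_Mapping.single j e \<in> L"
    and m: "mdeg m = e + 1" "(var_mono x + Poly_Mapping.single j e, m) \<in> lex_order"
  shows "m \<in> L"
proof (cases "m = var_mono x + Poly_Mapping.single j e")
  case False
  let ?\<mu> = "var_mono x + Poly_Mapping.single j e"
  obtain i where i: "lookup ?\<mu> i < lookup m i" "\<And>k. k < i \<Longrightarrow> lookup ?\<mu> k = lookup m k"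
    using m(2) False unfolding lex_order_def by blast
  have "lookup ?\<mu> x = 1" using x(2) by (simp add: lookup_add lookup_var_mono lookup_single)
  then have "0 < lookup m x" using i x(1)[of i] by (cases "x = i") auto
  then have mx: "m = var_mono x + (m - var_mono x)"
    by (intro monomial_diff) (auto simp: lookup_var_mono)
  define n where "n = m - var_mono x"
  have mn: "m = var_mono x + n" using mx by (simp add: n_def)
  have n: "mdeg n = e" using m(1) mn by simp
  have i': "lookup (Poly_Mapping.single j e) i < lookup n i"
    using i(1) by (simp add: mn lookup_add)
  show ?thesis
  proof (cases "\<exists>k<j. 0 < lookup n k")
    case True
    then obtain k where k: "k < j" "0 < lookup n k" by blast
    then have "n = var_mono k + (n - var_mono k)"
      by (intro monomial_diff) (auto simp: lookup_var_mono)
    then obtain l where "n = var_mono k + l" by blast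
    then have "m = l + (var_mono x + var_mono k)"
      by (simp add: mn add_ac)
    then show ?thesis using closed below[OF k(1)] unfolding mono_closed_def by metis
  next
    case nok: False
    have "j \<le> i" using nok i' by (metis gr_zeroI less_nat_zero_code not_le)
    moreover have "i \<noteq> j" using i' lookup_le_mdeg[of n j] n by auto
    ultimately have "j < i" by simp
    then have "lookup n j = e" using i(2)[of j] by (simp add: mn lookup_add)
    then have nj: "n = Poly_Mapping.single j e + (n - Poly_Mapping.single j e)"
      by (intro monomial_diff) (auto simp: lookup_single when_def)
    then have "mdeg n = e + mdeg (n - Poly_Mapping.single j e)" by (metis mdeg_add mdeg_single)
    then have "n = Poly_Mapping.single j e" using n nj mdeg_eq_0_iff by (metis add.right_neutral add_left_cancel)
    then show ?thesis using \<mu> mn by simp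
  qed
qed (use \<mu> in simp)

text \<open>At \<open>A\<close> every monomial of \<open>?C\<close> is leading, so the count there
  is maximal. Semicontinuity makes it maximal generically, which turns the count back into
  membership.\<close>

lemma lex_generic_leads:
  fixes A :: "('k::field_char_0, 'n::{finite, linorder}) sqmat"
  assumes I: "hclosed I" and x: "\<And>i. x \<le> i" "x < j"
    and below: "\<And>i. i < j \<Longrightarrow> var_mono x + var_mono i \<in> leads lex_order (orbit_ideal I A)"
    and \<mu>: "var_mono x + Poly_Mapping.single j e \<in> leads lex_order (orbit_ideal I A)"
  shows "generic (\<lambda>B. var_mono x + Poly_Mapping.single j e \<in> leads lex_order (orbit_ideal I B))"
proof -
  let ?\<mu> = "var_mono x + Poly_Mapping.single j e"
  let ?C = "{m. mdeg m = e + 1 \<and> (?\<mu>, m) \<in> lex_order}"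
  have up: "lex.upset (e + 1) ?C"
    unfolding lex.upset_def using lex.ord_trans by blast
  have sub: "?C \<subseteq> leads lex_order (orbit_ideal I A)"
    using lex_above[OF lex.mono_closed_leads[OF orbit_ideal_subspace] x below \<mu>] by blast
  have "generic (\<lambda>B. card (leads lex_order (orbit_ideal I A) \<inter> ?C) \<le> card (leads lex_order (orbit_ideal I B) \<inter> ?C))"
    by (rule lex.generic_card_leads[OF I up])
  then show ?thesis
  proof (rule generic_mono)
    fix B assume "card (leads lex_order (orbit_ideal I A) \<inter> ?C) \<le> card (leads lex_order (orbit_ideal I B) \<inter> ?C)"
    moreover have "leads lex_order (orbit_ideal I A) \<inter> ?C = ?C" using sub by blast
    ultimately have "leads lex_order (orbit_ideal I B) \<inter> ?C = ?C"
      using lex.upset_finite[OF up] by (intro card_seteq) auto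
    moreover have "?\<mu> \<in> ?C" using lex.ord_refl by simp
    ultimately show "?\<mu> \<in> leads lex_order (orbit_ideal I B)" by blast
  qed
qed

text \<open>A common value would give both orders the same generic leading monomials; one matrix
  that is generic for both, invertible and without singular square blocks contradicts
  \<open>revlex_obstruction\<close>.\<close>

lemma gins_not_singleton:
  fixes A :: "('k::field_char_0, 'n::{finite, linorder}) sqmat"
  assumes G: "spread G r" "pos j + r = CARD('n)" and x: "\<And>i. x \<le> i" "x < j"
    and below: "\<And>i. i < j \<Longrightarrow> var_mono x + var_mono i \<in> leads lex_order (orbit_ideal (edge_ideal G) A)"
    and \<mu>: "var_mono x + Poly_Mapping.single j e \<in> leads lex_order (orbit_ideal (edge_ideal G) A)"
  shows "card (gins (edge_ideal G :: ('n, 'k) mpoly set)) \<noteq> 1"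
proof
  let ?I = "edge_ideal G :: ('n, 'k) mpoly set" and ?\<mu> = "var_mono x + Poly_Mapping.single j e"
  assume "card (gins ?I) = 1"
  then obtain J where "gins ?I = {J}" by (metis card_1_singletonE)
  moreover have "gin lex_order ?I \<in> gins ?I" "gin revlex_order ?I \<in> gins ?I"
    unfolding gins_def using lex_term_order lex_decreasing revlex_term_order revlex_decreasing by blast+
  ultimately have eq: "gin lex_order ?I = gin revlex_order ?I" by simp
  obtain K L where K: "generic (\<lambda>A :: ('k, 'n) sqmat. leads lex_order (orbit_ideal ?I A) = K)"
    and L: "generic (\<lambda>A :: ('k, 'n) sqmat. leads revlex_order (orbit_ideal ?I A) = L)"
    unfolding edge_ideal_eq
    using lex.ex_generic_leads[OF mono_closed_edge_monos] revlex.ex_generic_leads[OF mono_closed_edge_monos] by blast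
  have sub: "ideal.subspace ?I" unfolding edge_ideal_eq by (intro mono_ideal_subspace mono_closed_edge_monos)
  have "(mono_ideal K :: ('n, 'k) mpoly set) = mono_ideal L"
    using generic_gin[OF lex_term_order sub K] generic_gin[OF revlex_term_order sub L] eq by simp
  then have KL: "K = L" by (simp add: mono_ideal_eq_iff)
  have "generic (\<lambda>B. ?\<mu> \<in> leads lex_order (orbit_ideal ?I B))"
    using x below \<mu> by (intro lex_generic_leads) (auto simp: edge_ideal_eq hclosed_mono_ideal)
  from generic_ex[OF generic_conj[OF generic_conj[OF K L]
      generic_conj[OF this generic_conj[OF generic_invertible generic_all_minors]]]]
  show False using KL revlex_obstruction[OF G x(2)] unfolding edge_ideal_eq by blast
qed

text \<open>As \<open>x\<close> is the largest variable, its exponent alone decides the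
  comparison.\<close>

lemma lex_leadI:
  fixes h :: "('n::{finite, linorder}, 'k::field) mpoly"
  assumes "mono_poly m + h \<in> V" "0 < lookup m x" "\<And>i. x \<le> i" "\<And>t. t \<in> keys h \<Longrightarrow> lookup t x = 0"
  shows "m \<in> leads lex_order V"
proof -
  have "m \<notin> keys h" using assms(2,4) by auto
  then have "m \<in> keys (mono_poly m + h)" by (simp add: in_keys_iff lookup_add mono_poly_def)
  moreover have "(t, m) \<in> lex_order" if "t \<in> keys (mono_poly m + h)" for t
  proof -
    have "t \<in> keys (mono_poly m :: ('n, 'k) mpoly) \<union> keys h"
      by (rule subsetD[OF keys_add that])
    then have "t = m \<or> lookup t x < lookup m x" using assms(2,4) by (auto simp: mono_poly_def)
    moreover have "\<forall>k<x. lookup t k = lookup m k" using assms(3) by (auto simp: not_less[symmetric])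
    ultimately show ?thesis unfolding lex_order_def by blast
  qed
  ultimately show ?thesis using assms(1) unfolding leads_def by blast
qed

section \<open>A singular matrix that straightens a forest\<close>

text \<open>A vertex \<open>v\<close> is mapped to \<open>x\<^sub>1 + \<psi> v\<close>. Growing a forest from its roots, \<open>\<psi>\<close> of a new vertex
  is chosen such that \<open>\<psi>\<close> sums to a prescribed variable along the new edge.\<close>

lemma grow_forest:
  fixes X0 J :: "'n::{finite, linorder} set" and \<psi>0 :: "'n \<Rightarrow> 'n \<Rightarrow> 'k::field"
  assumes card: "card J = card (- X0)"
    and reach: "\<And>X. X0 \<subseteq> X \<Longrightarrow> X \<noteq> UNIV \<Longrightarrow> \<exists>p\<in>X. \<exists>v. v \<notin> X \<and> {p, v} \<in> G"
  shows "\<exists>\<psi>. (\<forall>a\<in>X0. \<psi> a = \<psi>0 a) \<and>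
    (\<forall>i\<in>J. \<exists>a b. a \<noteq> b \<and> {a, b} \<in> G \<and> (\<forall>k. \<psi> a k + \<psi> b k = (if k = i then 1 else 0)))"
proof -
  define R where "R = (\<lambda>X. X0 \<subseteq> X \<and> (\<exists>\<psi> K. K \<subseteq> J \<and> card K + card (- X) = card J \<and> (\<forall>a\<in>X0. \<psi> a = \<psi>0 a) \<and>
    (\<forall>i\<in>K. \<exists>a\<in>X. \<exists>b\<in>X. a \<noteq> b \<and> {a, b} \<in> G \<and> (\<forall>k. \<psi> a k + \<psi> b k = (if k = i then 1 else 0)))))"
  have "R UNIV"
  proof (rule grow_to_UNIV[of R X0])
    show "R X0" unfolding R_def using card by (intro conjI exI[of _ \<psi>0] exI[of _ "{}"]) auto
    fix X assume X: "X0 \<subseteq> X" "R X" "X \<noteq> UNIV"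
    then obtain \<psi> K where K: "K \<subseteq> J" "card K + card (- X) = card J" "\<And>a. a \<in> X0 \<Longrightarrow> \<psi> a = \<psi>0 a"
      "\<And>i. i \<in> K \<Longrightarrow> \<exists>a\<in>X. \<exists>b\<in>X. a \<noteq> b \<and> {a, b} \<in> G \<and> (\<forall>k. \<psi> a k + \<psi> b k = (if k = i then 1 else 0))"
      unfolding R_def by blast
    obtain p v where pv: "p \<in> X" "v \<notin> X" "{p, v} \<in> G" using reach[OF X(1,3)] by blast
    have cX: "card (- X) = Suc (card (- insert v X))"
    proof -
      have "- X = insert v (- insert v X)" using pv(2) by auto
      then show ?thesis by (metis ComplD card_insert_disjoint finite insertI1)
    qed
    then have "K \<noteq> J" using K(2) by auto
    then obtain i where i: "i \<in> J" "i \<notin> K" using K(1) by blast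
    define \<phi> where "\<phi> = \<psi>(v := \<lambda>k. (if k = i then 1 else 0) - \<psi> p k)"
    have old: "\<phi> a = \<psi> a" if "a \<in> X" for a using that pv(2) by (auto simp: \<phi>_def)
    have "R (insert v X)" unfolding R_def
    proof (intro conjI exI[of _ \<phi>] exI[of _ "insert i K"] ballI)
      show "X0 \<subseteq> insert v X" "insert i K \<subseteq> J" using X(1) i K(1) by auto
      show "card (insert i K) + card (- insert v X) = card J" using K(2) cX i(2) by simp
      show "\<phi> a = \<psi>0 a" if "a \<in> X0" for a using that X(1) K(3) old by auto
      fix l assume l: "l \<in> insert i K"
      show "\<exists>a\<in>insert v X. \<exists>b\<in>insert v X. a \<noteq> b \<and> {a, b} \<in> G \<and> (\<forall>k. \<phi> a k + \<phi> b k = (if k = l then 1 else 0))"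
      proof (cases "l = i")
        case True
        have "\<forall>k. \<phi> p k + \<phi> v k = (if k = l then 1 else 0)" using old[OF pv(1)] True by (simp add: \<phi>_def)
        moreover have "p \<noteq> v" using pv by auto
        ultimately show ?thesis using pv by blast
      next
        case False
        then obtain a b where "a \<in> X" "b \<in> X" "a \<noteq> b" "{a, b} \<in> G" "\<forall>k. \<psi> a k + \<psi> b k = (if k = l then 1 else 0)"
          using K(4) l by blast
        then show ?thesis using old by (intro bexI[of _ a] bexI[of _ b]) auto
      qed
    qed
    then show "\<exists>v. v \<notin> X \<and> R (insert v X)" using pv(2) by blast
  qed
  then obtain \<psi> K where K: "K \<subseteq> J" "card K = card J" "\<forall>a\<in>X0. \<psi> a = \<psi>0 a"
      "\<forall>i\<in>K. \<exists>a b. a \<noteq> b \<and> {a, b} \<in> G \<and> (\<forall>k. \<psi> a k + \<psi> b k = (if k = i then 1 else 0))"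
    unfolding R_def by auto
  then have "K = J" by (intro card_subset_eq) auto
  then show ?thesis using K by blast
qed

definition forest_matrix :: "'n \<Rightarrow> ('n \<Rightarrow> 'n \<Rightarrow> 'k) \<Rightarrow> ('k::field, 'n::finite) sqmat" where
  "forest_matrix x \<psi> = (\<chi> k a. if k = x then 1 else \<psi> a k)"

text \<open>The coefficient at \<open>x\<close> is masked so that products of these forms are free
  of \<open>x\<close>, as \<open>lex_leadI\<close> requires.\<close>

definition lin :: "'n \<Rightarrow> ('n \<Rightarrow> 'k::field) \<Rightarrow> ('n::finite, 'k) mpoly" where
  "lin x c = linear_form (\<lambda>k. if k = x then 0 else c k)"

lemma linear_form_add: "linear_form c + linear_form d = linear_form (\<lambda>k. c k + d k)"
  by (simp add: linear_form_def const_hom.add distrib_right sum.distrib)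

lemma lin_add: "lin x c + lin x d = lin x (\<lambda>k. c k + d k)"
  unfolding lin_def linear_form_add by (rule arg_cong[of _ _ linear_form]) auto

lemma linear_form_unit: "linear_form (\<lambda>k. if k = i then c else 0) = const_poly c * var i"
proof -
  have "const_poly (if k = i then c else 0) * var k = (if k = i then const_poly c * var i else 0)" for k
    by (simp add: const_hom.zero)
  then show ?thesis by (simp add: linear_form_def)
qed

lemma lin_unit: "i \<noteq> x \<Longrightarrow> lin x (\<lambda>k. if k = i then c else 0) = const_poly c * var i"
  unfolding lin_def linear_form_unit[symmetric] by (rule arg_cong[of _ _ linear_form]) auto

lemma lin_zero: "lin x (\<lambda>k. 0) = 0"
  by (simp add: lin_def linear_form_def const_hom.zero)

lemma keys_lin: "t \<in> keys (lin x c) \<Longrightarrow> lookup t x = 0"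
proof -
  assume t: "t \<in> keys (lin x c)"
  show ?thesis
  proof (rule ccontr)
    assume x: "lookup t x \<noteq> 0"
    have "lookup (const_poly (if k = x then 0 else c k) * var k) t = 0" for k
      using x by (auto simp: mono_poly_def lookup_single when_def lookup_var_mono)
    then have "lookup (lin x c) t = 0"
      unfolding lin_def linear_form_def lookup_sum by (intro sum.neutral) blast
    then show False using t by (simp add: in_keys_iff)
  qed
qed

lemma keys_mult_free:
  fixes p q :: "('n::finite, 'k::comm_ring_1) mpoly"
  assumes "\<And>t. t \<in> keys p \<Longrightarrow> lookup t x = 0" "\<And>t. t \<in> keys q \<Longrightarrow> lookup t x = 0" "t \<in> keys (p * q)"
  shows "lookup t x = 0"
proof -
  obtain r s where "t = r + s" "r \<in> keys p" "s \<in> keys q" using keys_mult assms(3) by blast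
  then show ?thesis using assms(1,2) by (simp add: lookup_add)
qed

lemma keys_lin_mult: "t \<in> keys (lin x c * lin x d) \<Longrightarrow> lookup t x = 0"
  by (rule keys_mult_free[OF keys_lin keys_lin])

lemma keys_diff_free:
  assumes "\<And>t. t \<in> keys p \<Longrightarrow> lookup t x = 0" "\<And>t. t \<in> keys q \<Longrightarrow> lookup t x = 0" "t \<in> keys (p - q)"
  shows "lookup t x = 0"
  using keys_diff[of p q] assms by blast

lemma forest_matrix_var:
  fixes \<psi> :: "'n::finite \<Rightarrow> 'n \<Rightarrow> 'k::field"
  shows "linear_change (forest_matrix x \<psi>) (var a) = var x + lin x (\<psi> a)"
proof -
  have "linear_change (forest_matrix x \<psi>) (var a) = linear_form (\<lambda>k. if k = x then 1 else \<psi> a k)"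
    by (simp add: linear_change_var forest_matrix_def)
  also have "\<dots> = linear_form (\<lambda>k. if k = x then 1 else 0) + lin x (\<psi> a)"
    unfolding lin_def linear_form_add by (rule arg_cong[of _ _ linear_form]) auto
  finally show ?thesis by (simp add: linear_form_unit const_hom.one)
qed

lemma forest_matrix_edge:
  fixes \<psi> :: "'n::finite \<Rightarrow> 'n \<Rightarrow> 'k::field"
  assumes "a \<noteq> b" "{a, b} \<in> G"
  shows "(var x + lin x (\<psi> a)) * (var x + lin x (\<psi> b)) \<in> orbit_ideal (edge_ideal G) (forest_matrix x \<psi>)"
proof -
  have "var a * var b \<in> (edge_ideal G :: ('n, 'k) mpoly set)"
    unfolding edge_ideal_def using assms by (intro ideal.span_base) blast
  from linear_change_in_orbit[OF this, of "forest_matrix x \<psi>"]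
  show ?thesis by (simp add: change.mult forest_matrix_var)
qed

text \<open>The quadric of an edge is
  \<open>x^2 + x (\<psi> a + \<psi> b) + \<psi> a \<psi> b\<close>. On the base edge the middle term
  vanishes, which yields the square. Subtracting this from the quadric of an edge with sum
  \<open>i\<close> leaves \<open>x\<close> times the variable \<open>i\<close> plus terms free of
  \<open>x\<close>.\<close>

lemma forest_leads:
  fixes \<psi> :: "'n::{finite, linorder} \<Rightarrow> 'n \<Rightarrow> 'k::field"
  assumes x: "\<And>i. x \<le> i"
    and base: "a0 \<noteq> b0" "{a0, b0} \<in> G" "\<And>k. \<psi> a0 k + \<psi> b0 k = 0"
    and forest: "\<And>i. x < i \<Longrightarrow> i \<in> J \<Longrightarrow>
      \<exists>a b. a \<noteq> b \<and> {a, b} \<in> G \<and> (\<forall>k. \<psi> a k + \<psi> b k = (if k = i then 1 else 0))"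
    and i: "i \<in> J \<or> i = x"
  shows "var_mono x + var_mono i \<in> leads lex_order (orbit_ideal (edge_ideal G) (forest_matrix x \<psi>))"
proof -
  let ?V = "orbit_ideal (edge_ideal G) (forest_matrix x \<psi>)"
  let ?X = "var x :: ('n, 'k) mpoly"
  have "(?X + lin x (\<psi> a0)) * (?X + lin x (\<psi> b0))
      = ?X * ?X + ?X * (lin x (\<psi> a0) + lin x (\<psi> b0)) + lin x (\<psi> a0) * lin x (\<psi> b0)"
    by (simp add: distrib_left distrib_right mult.commute add_ac)
  moreover have "lin x (\<psi> a0) + lin x (\<psi> b0) = 0" unfolding lin_add by (simp add: base lin_zero)
  ultimately have sq: "?X * ?X + lin x (\<psi> a0) * lin x (\<psi> b0) \<in> ?V"
    using forest_matrix_edge[OF base(1,2), of x \<psi>] by simp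
  show ?thesis
  proof (cases "i = x")
    case True
    have "mono_poly (var_mono x + var_mono x) + lin x (\<psi> a0) * lin x (\<psi> b0) \<in> ?V"
      using sq by (simp add: mono_poly_add)
    then show ?thesis unfolding True
      by (rule lex_leadI[OF _ _ x keys_lin_mult]) (simp add: lookup_add lookup_var_mono)
  next
    case False
    then have "x < i" using x[of i] by simp
    then obtain a b where ab: "a \<noteq> b" "{a, b} \<in> G" "\<And>k. \<psi> a k + \<psi> b k = (if k = i then 1 else 0)"
      using forest i False by blast
    have "(?X + lin x (\<psi> a)) * (?X + lin x (\<psi> b))
      = ?X * ?X + ?X * (lin x (\<psi> a) + lin x (\<psi> b)) + lin x (\<psi> a) * lin x (\<psi> b)"
      by (simp add: distrib_left distrib_right mult.commute add_ac)
    moreover have "lin x (\<psi> a) + lin x (\<psi> b) = var i"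
      unfolding lin_add ab(3) using False by (simp add: lin_unit const_hom.one)
    ultimately have "?X * ?X + ?X * var i + lin x (\<psi> a) * lin x (\<psi> b) \<in> ?V"
      using forest_matrix_edge[OF ab(1,2), of x \<psi>] by simp
    from ideal.subspace_diff[OF orbit_ideal_subspace this sq]
    have "mono_poly (var_mono x + var_mono i) + (lin x (\<psi> a) * lin x (\<psi> b) - lin x (\<psi> a0) * lin x (\<psi> b0)) \<in> ?V"
      by (simp add: mono_poly_add algebra_simps)
    then show ?thesis
      by (rule lex_leadI[OF _ _ x keys_diff_free[OF keys_lin_mult keys_lin_mult]])
        (simp add: lookup_add lookup_var_mono)
  qed
qed

section \<open>Graphs\<close>

definition adj :: "'n set set \<Rightarrow> 'n rel" where
  "adj G = {(u, v). u \<noteq> v \<and> {u, v} \<in> G}"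

lemma sym_adj: "sym (adj G)"
  by (auto simp: sym_def adj_def insert_commute)

lemma rtrancl_leaves:
  assumes "(u, v) \<in> r\<^sup>*" "u \<in> X" "v \<notin> X"
  shows "\<exists>p\<in>X. \<exists>w. w \<notin> X \<and> (p, w) \<in> r"
  using assms by (induction rule: rtrancl_induct) blast+

lemma semi_complete_bipartite_iff:
  assumes G: "graph G"
  shows "semi_complete_bipartite G \<longleftrightarrow> (\<exists>P Q. P \<noteq> {} \<and> Q \<noteq> {} \<and> P \<inter> Q = {} \<and>
    (\<forall>i j. i \<noteq> j \<longrightarrow> {i, j} \<in> G \<longleftrightarrow> i \<in> P \<and> j \<in> Q \<or> i \<in> Q \<and> j \<in> P))" (is "_ \<longleftrightarrow> ?R")
proof
  assume "semi_complete_bipartite G"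
  then obtain D where D: "\<forall>i\<in>D. isolated G i" and "complete_bipartite (delete_vertices G D)"
    unfolding semi_complete_bipartite_def by blast
  then obtain P Q where PQ: "P \<noteq> {}" "Q \<noteq> {}" "P \<inter> Q = {}"
    and eq: "delete_vertices G D = {{}} \<union> {{i} |i. i \<in> P \<union> Q} \<union> {{a, b} |a b. a \<in> P \<and> b \<in> Q}"
    unfolding complete_bipartite_def by (elim exE conjE) (rule that; assumption)
  have "{i, j} \<in> G \<longleftrightarrow> i \<in> P \<and> j \<in> Q \<or> i \<in> Q \<and> j \<in> P" if ij: "i \<noteq> j" for i j
  proof
    assume e: "{i, j} \<in> G"
    then have "i \<notin> D" "j \<notin> D" using D ij by (auto simp: isolated_def insert_commute)
    then have "{i, j} \<in> delete_vertices G D" using e by (simp add: delete_vertices_def)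
    then show "i \<in> P \<and> j \<in> Q \<or> i \<in> Q \<and> j \<in> P"
      using ij unfolding eq by (auto simp: doubleton_eq_iff)
  next
    assume "i \<in> P \<and> j \<in> Q \<or> i \<in> Q \<and> j \<in> P"
    then have "{i, j} \<in> delete_vertices G D" unfolding eq by (auto simp: insert_commute)
    then show "{i, j} \<in> G" by (simp add: delete_vertices_def)
  qed
  then show ?R using PQ by blast
next
  assume ?R
  then obtain P Q where PQ: "P \<noteq> {}" "Q \<noteq> {}" "P \<inter> Q = {}"
    and e: "\<And>i j. i \<noteq> j \<Longrightarrow> {i, j} \<in> G \<longleftrightarrow> i \<in> P \<and> j \<in> Q \<or> i \<in> Q \<and> j \<in> P" by blast
  have single: "{i} \<in> G" for i using G by (simp add: graph_def)
  have sub: "H \<in> G" if "F \<in> G" "H \<subseteq> F" for F H using G that unfolding graph_def by blast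
  have cards: "finite F \<and> card F \<le> 2" if "F \<in> G" for F using G that unfolding graph_def by blast
  have "delete_vertices G (- (P \<union> Q)) = {{}} \<union> {{i} |i. i \<in> P \<union> Q} \<union> {{a, b} |a b. a \<in> P \<and> b \<in> Q}" (is "_ = ?S")
  proof
    show "delete_vertices G (- (P \<union> Q)) \<subseteq> ?S"
    proof
      fix F assume F: "F \<in> delete_vertices G (- (P \<union> Q))"
      then have FG: "F \<in> G" "F \<subseteq> P \<union> Q" by (auto simp: delete_vertices_def)
      then consider "card F = 0" | "card F = 1" | "card F = 2" using cards[of F] by linarith
      then show "F \<in> ?S"
      proof cases
        case 1
        then show ?thesis using cards[OF FG(1)] by simp
      next
        case 2
        then obtain i where "F = {i}" by (metis card_1_singletonE)
        then show ?thesis using FG(2) by auto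
      next
        case 3
        then obtain i j where ij: "F = {i, j}" "i \<noteq> j" by (meson card_2_iff)
        then have "i \<in> P \<and> j \<in> Q \<or> i \<in> Q \<and> j \<in> P" using e FG(1) by blast
        then show ?thesis unfolding ij(1) by (auto simp: insert_commute)
      qed
    qed
    have "{a, b} \<in> G" if "a \<in> P" "b \<in> Q" for a b using e[of a b] that PQ(3) by blast
    then show "?S \<subseteq> delete_vertices G (- (P \<union> Q))"
      using single sub[OF single, of "{}"] by (auto simp: delete_vertices_def)
  qed
  moreover have "isolated G i" if "i \<notin> P \<union> Q" for i
    using that e single by (auto simp: isolated_def)
  ultimately show "semi_complete_bipartite G"
    unfolding semi_complete_bipartite_def complete_bipartite_def using PQ
    by (intro exI[of _ "- (P \<union> Q)"]) blast
qed

lemma pos_least: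
  fixes x :: "'n::{finite, linorder}"
  assumes "\<And>i. x \<le> i" shows "pos x = 1"
proof -
  have "{k. k \<le> x} = {x}" using assms by (auto intro: antisym)
  then show ?thesis by (simp add: pos_def)
qed

lemma pos_interval:
  fixes x j :: "'n::{finite, linorder}"
  assumes "\<And>i. x \<le> i"
  shows "card {i. x < i \<and> i \<le> j} = pos j - 1" "card {i. x < i \<and> i < j} = pos j - 2"
proof -
  have px: "pos x = 1" by (rule pos_least[OF assms])
  have "{i. x < i \<and> i \<le> j} = {i. pos i \<in> {1<..pos j}}"
    unfolding pos_less_iff[symmetric] pos_le_iff[symmetric] px by auto
  moreover have "card {i :: 'n. pos i \<in> {1<..pos j}} = card {1<..pos j}"
    using pos_le_card[of j] by (intro card_pos_vimage) auto
  ultimately show "card {i. x < i \<and> i \<le> j} = pos j - 1" by simp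
  have "{i. x < i \<and> i < j} = {i. pos i \<in> {1<..<pos j}}"
    unfolding pos_less_iff[symmetric] px by auto
  moreover have "card {i :: 'n. pos i \<in> {1<..<pos j}} = card {1<..<pos j}"
    using pos_le_card[of j] by (intro card_pos_vimage) auto
  ultimately show "card {i. x < i \<and> i < j} = pos j - 2" by simp
qed

text \<open>The simp rule \<open>ideal.scale_scale\<close> is associativity, oriented against the normal form of
  \<open>algebra_simps\<close>; without deleting it the simplifier does not terminate.\<close>

lemma cubic_identity:
  fixes x z y :: "'a::comm_ring_1"
  shows "x * (z * z) + (z * z * y - z * z * z) = (z - x) * ((x + z) * (x + (y - z)) - x * x) + y * (x * x)"
  by (simp add: algebra_simps del: ideal.scale_scale)

section \<open>Graphs that are not semi-complete bipartite\<close>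

locale fixed_graph =
  fixes G :: "'n::{finite, linorder} set set" and x :: 'n and Iso :: "'n set"
  assumes least: "\<And>i. x \<le> i" and Iso: "Iso = {v. \<forall>w. (v, w) \<notin> adj G}"
begin

lemma pos_less: "1 < pos j \<Longrightarrow> x < j"
  using pos_less_iff[of x j] pos_least[OF least] by simp

text \<open>An edge in the component of \<open>a\<close> with \<psi> zero at both ends contributes
  the square of the largest variable. The component of \<open>c\<close> has an edge whose sum is
  \<open>x_k\<close> but whose ends involve \<open>x_j\<close>; combining the two produces a cubic
  led by \<open>x_1 x_j^2\<close>.\<close>

lemma two_components:
  assumes a: "a \<notin> Iso" and c: "c \<notin> Iso" and ac: "(a, c) \<notin> (adj G)\<^sup>*"
  shows "card (gins (edge_ideal G :: ('n, 'k::field_char_0) mpoly set)) \<noteq> 1"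
proof -
  have symr: "(v, u) \<in> (adj G)\<^sup>*" if "(u, v) \<in> (adj G)\<^sup>*" for u v
    using that sym_rtrancl[OF sym_adj] by (meson symD)
  \<comment> \<open>The choice depends only on the set of reachable vertices, so it is constant on
    components, and \<open>T0\<close> contains one vertex of each component, isolated vertices
    included.\<close>
  define rep where "rep = (\<lambda>v. SOME w. (v, w) \<in> (adj G)\<^sup>*)"
  have rep: "(v, rep v) \<in> (adj G)\<^sup>*" for v unfolding rep_def by (rule someI[of _ v]) simp
  have rep_eq: "rep u = rep v" if "(u, v) \<in> (adj G)\<^sup>*" for u v
  proof -
    have "(u, w) \<in> (adj G)\<^sup>* \<longleftrightarrow> (v, w) \<in> (adj G)\<^sup>*" for w
      using that symr by (meson rtrancl_trans)
    then show ?thesis unfolding rep_def by simp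
  qed
  have rep_rep: "rep (rep v) = rep v" for v using rep_eq[OF rep] by simp
  have rep_adj: "rep u = rep v" if "(u, v) \<in> adj G" for u v using that by (intro rep_eq) blast
  define T0 where "T0 = range rep"
  have T0: "rep v = v" if "v \<in> T0" for v using that rep_rep unfolding T0_def by blast
  have repT0: "rep v \<in> T0" for v by (simp add: T0_def)
  have neighbour: "\<exists>w. (rep v, w) \<in> adj G" if v: "v \<notin> Iso" for v
  proof (cases "rep v = v")
    case True
    then show ?thesis using v Iso by auto
  next
    case False
    then show ?thesis using symr[OF rep[of v]] by (metis converse_rtranclE)
  qed
  obtain b d where b: "(rep a, b) \<in> adj G" and d: "(rep c, d) \<in> adj G"
    using neighbour a c by blast
  have ne: "rep a \<noteq> rep c"
    using ac rep[of a] symr[OF rep[of c]] by (metis rtrancl_trans)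
  have rb: "rep b = rep a" and rd: "rep d = rep c" using rep_adj[OF b] rep_adj[OF d] rep_rep by simp_all
  have bT: "b \<notin> T0" and dT: "d \<notin> T0" using T0 rb rd b d by (auto simp: adj_def)
  have bd: "b \<noteq> d" using rb rd ne by auto
  define t where "t = card T0"
  have t1: "1 \<le> t" unfolding t_def using repT0 by (auto simp: Suc_le_eq card_gt_0_iff)
  have "card (insert b (insert d T0)) = t + 2" using bT dT bd by (simp add: t_def)
  moreover have "card (insert b (insert d T0)) \<le> CARD('n)" by (intro card_mono) auto
  ultimately have tn: "t + 2 \<le> CARD('n)" by simp
  have "1 \<le> CARD('n) - t + 1" "CARD('n) - t + 1 \<le> CARD('n)" using t1 tn by linarith+
  then obtain j :: 'n where j: "pos j = CARD('n) - t + 1" using ex_pos by blast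
  have xj: "x < j" using j tn by (intro pos_less) simp
  \<comment> \<open>The start omits the representative of the component of \<open>a\<close>. As soon
    as it is present, a new vertex replaces the representative of its own component, which keeps the
    set independent and of size \<open>t\<close>.\<close>
  have spread: "spread G (t - 1)" unfolding spread_def
  proof (intro exI[of _ "T0 - {rep a}"] conjI allI impI)
    show "card (T0 - {rep a}) = t - 1" using repT0 by (simp add: t_def)
    fix X assume X: "T0 - {rep a} \<subseteq> X" "X \<noteq> UNIV"
    have indep: "{i, l} \<notin> G" if "rep i \<noteq> rep l" for i l
      using rep_adj[of i l] that by (auto simp: adj_def)
    show "\<exists>v T. v \<notin> X \<and> v \<in> T \<and> T \<subseteq> insert v X \<and> card T = t - 1 + 1 \<and>
        (\<forall>i\<in>T. \<forall>l\<in>T. i \<noteq> l \<longrightarrow> {i, l} \<notin> G)"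
    proof (cases "rep a \<in> X")
      case False
      have "\<forall>i\<in>T0. \<forall>l\<in>T0. i \<noteq> l \<longrightarrow> {i, l} \<notin> G" using T0 indep by metis
      then show ?thesis using False X(1) repT0 t1
        by (intro exI[of _ "rep a"] exI[of _ T0]) (auto simp: t_def)
    next
      case True
      then have sub: "T0 \<subseteq> X" using X(1) by auto
      obtain v where v: "v \<notin> X" using X(2) by auto
      have vT: "v \<notin> T0" using v sub by auto
      have "{i, l} \<notin> G" if "i \<in> insert v (T0 - {rep v})" "l \<in> insert v (T0 - {rep v})" "i \<noteq> l" for i l
        using that T0 rep_rep by (intro indep) (metis DiffE insertE singletonI)
      moreover have "card (insert v (T0 - {rep v})) = t - 1 + 1" using vT repT0 t1 by (simp add: t_def)
      ultimately show ?thesis using v sub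
        by (intro exI[of _ v] exI[of _ "insert v (T0 - {rep v})"]) auto
    qed
  qed
  define J where "J = {i. x < i \<and> i < j}"
  have cardJ: "card J = CARD('n) - t - 1" using pos_interval(2)[of x j] least j by (simp add: J_def)
  then have "J \<noteq> {}" using tn by auto
  then obtain k where k: "k \<in> J" by blast
  define X0 where "X0 = insert b (insert d T0)"
  \<comment> \<open>The edge from \<open>rep c\<close> to \<open>d\<close> has sum
    \<open>x_k\<close> with \<open>k\<close> in \<open>J\<close>, split as \<open>x_j\<close> and
    \<open>x_k - x_j\<close>. This brings in \<open>x_j\<close>, the first variable that the forest
    does not reach.\<close>
  define \<psi>0 :: "'n \<Rightarrow> 'n \<Rightarrow> 'k" where "\<psi>0 = (\<lambda>a i. if a = rep c then if i = j then 1 else 0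
      else if a = d then (if i = k then 1 else 0) - (if i = j then 1 else 0) else 0)"
  have "card (- X0) = CARD('n) - (t + 2)" using \<open>card (insert b (insert d T0)) = t + 2\<close> by (simp add: X0_def card_Compl)
  then have card: "card (J - {k}) = card (- X0)" using cardJ k tn by simp
  have reach: "\<exists>p\<in>X. \<exists>v. v \<notin> X \<and> {p, v} \<in> G" if X: "X0 \<subseteq> X" "X \<noteq> UNIV" for X
  proof -
    obtain v where v: "v \<notin> X" using X(2) by auto
    have "rep v \<in> X" using repT0 X(1) by (auto simp: X0_def)
    then show ?thesis using rtrancl_leaves[OF symr[OF rep[of v]], of X] v by (auto simp: adj_def)
  qed
  obtain \<psi> where \<psi>: "\<And>a. a \<in> X0 \<Longrightarrow> \<psi> a = \<psi>0 a"
    "\<And>i. i \<in> J - {k} \<Longrightarrow> \<exists>a b. a \<noteq> b \<and> {a, b} \<in> G \<and> (\<forall>k. \<psi> a k + \<psi> b k = (if k = i then 1 else 0))"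
    using grow_forest[OF card reach, of \<psi>0] by blast
  have "b \<noteq> rep c" "b \<noteq> d" "rep a \<noteq> d" "d \<noteq> rep c" using bT dT repT0 bd by auto
  then have \<psi>a: "\<psi> (rep a) = (\<lambda>i. 0)" and \<psi>b: "\<psi> b = (\<lambda>i. 0)"
    and \<psi>c: "\<psi> (rep c) = (\<lambda>i. if i = j then 1 else 0)"
    and \<psi>d: "\<psi> d = (\<lambda>i. (if i = k then 1 else 0) - (if i = j then 1 else 0))"
    using \<psi>(1) repT0 ne by (auto simp: X0_def \<psi>0_def)
  let ?V = "orbit_ideal (edge_ideal G) (forest_matrix x \<psi>)"
  let ?X = "var x :: ('n, 'k) mpoly"
  have base: "rep a \<noteq> b" "{rep a, b} \<in> G" and cd: "rep c \<noteq> d" "{rep c, d} \<in> G" using b d by (auto simp: adj_def)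
  have forest: "\<exists>a b. a \<noteq> b \<and> {a, b} \<in> G \<and> (\<forall>l. \<psi> a l + \<psi> b l = (if l = i then 1 else 0))" if "i \<in> J" for i
  proof (cases "i = k")
    case True
    then show ?thesis using cd by (intro exI[of _ "rep c"] exI[of _ d]) (simp add: \<psi>c \<psi>d)
  qed (use \<psi>(2) that in blast)
  have leads: "var_mono x + var_mono i \<in> leads lex_order ?V" if "i < j" for i
  proof (rule forest_leads[of x "rep a" b G \<psi> J, OF least base])
    show "i \<in> J \<or> i = x" using that least[of i] by (cases "i = x") (simp_all add: J_def order_less_le)
  qed (use forest in \<open>simp_all add: \<psi>a \<psi>b\<close>)
  have jk: "j \<noteq> x" "k \<noteq> x" "j \<noteq> k" using xj k by (auto simp: J_def)
  have lc: "lin x (\<psi> (rep c)) = var j" unfolding \<psi>c using jk by (simp add: lin_unit const_hom.one)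
  have "\<psi> d = (\<lambda>i. (if i = k then 1 else 0) + (if i = j then - 1 else 0))" by (auto simp: \<psi>d)
  then have "lin x (\<psi> d) = var k + const_poly (- 1) * var j"
    using jk by (simp only: lin_add[symmetric]) (simp add: lin_unit const_hom.one)
  then have ld: "lin x (\<psi> d) = var k - var j" by (simp add: const_poly_def single_uminus)
  have xx: "?X * ?X \<in> ?V"
    using forest_matrix_edge[OF base, of x \<psi>] by (simp add: \<psi>a \<psi>b lin_zero)
  have q: "(?X + var j) * (?X + (var k - var j)) \<in> ?V"
    using forest_matrix_edge[OF cd, of x \<psi>] by (simp only: lc ld)
  \<comment> \<open>Modulo \<open>x_1^2\<close> the quadric is
    \<open>x_1 x_k + x_j x_k - x_j^2\<close>. The factor \<open>x_j - x_1\<close> cancels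
    \<open>x_1 x_j x_k\<close>; modulo \<open>x_1^2\<close> the only term left with
    \<open>x_1\<close> is \<open>x_1 x_j^2\<close>.\<close>
  have "(?X * (var j * var j)) + (var j * var j * var k - var j * var j * var j)
      = (var j - ?X) * ((?X + var j) * (?X + (var k - var j)) - ?X * ?X) + var k * (?X * ?X)"
    by (rule cubic_identity)
  also have "\<dots> \<in> ?V"
    by (intro ideal.subspace_add ideal.subspace_scale ideal.subspace_diff orbit_ideal_subspace xx q)
  also have "?X * (var j * var j) = mono_poly (var_mono x + Poly_Mapping.single j 2)"
    by (simp add: mono_poly_add power2_eq_square flip: var_power)
  finally have "var_mono x + Poly_Mapping.single j 2 \<in> leads lex_order ?V"
  proof (rule lex_leadI[where x = x])
    fix t assume t: "t \<in> keys (var j * var j * var k - var j * var j * var j :: ('n, 'k) mpoly)"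
    have free: "lookup s x = 0" if "s \<in> keys (var i :: ('n, 'k) mpoly)" "i \<noteq> x" for s i
      using that by (simp add: mono_poly_def lookup_var_mono)
    have sq: "lookup s x = 0" if "s \<in> keys (var j * var j :: ('n, 'k) mpoly)" for s
      by (rule keys_mult_free[OF free free that]) (use jk in simp_all)
    have "lookup s x = 0" if "s \<in> keys (var j * var j * var i :: ('n, 'k) mpoly)" "i \<noteq> x" for s i
      by (rule keys_mult_free[OF sq free that(1)]) (use that(2) in simp_all)
    then show "lookup t x = 0"
      using keys_diff_free[OF _ _ t] jk by metis
  qed (use jk in \<open>auto simp: least lookup_add lookup_var_mono\<close>)
  then show ?thesis
    using leads j tn t1 by (intro gins_not_singleton[OF spread _ least xj]) auto
qed

lemma one_component_card_ne:
  fixes \<psi> :: "'n \<Rightarrow> 'n \<Rightarrow> 'k::field_char_0"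
  assumes spread: "spread G r" and j: "pos j + r = CARD('n)" "1 < pos j"
    and base: "a \<noteq> b" "{a, b} \<in> G" "\<And>k. \<psi> a k + \<psi> b k = 0"
    and forest: "\<And>i. x < i \<Longrightarrow> i \<le> j \<Longrightarrow>
      \<exists>a b. a \<noteq> b \<and> {a, b} \<in> G \<and> (\<forall>k. \<psi> a k + \<psi> b k = (if k = i then 1 else 0))"
  shows "card (gins (edge_ideal G :: ('n, 'k) mpoly set)) \<noteq> 1"
proof -
  let ?V = "orbit_ideal (edge_ideal G) (forest_matrix x \<psi>)"
  have lead: "var_mono x + var_mono i \<in> leads lex_order ?V" if "i \<le> j" for i
    using that least base forest by (intro forest_leads[of x a b G \<psi> "{..j}"]) auto
  have "var_mono x + Poly_Mapping.single j 1 \<in> leads lex_order ?V"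
    using lead[of j] by (simp add: var_mono_def)
  then show ?thesis
    using lead by (intro gins_not_singleton[OF spread j(1) least pos_less[OF j(2)]]) auto
qed

lemma iso_not_adj: "i \<in> Iso \<Longrightarrow> i \<noteq> l \<Longrightarrow> {i, l} \<notin> G"
  using Iso by (auto simp: adj_def)

lemma reach_component:
  assumes conn: "\<And>u v. u \<notin> Iso \<Longrightarrow> v \<notin> Iso \<Longrightarrow> (u, v) \<in> (adj G)\<^sup>*"
    and "Iso \<subseteq> X" "a \<in> X" "a \<notin> Iso" "X \<noteq> UNIV"
  shows "\<exists>p\<in>X. \<exists>v. v \<notin> X \<and> {p, v} \<in> G"
proof -
  obtain v where v: "v \<notin> X" using assms(5) by auto
  then have "v \<notin> Iso" using assms(2) by blast
  from rtrancl_leaves[OF conn[OF assms(4) this] assms(3) v] show ?thesis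
    unfolding adj_def by blast
qed

text \<open>The incidence matrix of an odd cycle is invertible when 2 is, so the sums along all
  three edges of a triangle can be prescribed. This is one edge more than a tree offers and reaches
  position \<open>n - card Iso\<close>, where independent sets made of \<open>Iso\<close> and one
  further vertex suffice.\<close>

lemma triangle_component:
  assumes conn: "\<And>u v. u \<notin> Iso \<Longrightarrow> v \<notin> Iso \<Longrightarrow> (u, v) \<in> (adj G)\<^sup>*"
    and tri: "a \<noteq> b" "{a, b} \<in> G" "a \<noteq> c" "{a, c} \<in> G" "b \<noteq> c" "{b, c} \<in> G"
  shows "card (gins (edge_ideal G :: ('n, 'k::field_char_0) mpoly set)) \<noteq> 1"
proof -
  define r where "r = card Iso"
  have niso: "a \<notin> Iso" "b \<notin> Iso" "c \<notin> Iso" using tri iso_not_adj by (blast, metis insert_commute, metis insert_commute)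
  have cX: "card ({a, b, c} \<union> Iso) = r + 3" using niso tri by (simp add: r_def)
  moreover have "card ({a, b, c} \<union> Iso) \<le> CARD('n)" by (intro card_mono) auto
  ultimately have rn: "r + 3 \<le> CARD('n)" by simp
  have "1 \<le> CARD('n) - r" "CARD('n) - r \<le> CARD('n)" using rn by linarith+
  then obtain j :: 'n where j: "pos j = CARD('n) - r" using ex_pos by blast
  have spread: "spread G r" unfolding spread_def
  proof (intro exI[of _ Iso] conjI allI impI)
    fix X assume X: "Iso \<subseteq> X" "X \<noteq> UNIV"
    then obtain v where v: "v \<notin> X" by auto
    have "{i, l} \<notin> G" if "i \<in> insert v Iso" "l \<in> insert v Iso" "i \<noteq> l" for i l
      using that iso_not_adj by (metis insertE insert_commute)
    moreover have "v \<notin> Iso" using v X(1) by blast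
    then have "card (insert v Iso) = r + 1" by (simp add: r_def)
    ultimately show "\<exists>v T. v \<notin> X \<and> v \<in> T \<and> T \<subseteq> insert v X \<and> card T = r + 1 \<and>
        (\<forall>i\<in>T. \<forall>l\<in>T. i \<noteq> l \<longrightarrow> {i, l} \<notin> G)"
      using v X(1) by (intro exI[of _ v] exI[of _ "insert v Iso"]) auto
  qed (simp add: r_def)
  define J where "J = {i. x < i \<and> i \<le> j}"
  have cardJ: "card J = CARD('n) - r - 1" using pos_interval(1)[of x j] least j by (simp add: J_def)
  then have "2 \<le> card J" using rn by simp
  then obtain k l where kl: "k \<in> J" "l \<in> J" "k \<noteq> l"
    by (metis card_le_Suc0_iff_eq finite not_less_eq_eq numeral_2_eq_2)
  define X0 where "X0 = {a, b, c} \<union> Iso"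
  define e :: "'n \<Rightarrow> 'n \<Rightarrow> 'k" where "e = (\<lambda>k i. if i = k then 1 else 0)"
  \<comment> \<open>The solution with sum 0 along \<open>ab\<close>, \<open>x_k\<close> along
    \<open>ac\<close> and \<open>x_l\<close> along \<open>bc\<close>.\<close>
  define \<psi>0 :: "'n \<Rightarrow> 'n \<Rightarrow> 'k" where "\<psi>0 = (\<lambda>v i. if v = a then (e k i - e l i) / 2
      else if v = b then (e l i - e k i) / 2 else if v = c then (e k i + e l i) / 2 else 0)"
  have "card (- X0) = CARD('n) - (r + 3)" using cX by (simp add: X0_def card_Compl)
  moreover have "card (J - {k, l}) = card J - 2" using kl by (simp add: card_Diff_subset)
  ultimately have card: "card (J - {k, l}) = card (- X0)" using cardJ rn by simp
  have reach: "\<exists>p\<in>X. \<exists>v. v \<notin> X \<and> {p, v} \<in> G" if X: "X0 \<subseteq> X" "X \<noteq> UNIV" for X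
    using X niso by (intro reach_component[OF conn, of X a]) (auto simp: X0_def)
  obtain \<psi> where \<psi>: "\<And>a. a \<in> X0 \<Longrightarrow> \<psi> a = \<psi>0 a"
    "\<And>i. i \<in> J - {k, l} \<Longrightarrow> \<exists>a b. a \<noteq> b \<and> {a, b} \<in> G \<and> (\<forall>k. \<psi> a k + \<psi> b k = (if k = i then 1 else 0))"
    using grow_forest[OF card reach, of \<psi>0] by blast
  have \<psi>abc: "\<psi> a i = (e k i - e l i) / 2" "\<psi> b i = (e l i - e k i) / 2" "\<psi> c i = (e k i + e l i) / 2" for i
    using \<psi>(1) tri by (auto simp: X0_def \<psi>0_def)
  have "\<psi> a i + \<psi> b i = 0" for i by (simp add: \<psi>abc flip: add_divide_distrib)
  moreover have "\<psi> a i + \<psi> c i = e k i" "\<psi> b i + \<psi> c i = e l i" for i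
    unfolding \<psi>abc by (simp_all add: add_divide_distrib[symmetric])
  then have "\<exists>a b. a \<noteq> b \<and> {a, b} \<in> G \<and> (\<forall>k. \<psi> a k + \<psi> b k = (if k = i then 1 else 0))" if "i = k \<or> i = l" for i
    using that tri unfolding e_def by metis
  then have "\<exists>a b. a \<noteq> b \<and> {a, b} \<in> G \<and> (\<forall>k. \<psi> a k + \<psi> b k = (if k = i then 1 else 0))" if "x < i" "i \<le> j" for i
    using that \<psi>(2)[of i] by (cases "i = k \<or> i = l") (auto simp: J_def)
  ultimately show ?thesis
    using j rn tri by (intro one_component_card_ne[OF spread, of j a b \<psi>]) auto
qed

text \<open>\<open>co\<close> says that the complement graph on the non-isolated vertices is
  connected. A spanning tree, with one edge spent on the sum 0, reaches position
  \<open>n - card Iso - 1\<close>, so independent sets with two non-isolated vertices are required;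
  \<open>co\<close> supplies such a pair across every cut.\<close>

lemma co_connected_component:
  assumes conn: "\<And>u v. u \<notin> Iso \<Longrightarrow> v \<notin> Iso \<Longrightarrow> (u, v) \<in> (adj G)\<^sup>*"
    and edge: "a \<noteq> b" "{a, b} \<in> G"
    and co: "\<And>X. X - Iso \<noteq> {} \<Longrightarrow> - X - Iso \<noteq> {} \<Longrightarrow> \<exists>s\<in>X - Iso. \<exists>t\<in>- X - Iso. {s, t} \<notin> G"
  shows "card (gins (edge_ideal G :: ('n, 'k::field_char_0) mpoly set)) \<noteq> 1"
proof -
  define r where "r = card Iso + 1"
  have niso: "a \<notin> Iso" "b \<notin> Iso" using edge iso_not_adj by (blast, metis insert_commute)
  \<comment> \<open>A third non-isolated vertex guarantees \<open>r + 2 \<le> n\<close>, hence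
    \<open>pos j > 1\<close>.\<close>
  obtain c where c: "c \<noteq> a" "c \<notin> Iso" "{a, c} \<notin> G" proof -
    have "{a} - Iso \<noteq> {}" "- {a} - Iso \<noteq> {}" using niso edge by auto
    then obtain s t where "s \<in> {a} - Iso" "t \<in> - {a} - Iso" "{s, t} \<notin> G" using co by blast
    then show ?thesis using that by blast
  qed
  have "c \<noteq> b" using c edge by auto
  have "card ({a, b, c} \<union> Iso) = r + 2" using niso c edge \<open>c \<noteq> b\<close> by (simp add: r_def)
  moreover have "card ({a, b, c} \<union> Iso) \<le> CARD('n)" by (intro card_mono) auto
  ultimately have rn: "r + 2 \<le> CARD('n)" by simp
  have "1 \<le> CARD('n) - r" "CARD('n) - r \<le> CARD('n)" using rn by linarith+
  then obtain j :: 'n where j: "pos j = CARD('n) - r" using ex_pos by blast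
  have spread: "spread G r" unfolding spread_def
  proof (intro exI[of _ "insert a Iso"] conjI allI impI)
    show "card (insert a Iso) = r" using niso by (simp add: r_def)
    fix X assume X: "insert a Iso \<subseteq> X" "X \<noteq> UNIV"
    then have "X - Iso \<noteq> {}" "- X - Iso \<noteq> {}" using niso by auto
    then obtain s t where st: "s \<in> X - Iso" "t \<in> - X - Iso" "{s, t} \<notin> G" using co by blast
    have "{i, l} \<notin> G" if "i \<in> {s, t} \<union> Iso" "l \<in> {s, t} \<union> Iso" "i \<noteq> l" for i l
    proof (cases "i \<in> Iso \<or> l \<in> Iso")
      case True
      then show ?thesis using iso_not_adj[of i l] iso_not_adj[of l i] that(3) by (metis insert_commute)
    next
      case False
      then have "{i, l} = {s, t}" using that by auto
      then show ?thesis using st(3) by simp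
    qed
    moreover have "s \<noteq> t" using st by blast
    then have "card ({s, t} \<union> Iso) = r + 1" using st by (simp add: r_def)
    ultimately show "\<exists>v T. v \<notin> X \<and> v \<in> T \<and> T \<subseteq> insert v X \<and> card T = r + 1 \<and>
        (\<forall>i\<in>T. \<forall>l\<in>T. i \<noteq> l \<longrightarrow> {i, l} \<notin> G)"
      using st X(1) by (intro exI[of _ t] exI[of _ "{s, t} \<union> Iso"]) auto
  qed
  define J where "J = {i. x < i \<and> i \<le> j}"
  have cardJ: "card J = CARD('n) - r - 1" using pos_interval(1)[of x j] least j by (simp add: J_def)
  define X0 where "X0 = {a, b} \<union> Iso"
  have "card X0 = r + 1" using niso edge by (simp add: X0_def r_def)
  then have card: "card J = card (- X0)" using cardJ by (simp add: card_Compl)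
  have reach: "\<exists>p\<in>X. \<exists>v. v \<notin> X \<and> {p, v} \<in> G" if X: "X0 \<subseteq> X" "X \<noteq> UNIV" for X
    using X niso by (intro reach_component[OF conn, of X a]) (auto simp: X0_def)
  obtain \<psi> :: "'n \<Rightarrow> 'n \<Rightarrow> 'k" where \<psi>: "\<And>a. a \<in> X0 \<Longrightarrow> \<psi> a = (\<lambda>_. 0)"
    "\<And>i. i \<in> J \<Longrightarrow> \<exists>a b. a \<noteq> b \<and> {a, b} \<in> G \<and> (\<forall>k. \<psi> a k + \<psi> b k = (if k = i then 1 else 0))"
    using grow_forest[OF card reach, of "\<lambda>_ _. 0"] by blast
  have "\<psi> a k + \<psi> b k = 0" for k using \<psi>(1) by (simp add: X0_def)
  then show ?thesis
    using j rn edge \<psi>(2) by (intro one_component_card_ne[OF spread, of j a b \<psi>]) (auto simp: J_def)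
qed

end

theorem theorem1p2:
  fixes G :: "'n::{finite, linorder} set set"
  assumes "graph G"
  shows "card (gins (edge_ideal G :: ('n, 'k::field_char_0) mpoly set)) = 1
           \<longleftrightarrow> semi_complete_bipartite G"
proof
  assume single: "card (gins (edge_ideal G :: ('n, 'k) mpoly set)) = 1"
  define x where "x = Min (UNIV :: 'n set)"
  define Iso where "Iso = {v. \<forall>w. (v, w) \<notin> adj G}"
  interpret fixed_graph G x Iso by unfold_locales (simp_all add: x_def Iso_def)
  have conn: "(u, v) \<in> (adj G)\<^sup>*" if "u \<notin> Iso" "v \<notin> Iso" for u v
    using two_components[OF that] single by blast
  obtain a b where ab: "a \<noteq> b" "{a, b} \<in> G" using assms unfolding graph_def by (metis card_2_iff)
  \<comment> \<open>The complement of the nontrivial component is disconnected, so \<open>X\<close>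
    and the rest of that component are completely joined. An edge inside one side would form a
    triangle with any vertex of the other side.\<close>
  obtain X where X: "X - Iso \<noteq> {}" "- X - Iso \<noteq> {}"
      "\<And>s t. s \<in> X - Iso \<Longrightarrow> t \<in> - X - Iso \<Longrightarrow> {s, t} \<in> G"
    using co_connected_component[OF conn ab] single by blast
  have no_tri: False if "u \<noteq> v" "{u, v} \<in> G" "u \<noteq> w" "{u, w} \<in> G" "v \<noteq> w" "{v, w} \<in> G" for u v w
    using triangle_component[OF conn that] single by blast
  have "{i, j} \<in> G \<longleftrightarrow> i \<in> X - Iso \<and> j \<in> - X - Iso \<or> i \<in> - X - Iso \<and> j \<in> X - Iso" if ij: "i \<noteq> j" for i j
  proof
    assume e: "{i, j} \<in> G"
    then have "i \<notin> Iso" "j \<notin> Iso" using ij iso_not_adj by (blast, metis insert_commute)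
    moreover have False if same: "i \<in> X \<longleftrightarrow> j \<in> X"
    proof (cases "i \<in> X")
      case True
      obtain w where "w \<in> - X - Iso" using X(2) by blast
      then show ?thesis
        using no_tri[OF ij e, of w] X(3)[of i w] X(3)[of j w] True same calculation by auto
    next
      case False
      obtain w where "w \<in> X - Iso" using X(1) by blast
      then show ?thesis
        using no_tri[OF ij e, of w] X(3)[of w i] X(3)[of w j] False same calculation
        by (auto simp: insert_commute)
    qed
    ultimately show "i \<in> X - Iso \<and> j \<in> - X - Iso \<or> i \<in> - X - Iso \<and> j \<in> X - Iso" by blast
  next
    assume "i \<in> X - Iso \<and> j \<in> - X - Iso \<or> i \<in> - X - Iso \<and> j \<in> X - Iso"
    then show "{i, j} \<in> G" using X(3)[of i j] X(3)[of j i] by (auto simp: insert_commute)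
  qed
  then show "semi_complete_bipartite G"
    unfolding semi_complete_bipartite_iff[OF assms] using X(1,2)
    by (intro exI[of _ "X - Iso"] exI[of _ "- X - Iso"]) auto
next
  assume "semi_complete_bipartite G"
  then obtain P Q where PQ: "P \<inter> Q = {}"
    "\<And>i j. i \<noteq> j \<Longrightarrow> {i, j} \<in> G \<longleftrightarrow> i \<in> P \<and> j \<in> Q \<or> i \<in> Q \<and> j \<in> P"
    unfolding semi_complete_bipartite_iff[OF assms] by metis
  have "\<exists>J. \<forall>\<sigma>. term_order \<sigma> \<longrightarrow> decreasing_vars \<sigma> \<longrightarrow> gin \<sigma> (edge_ideal G :: ('n, 'k) mpoly set) = J"
  proof (cases "card P \<le> card Q")
    case True
    then show ?thesis using gin_bipartite[OF _ _ PQ(1) True PQ(2)] by blast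
  next
    case False
    then have *: "Q \<inter> P = {}" "card Q \<le> card P" using PQ(1) by auto
    have "{i, j} \<in> G \<longleftrightarrow> i \<in> Q \<and> j \<in> P \<or> i \<in> P \<and> j \<in> Q" if "i \<noteq> j" for i j
      using PQ(2)[OF that] by blast
    from gin_bipartite[OF _ _ * this] show ?thesis by blast
  qed
  then obtain J where J: "\<And>\<sigma>. term_order \<sigma> \<Longrightarrow> decreasing_vars \<sigma> \<Longrightarrow> gin \<sigma> (edge_ideal G :: ('n, 'k) mpoly set) = J"
    by blast
  \<comment> \<open>The lexicographic order shows that the set is nonempty.\<close>
  then have "gins (edge_ideal G :: ('n, 'k) mpoly set) = {J}"
    unfolding gins_def using lex_term_order lex_decreasing by blast
  then show "card (gins (edge_ideal G :: ('n, 'k) mpoly set)) = 1" by simp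
qed

end
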